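(* Let $\Bbbk$ be a field, let $\Lambda\subseteq\mathbb{N}$ be a numerical semigroup, let $R=\Bbbk\llbracket\Lambda\rrbracket$ with maximal ideal $\mathfrak{m}$, and let $G=\mathrm{gr}_{\mathfrak{m}}(R)$ be its associated graded ring. Assume that $G$ has codimension $c$ and is defined by equations of degree at most $d$, for some integers $c,d\geq 2$. If $G$ is not a complete intersection, then the multiplicity of $G$ satisfies $$e(G)\leq d^c-(d-1)d^{c-2}.$$ Furthermore, if equality holds, then $G$ is a Cohen--Macaulay almost complete intersection.
   Context: A numerical semigroup is a submonoid $\Lambda$ of $(\mathbb{N},+)$ (with $0\in\mathbb N$) such that $\mathbb{N}\setminus\Lambda$ is finite. It has a unique minimal set of generators $n_0<n_1<\cdots<n_c$. The ring $R=\Bbbk\llbracket\Lambda\rrbracket=\Bbbk\llbracket t^n : n\in\Lambda\rrbracket\subseteq\Bbbk\llbracket t\rrbracket$ is a one-dimensional Noetherian local domain with maximal ideal $\mathfrak{m}=(t^{n_0},\ldots,t^{n_c})$. Its associated graded ring is $G=\mathrm{gr}_{\mathfrak m}(R)=\bigoplus_{i\geq 0}\mathfrak{m}^i/\mathfrak{m}^{i+1}$, a standard graded $\Bbbk$-algebra. Let $P=\Bbbk[x_0,\ldots,x_c]$ be the standard graded polynomial ring, and let $P\twoheadrightarrow G$ be the surjection of graded algebras sending $x_i$ to the class of $t^{n_i}$ in $\mathfrak m/\mathfrak m^2$; its kernel $J$ is the defining ideal of $G$. The codimension of $G$ is the height of $J$, which equals $c$, i.e. the number of minimal generators of $\Lambda$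 minus one. "$G$ is defined by equations of degree at most $d$" means that $J$ is generated by homogeneous forms of degree at most $d$. $G$ is a complete intersection if $J$ is generated by a regular sequence (equivalently, minimally generated by $c$ elements), and an almost complete intersection if $J$ is minimally generated by $c+1$ elements. $e(G)$ denotes the (Hilbert--Samuel) multiplicity, or degree, of the graded algebra $G$; one has $e(G)=e(R)=n_0$. *)

theory Defs
  imports
    "HOL-Library.Poly_Mapping"
    "HOL-Library.Extended_Nat"
    "HOL-Computational_Algebra.Polynomial"
    "HOL-Computational_Algebra.Formal_Power_Series"
    "HOL-Algebra.Ideal_Product"
    "HOL-Algebra.QuotRing"
    "HOL-Algebra.Embedded_Algebras"
    "HOL-Algebra.Ring_Divisibility"
begin

section \<open>Commutative algebra\<close>

text \<open>The supremum of the lengths \<open>n\<close> of strict chains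
  \<open>q 0 \<subset> \<dots> \<subset> q n = p\<close> of prime ideals.\<close>

definition prime_height :: "('a, 'b) ring_scheme \<Rightarrow> 'a set \<Rightarrow> enat" where
  "prime_height R p = Sup {enat n | n. \<exists>q :: nat \<Rightarrow> 'a set.
     (\<forall>i\<le>n. primeideal (q i) R) \<and> (\<forall>i<n. q i \<subset> q (Suc i)) \<and> q n = p}"

definition height :: "('a, 'b) ring_scheme \<Rightarrow> 'a set \<Rightarrow> enat" where
  "height R I = Inf {prime_height R p | p. primeideal p R \<and> I \<subseteq> p}"

definition regular_sequence :: "('a, 'b) ring_scheme \<Rightarrow> 'a list \<Rightarrow> bool" where
  "regular_sequence R xs \<longleftrightarrow>
     set xs \<subseteq> carrier R \<and>
     genideal R (set xs) \<noteq> carrier R \<and>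
     (\<forall>i<length xs. \<forall>y\<in>carrier R.
        xs ! i \<otimes>\<^bsub>R\<^esub> y \<in> genideal R (set (take i xs)) \<longrightarrow>
        y \<in> genideal R (set (take i xs)))"

definition depth :: "('a, 'b) ring_scheme \<Rightarrow> 'a set \<Rightarrow> enat" where
  "depth R I = Sup {enat (length xs) | xs. regular_sequence R xs \<and> set xs \<subseteq> I}"

text \<open>For a maximal ideal \<open>M\<close> of a Noetherian ring, the depth and the height of \<open>M\<close> agree with
  the depth and the dimension of the localisation at \<open>M\<close>.\<close>

definition cohen_macaulay :: "('a, 'b) ring_scheme \<Rightarrow> bool" where
  "cohen_macaulay R \<longleftrightarrow>
     cring R \<and> noetherian_ring R \<and> (\<forall>M. maximalideal M R \<longrightarrow> depth R M = height R M)"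

definition minimally_generated_by :: "('a, 'b) ring_scheme \<Rightarrow> 'a set \<Rightarrow> nat \<Rightarrow> bool" where
  "minimally_generated_by R I n \<longleftrightarrow>
     (\<exists>S\<subseteq>carrier R. finite S \<and> card S = n \<and> I = genideal R S) \<and>
     (\<forall>S\<subseteq>carrier R. finite S \<and> I = genideal R S \<longrightarrow> n \<le> card S)"

text \<open>The next two predicates speak about \<open>P/J\<close> in terms of the defining ideal \<open>J\<close>.\<close>

definition complete_intersection :: "('a, 'b) ring_scheme \<Rightarrow> 'a set \<Rightarrow> bool" where
  "complete_intersection P J \<longleftrightarrow> (\<exists>fs. regular_sequence P fs \<and> J = genideal P (set fs))"

definition almost_complete_intersection :: "('a, 'b) ring_scheme \<Rightarrow> 'a set \<Rightarrow> bool" where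
  "almost_complete_intersection P J \<longleftrightarrow>
     (\<exists>c. height P J = enat c \<and> minimally_generated_by P J (c + 1))"


section \<open>Associated graded rings\<close>

text \<open>In the monoid \<^term>\<open>ideals_set R\<close> of ideals, the zeroth power of \<open>I\<close> is the unit ideal.\<close>

abbreviation ideal_pow :: "('a, 'b) ring_scheme \<Rightarrow> 'a set \<Rightarrow> nat \<Rightarrow> 'a set" where
  "ideal_pow R I n \<equiv> I [^]\<^bsub>ideals_set R\<^esub> n"

text \<open>An element of the direct sum of the \<open>I\<^sup>i/I\<^sup>i\<^sup>+\<^sup>1\<close> is a function \<open>g\<close> with \<open>g i\<close> a coset of
  \<open>I\<^sup>i\<^sup>+\<^sup>1\<close> in \<open>I\<^sup>i\<close>, almost always the zero coset \<open>I\<^sup>i\<^sup>+\<^sup>1\<close>. If \<open>A\<close> and \<open>B\<close> are cosets in degrees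
  \<open>i\<close> and \<open>n - i\<close>, then \<^term>\<open>rcoset_mult R (ideal_pow R I (Suc n)) A B\<close> is a single coset of
  \<open>I\<^sup>n\<^sup>+\<^sup>1\<close>, namely their product in degree \<open>n\<close>.\<close>

definition assoc_graded :: "('a, 'b) ring_scheme \<Rightarrow> 'a set \<Rightarrow> (nat \<Rightarrow> 'a set) ring" where
  "assoc_graded R I =
     \<lparr>carrier = {g. (\<forall>i. \<exists>x\<in>ideal_pow R I i. g i = ideal_pow R I (Suc i) +>\<^bsub>R\<^esub> x) \<and>
                    finite {i. g i \<noteq> ideal_pow R I (Suc i)}},
      mult = (\<lambda>g h n. finsum (R Quot ideal_pow R I (Suc n))
                (\<lambda>i. rcoset_mult R (ideal_pow R I (Suc n)) (g i) (h (n - i))) {..n}),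
      one = (\<lambda>i. if i = 0 then ideal_pow R I (Suc 0) +>\<^bsub>R\<^esub> \<one>\<^bsub>R\<^esub> else ideal_pow R I (Suc i)),
      zero = (\<lambda>i. ideal_pow R I (Suc i)),
      add = (\<lambda>g h i. g i <+>\<^bsub>R\<^esub> h i)\<rparr>"

text \<open>The class of \<open>x \<in> I\<^sup>i\<close> in \<open>I\<^sup>i/I\<^sup>i\<^sup>+\<^sup>1\<close>, as an element of the associated graded ring.\<close>

definition gr_class :: "('a, 'b) ring_scheme \<Rightarrow> 'a set \<Rightarrow> nat \<Rightarrow> 'a \<Rightarrow> (nat \<Rightarrow> 'a set)" where
  "gr_class R I i x =
     (\<lambda>j. if j = i then ideal_pow R I (Suc i) +>\<^bsub>R\<^esub> x else ideal_pow R I (Suc j))"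

text \<open>The following notions apply to graded rings whose elements are presented as the families of
  their homogeneous components, such as \<^const>\<open>assoc_graded\<close>.\<close>

definition graded_component :: "((nat \<Rightarrow> 'a), 'b) ring_scheme \<Rightarrow> nat \<Rightarrow> (nat \<Rightarrow> 'a) set" where
  "graded_component G i = {g \<in> carrier G. \<forall>j. j \<noteq> i \<longrightarrow> g j = \<zero>\<^bsub>G\<^esub> j}"

text \<open>The degree zero component is assumed to be a field.\<close>

definition hilbert_function :: "((nat \<Rightarrow> 'a), 'b) ring_scheme \<Rightarrow> nat \<Rightarrow> nat" where
  "hilbert_function G i = ring.dim G (graded_component G 0) (graded_component G i)"

text \<open>The polynomial which agrees with the length of \<open>G/G\<^sub>+\<^sup>n\<^sup>+\<^sup>1\<close> for all large \<open>n\<close>, where \<open>G\<close> is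
  standard graded. Its degree is the Krull dimension of \<open>G\<close>.\<close>

definition hilbert_samuel_poly :: "((nat \<Rightarrow> 'a), 'b) ring_scheme \<Rightarrow> rat poly" where
  "hilbert_samuel_poly G = (THE p. \<forall>\<^sub>F n in sequentially.
     poly p (of_nat n) = of_nat (\<Sum>i\<le>n. hilbert_function G i))"

definition hs_multiplicity :: "((nat \<Rightarrow> 'a), 'b) ring_scheme \<Rightarrow> rat" where
  "hs_multiplicity G =
     fact (Polynomial.degree (hilbert_samuel_poly G)) * lead_coeff (hilbert_samuel_poly G)"


section \<open>Polynomial rings\<close>

text \<open>Polynomials in the variables \<open>x\<^sub>0, \<dots>, x\<^sub>n\<^sub>-\<^sub>1\<close>; a monomial is its finitely supported exponent
  function.\<close>

definition mpoly_ring :: "nat \<Rightarrow> ((nat \<Rightarrow>\<^sub>0 nat) \<Rightarrow>\<^sub>0 'k::field) ring" where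
  "mpoly_ring n =
     \<lparr>carrier = {f. \<forall>a\<in>Poly_Mapping.keys f. Poly_Mapping.keys a \<subseteq> {..<n}},
      mult = (*), one = 1, zero = 0, add = (+)\<rparr>"

definition homogeneous :: "nat \<Rightarrow> ((nat \<Rightarrow>\<^sub>0 nat) \<Rightarrow>\<^sub>0 'k::field) \<Rightarrow> bool" where
  "homogeneous e f \<longleftrightarrow>
     (\<forall>a\<in>Poly_Mapping.keys f. (\<Sum>i\<in>Poly_Mapping.keys a. Poly_Mapping.lookup a i) = e)"

definition generated_in_degree_le :: "nat \<Rightarrow> nat \<Rightarrow> ((nat \<Rightarrow>\<^sub>0 nat) \<Rightarrow>\<^sub>0 'k::field) set \<Rightarrow> bool" where
  "generated_in_degree_le n d J \<longleftrightarrow>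
     (\<exists>S\<subseteq>carrier (mpoly_ring n). (\<forall>f\<in>S. \<exists>e\<le>d. homogeneous e f) \<and> J = genideal (mpoly_ring n) S)"

text \<open>The homomorphism to \<open>A\<close> given by \<open>\<iota>\<close> on coefficients and by \<open>x\<^sub>i \<mapsto> y i\<close> on variables.\<close>

definition mpoly_eval ::
  "('a, 'b) ring_scheme \<Rightarrow> ('k::field \<Rightarrow> 'a) \<Rightarrow> (nat \<Rightarrow> 'a) \<Rightarrow> nat \<Rightarrow> ((nat \<Rightarrow>\<^sub>0 nat) \<Rightarrow>\<^sub>0 'k) \<Rightarrow> 'a" where
  "mpoly_eval A \<iota> y n f = finsum A (\<lambda>a. \<iota> (Poly_Mapping.lookup f a) \<otimes>\<^bsub>A\<^esub>
     finprod A (\<lambda>i. y i [^]\<^bsub>A\<^esub> Poly_Mapping.lookup a i) {..<n}) (Poly_Mapping.keys f)"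


section \<open>Numerical semigroup rings\<close>

definition numerical_semigroup :: "nat set \<Rightarrow> bool" where
  "numerical_semigroup \<Lambda> \<longleftrightarrow>
     0 \<in> \<Lambda> \<and> (\<forall>a\<in>\<Lambda>. \<forall>b\<in>\<Lambda>. a + b \<in> \<Lambda>) \<and> finite (UNIV - \<Lambda>)"

inductive_set submonoid_gen :: "nat set \<Rightarrow> nat set" for A where
  zero: "0 \<in> submonoid_gen A"
| add: "a \<in> A \<Longrightarrow> s \<in> submonoid_gen A \<Longrightarrow> a + s \<in> submonoid_gen A"

definition min_gens :: "nat set \<Rightarrow> nat set" where
  "min_gens \<Lambda> = (THE A. submonoid_gen A = \<Lambda> \<and> (\<forall>B. B \<subset> A \<longrightarrow> submonoid_gen B \<noteq> \<Lambda>))"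

text \<open>The generator \<open>n\<^sub>i\<close>, in increasing order.\<close>

definition min_gen :: "nat set \<Rightarrow> nat \<Rightarrow> nat" where
  "min_gen \<Lambda> i = sorted_list_of_set (min_gens \<Lambda>) ! i"

definition semigroup_ring :: "nat set \<Rightarrow> 'k::field fps ring" where
  "semigroup_ring \<Lambda> =
     \<lparr>carrier = {f. \<forall>n. fps_nth f n \<noteq> 0 \<longrightarrow> n \<in> \<Lambda>},
      mult = (*), one = 1, zero = 0, add = (+)\<rparr>"

definition semigroup_max_ideal :: "nat set \<Rightarrow> 'k::field fps set" where
  "semigroup_max_ideal \<Lambda> = genideal (semigroup_ring \<Lambda>) {fps_X ^ n | n. n \<in> min_gens \<Lambda>}"

definition semigroup_gr :: "nat set \<Rightarrow> (nat \<Rightarrow> 'k::field fps set) ring" where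
  "semigroup_gr \<Lambda> = assoc_graded (semigroup_ring \<Lambda>) (semigroup_max_ideal \<Lambda>)"

definition semigroup_poly_ring :: "nat set \<Rightarrow> ((nat \<Rightarrow>\<^sub>0 nat) \<Rightarrow>\<^sub>0 'k::field) ring" where
  "semigroup_poly_ring \<Lambda> = mpoly_ring (card (min_gens \<Lambda>))"

definition gr_presentation ::
  "nat set \<Rightarrow> ((nat \<Rightarrow>\<^sub>0 nat) \<Rightarrow>\<^sub>0 'k::field) \<Rightarrow> (nat \<Rightarrow> 'k fps set)" where
  "gr_presentation \<Lambda> =
     mpoly_eval (semigroup_gr \<Lambda>)
       (\<lambda>a. gr_class (semigroup_ring \<Lambda>) (semigroup_max_ideal \<Lambda>) 0 (fps_const a))
       (\<lambda>i. gr_class (semigroup_ring \<Lambda>) (semigroup_max_ideal \<Lambda>) 1 (fps_X ^ min_gen \<Lambda> i))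
       (card (min_gens \<Lambda>))"

definition defining_ideal :: "nat set \<Rightarrow> ((nat \<Rightarrow>\<^sub>0 nat) \<Rightarrow>\<^sub>0 'k::field) set" where
  "defining_ideal \<Lambda> = a_kernel (semigroup_poly_ring \<Lambda>) (semigroup_gr \<Lambda>) (gr_presentation \<Lambda>)"

end

theory Submission
  imports Defs
begin

text \<open>
  Write \<open>x\<^sub>0, \<dots>, x\<^sub>m\<^sub>-\<^sub>1\<close> for the variables and \<open>n\<^sub>0 < \<dots> < n\<^sub>m\<^sub>-\<^sub>1\<close> for the generators. The associated graded ring
  has a basis indexed by the semigroup: \<open>t\<^sup>s\<close> lies in degree \<open>max_len s\<close>, the greatest length of a
  factorisation of \<open>s\<close>, and the product of two basis elements is the expected one or zero. So the
  defining ideal consists of the polynomials in which, for every \<open>s\<close>, the coefficients of the monomials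
  of value \<open>s\<close> and degree \<open>max_len s\<close> add up to zero (\<open>kernel_presentation\<close>); in particular it is generated by
  monomials and by differences of monomials of the same degree and value. The multiplicity is \<open>n\<^sub>0\<close>
  (\<open>hs_multiplicity_eq\<close>), the number of residue classes modulo \<open>n\<^sub>0\<close>.

  The bound comes from representing each residue class by a monomial in \<open>x\<^sub>1, \<dots>, x\<^sub>m\<^sub>-\<^sub>1\<close>, the one with
  the smallest \<open>\<Sum> a\<^sub>i (n\<^sub>i - n\<^sub>0)\<close>, then the largest \<open>\<Sum> a\<^sub>i (n\<^sub>i - n\<^sub>0)\<^sup>2\<close>, then the lexicographically
  smallest. Divisors of such standard monomials are standard. Since \<open>x\<^sub>i\<close> with \<open>i \<ge> 1\<close> is nilpotent in the
  graded ring, some generator of degree at most \<open>d\<close> contains a pure power \<open>x\<^sub>i\<^sup>k\<close>, and its coefficient is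
  cancelled: either \<open>k\<close> is not the greatest length, or another monomial has the same degree and value.
  The decisive point is that the square is strictly convex: among all monomials of a given degree and
  value, a pure power has the smallest \<open>\<Sum> a\<^sub>i (n\<^sub>i - n\<^sub>0)\<^sup>2\<close> (\<open>pure_power_spread\<close>). Hence \<open>x\<^sub>i\<^sup>k\<close> is never
  standard, the standard monomials lie in a box with sides at most \<open>d\<close>, and \<open>n\<^sub>0 \<le> d\<^sup>m\<^sup>-\<^sup>1\<close>.

  If some side is shorter than \<open>d\<close>, or \<open>m - 1 < c\<close>, the bound of the theorem is already strict. Otherwise
  there are equations \<open>f\<^sub>i\<close>, each equal to \<open>x\<^sub>i\<^sup>d\<close> or to \<open>x\<^sub>i\<^sup>d\<close> minus a monomial, and by the same convexity
  \<open>x\<^sub>i\<^sup>d\<close> is the leading term for one common weight. So they form a regular sequence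
  (\<open>regular_sequence_eq\<close>). If the ideal is not a complete intersection, it is larger than
  \<open>(f\<^sub>1, \<dots>, f\<^sub>m\<^sub>-\<^sub>1)\<close>, which yields a monomial \<open>u\<close> of degree at most \<open>d\<close> in the box that is not standard. No
  multiple of \<open>u\<close> is standard, and there are at least \<open>(d - 1) d\<^sup>c\<^sup>-\<^sup>2\<close> of them in the box
  (\<open>prod_diff_lower_bound\<close>).

  If equality holds, the standard monomials are exactly the box without the multiples of \<open>u\<close>. Then every
  monomial reduces modulo \<open>f\<^sub>1, \<dots>, f\<^sub>m\<^sub>-\<^sub>1\<close> and one further equation with leading term \<open>u\<close> to zero or to a
  power of \<open>x\<^sub>0\<close> times a standard monomial, so these generate the ideal. They all have the smallest degree
  \<open>d\<close> that occurs in it and are linearly independent, so there is no smaller set of generators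
  (\<open>extremal_case\<close>). Moreover \<open>x\<^sub>0\<close> becomes a nonzerodivisor, the graded ring is a finite torsion-free
  module over \<open>k[x\<^sub>0]\<close> that differs from \<open>k[x\<^sub>0]\<close> only by nilpotents, and such rings are Cohen-Macaulay
  (\<open>nilpotent_over_line\<close>).
\<close>

section \<open>Exponents and their weights\<close>

abbreviation (input) keys :: "('a \<Rightarrow>\<^sub>0 'b::zero) \<Rightarrow> 'a set" where "keys \<equiv> Poly_Mapping.keys"
abbreviation (input) lookup :: "('a \<Rightarrow>\<^sub>0 'b::zero) \<Rightarrow> 'a \<Rightarrow> 'b" where "lookup \<equiv> Poly_Mapping.lookup"
abbreviation (input) single :: "'a \<Rightarrow> 'b \<Rightarrow> ('a \<Rightarrow>\<^sub>0 'b::zero)" where "single \<equiv> Poly_Mapping.single"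

type_synonym expo = "nat \<Rightarrow>\<^sub>0 nat"

definition weight :: "(nat \<Rightarrow> nat) \<Rightarrow> expo \<Rightarrow> nat" where
  "weight w a = (\<Sum>i\<in>keys a. w i * lookup a i)"

lemma weight_superset:
  assumes "finite S" "keys a \<subseteq> S"
  shows "weight w a = (\<Sum>i\<in>S. w i * lookup a i)"
  unfolding weight_def by (rule sum.mono_neutral_left) (use assms in \<open>auto simp: in_keys_iff\<close>)

lemma weight_zero [simp]: "weight w 0 = 0"
  by (simp add: weight_def)

lemma weight_single [simp]: "weight w (single i k) = w i * k"
  by (simp add: weight_def)

lemma weight_add: "weight w (a + b) = weight w a + weight w b"
proof -
  let ?S = "keys a \<union> keys b"
  have "weight w (a + b) = (\<Sum>i\<in>?S. w i * lookup (a + b) i)"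
    by (rule weight_superset) (use keys_add[of a b] in auto)
  also have "\<dots> = (\<Sum>i\<in>?S. w i * lookup a i) + (\<Sum>i\<in>?S. w i * lookup b i)"
    by (simp add: lookup_add sum.distrib algebra_simps)
  also have "\<dots> = weight w a + weight w b"
    by (simp add: weight_superset[of ?S])
  finally show ?thesis .
qed

lemma keys_add_nat: "keys (a + b) = keys a \<union> keys (b :: expo)"
  by (auto simp: in_keys_iff lookup_add)

lemma expo_add_single_diff:
  assumes "k \<le> lookup (a :: expo) i"
  shows "a = single i k + (a - single i k)"
  by (rule poly_mapping_eqI) (use assms in \<open>auto simp: lookup_add lookup_minus lookup_single when_def\<close>)

lemma expo_le_imp_add:
  assumes "\<And>i. lookup u i \<le> lookup (a :: expo) i"
  shows "a = u + (a - u)"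
  by (rule poly_mapping_eqI) (use assms in \<open>auto simp: lookup_add lookup_minus\<close>)

lemma keys_minus_subset: "keys (a - b) \<subseteq> keys (a :: expo)"
  by (auto simp: in_keys_iff lookup_minus)

definition box :: "nat set \<Rightarrow> (nat \<Rightarrow> nat) \<Rightarrow> (nat \<Rightarrow> nat) \<Rightarrow> expo set" where
  "box S l h = {a. keys a \<subseteq> S \<and>
     (\<forall>i\<in>S. l i \<le> lookup a i \<and> lookup a i < h i)}"

lemma finite_card_box:
  assumes "finite S"
  shows "finite (box S l h)" "card (box S l h) = (\<Prod>i\<in>S. h i - l i)"
proof -
  let ?f = "\<lambda>a. restrict (lookup a) S"
  have inj: "inj_on ?f (box S l h)"
  proof (rule inj_onI)
    fix a b assume a: "a \<in> box S l h" and b: "b \<in> box S l h" and eq: "?f a = ?f b"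
    show "a = b"
    proof (rule poly_mapping_eqI)
      fix i show "lookup a i = lookup b i"
      proof (cases "i \<in> S")
        case True then show ?thesis using fun_cong[OF eq, of i] by simp
      next
        case False
        then have "i \<notin> keys a" "i \<notin> keys b" using a b by (auto simp: box_def)
        then show ?thesis by (simp add: in_keys_iff)
      qed
    qed
  qed
  have im: "?f ` box S l h = PiE S (\<lambda>i. {l i..<h i})"
  proof
    show "?f ` box S l h \<subseteq> PiE S (\<lambda>i. {l i..<h i})" by (auto simp: box_def)
    show "PiE S (\<lambda>i. {l i..<h i}) \<subseteq> ?f ` box S l h"
    proof
      fix g assume g: "g \<in> PiE S (\<lambda>i. {l i..<h i})"
      define a where "a = Abs_poly_mapping (\<lambda>i. if i \<in> S then g i else 0)"
      have fin: "finite {i. (if i \<in> S then g i else 0) \<noteq> 0}"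
        by (rule finite_subset[OF _ assms]) auto
      have la: "lookup a i = (if i \<in> S then g i else 0)" for i
        using fin by (simp add: a_def lookup_Abs_poly_mapping)
      have "a \<in> box S l h" using g by (auto simp: box_def in_keys_iff la)
      moreover have "?f a = g" using g by (auto simp: la fun_eq_iff)
      ultimately show "g \<in> ?f ` box S l h" by blast
    qed
  qed
  have bij: "bij_betw ?f (box S l h) (PiE S (\<lambda>i. {l i..<h i}))"
    using inj im by (simp add: bij_betw_def)
  have "finite (PiE S (\<lambda>i. {l i..<h i}))" using assms by (intro finite_PiE) auto
  then show "finite (box S l h)" using bij_betw_finite[OF bij] by simp
  show "card (box S l h) = (\<Prod>i\<in>S. h i - l i)"
    using bij_betw_same_card[OF bij] assms by (simp add: card_PiE)
qed

lemma finite_weight_eq: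
  assumes "finite S" "\<And>i. i \<in> S \<Longrightarrow> 0 < w i"
  shows "finite {a. keys a \<subseteq> S \<and> weight w a = N}"
proof (rule finite_subset)
  show "{a. keys a \<subseteq> S \<and> weight w a = N} \<subseteq> box S (\<lambda>_. 0) (\<lambda>_. Suc N)"
  proof
    fix a assume a: "a \<in> {a. keys a \<subseteq> S \<and> weight w a = N}"
    have "lookup a i \<le> N" if i: "i \<in> S" for i
    proof -
      have "lookup a i \<le> w i * lookup a i" using assms(2)[OF i] by simp
      also have "\<dots> \<le> (\<Sum>i\<in>S. w i * lookup a i)"
        by (rule member_le_sum) (use assms i in auto)
      also have "\<dots> = N" using a weight_superset[OF assms(1), of a w] by simp
      finally show ?thesis .
    qed
    then show "a \<in> box S (\<lambda>_. 0) (\<lambda>_. Suc N)" using a by (auto simp: box_def less_Suc_eq_le)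
  qed
  show "finite (box S (\<lambda>_. 0) (\<lambda>_. Suc N))" using finite_card_box assms(1) by blast
qed

text \<open>A Weierstrass product inequality: spreading a sum over several factors makes the product
  \<open>\<Prod>(d - u\<^sub>i)\<close> larger than concentrating it in one factor.\<close>

lemma power_times_diff_le_prod_diff:
  fixes d :: int
  assumes "finite S" "S \<noteq> {}" "\<And>i. i \<in> S \<Longrightarrow> 0 \<le> u i" "sum u S \<le> d"
  shows "d ^ (card S - 1) * (d - sum u S) \<le> (\<Prod>i\<in>S. d - u i)"
  using assms
proof (induction S rule: finite_ne_induct)
  case (singleton x) then show ?case by simp
next
  case (insert x F)
  have nn: "0 \<le> u x" "0 \<le> sum u F" using insert by (auto intro: sum_nonneg)
  have sum: "u x + sum u F \<le> d" using insert by simp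
  have IH: "d ^ (card F - 1) * (d - sum u F) \<le> (\<Prod>i\<in>F. d - u i)"
  proof (rule insert.IH)
    show "sum u F \<le> d" using nn(1) sum by linarith
  qed (use insert.prems in auto)
  obtain k where k: "card F = Suc k" using insert by (cases "card F") auto
  have "d ^ (card (insert x F) - 1) * (d - sum u (insert x F))
      = d ^ (card F - 1) * (d * (d - u x - sum u F))"
    using insert.hyps by (simp add: k diff_diff_eq mult_ac)
  also have "\<dots> \<le> d ^ (card F - 1) * ((d - u x) * (d - sum u F))"
  proof (rule mult_left_mono)
    have "0 \<le> u x * sum u F" using nn by simp
    then show "d * (d - u x - sum u F) \<le> (d - u x) * (d - sum u F)" by (simp add: algebra_simps)
    show "0 \<le> d ^ (card F - 1)" using nn sum by simp
  qed
  also have "\<dots> = (d - u x) * (d ^ (card F - 1) * (d - sum u F))" by (simp add: mult_ac)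
  also have "\<dots> \<le> (d - u x) * (\<Prod>i\<in>F. d - u i)"
    by (rule mult_left_mono[OF IH]) (use nn sum in simp)
  finally show ?case using insert by simp
qed

text \<open>The number of multiples of \<open>x\<^sup>u\<close> in the box of side \<open>d\<close> is \<open>\<Prod>(d - u\<^sub>i)\<close>. It is smallest for
  \<open>x\<^sub>i\<^sup>d\<^sup>-\<^sup>1 x\<^sub>j\<close>, which gives the correction term of the theorem.\<close>

lemma prod_diff_lower_bound:
  fixes u :: "nat \<Rightarrow> nat"
  assumes S: "finite S" "2 \<le> card S" and d: "1 \<le> d"
    and u: "\<And>i. i \<in> S \<Longrightarrow> u i < d" and sum: "sum u S \<le> d"
  shows "(d - 1) * d ^ (card S - 2) \<le> (\<Prod>i\<in>S. d - u i)"
    and "sum u S < d \<Longrightarrow> (d - 1) * d ^ (card S - 2) < (\<Prod>i\<in>S. d - u i)"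
proof -
  have ne: "S \<noteq> {}" using S by auto
  have cS: "card S - 1 = Suc (card S - 2)" using S by simp
  define D :: int where "D = int d"
  have pr: "int (\<Prod>i\<in>S. d - u i) = (\<Prod>i\<in>S. D - int (u i))"
    unfolding of_nat_prod D_def using u by (intro prod.cong) (auto simp: of_nat_diff less_imp_le)
  have lhs: "int ((d - 1) * d ^ (card S - 2)) = (D - 1) * D ^ (card S - 2)"
    using d by (simp add: D_def of_nat_diff)
  have main: "D ^ (card S - 1) * (D - (\<Sum>i\<in>S. int (u i))) \<le> (\<Prod>i\<in>S. D - int (u i))"
    using S ne sum by (intro power_times_diff_le_prod_diff) (auto simp: D_def of_nat_sum[symmetric] simp del: of_nat_sum)
  show strict: "(d - 1) * d ^ (card S - 2) < (\<Prod>i\<in>S. d - u i)" if lt: "sum u S < d"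
  proof -
    have "int (\<Sum>i\<in>S. u i) < D" using lt unfolding D_def by (simp only: of_nat_less_iff)
    then have "1 \<le> D - (\<Sum>i\<in>S. int (u i))" by simp
    then have "D ^ (card S - 1) * 1 \<le> D ^ (card S - 1) * (D - (\<Sum>i\<in>S. int (u i)))"
      by (intro mult_left_mono) (auto simp: D_def)
    moreover have "(D - 1) * D ^ (card S - 2) < D ^ (card S - 1)"
      unfolding cS power_Suc using d by (intro mult_strict_right_mono) (auto simp: D_def)
    ultimately have "int ((d - 1) * d ^ (card S - 2)) < int (\<Prod>i\<in>S. d - u i)"
      unfolding pr lhs using main by linarith
    then show ?thesis by (simp only: of_nat_less_iff)
  qed
  show "(d - 1) * d ^ (card S - 2) \<le> (\<Prod>i\<in>S. d - u i)"
  proof (cases "sum u S < d")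
    case True then show ?thesis using strict by simp
  next
    case False
    then have eq: "sum u S = d" using sum by simp
    then obtain i where i: "i \<in> S" "0 < u i"
    proof -
      have "sum u S \<noteq> 0" using eq d by simp
      then obtain i where "i \<in> S" "u i \<noteq> 0" using S(1) by auto
      then show ?thesis using that by auto
    qed
    have s': "(\<Sum>j\<in>S - {i}. int (u j)) = D - int (u i)"
      using sum.remove[OF S(1) i(1), of "\<lambda>j. int (u j)"] eq unfolding D_def by (metis add_diff_cancel_left' of_nat_sum)
    \<comment> \<open>Separate one variable that occurs: the others carry the remaining degree \<open>d - u i\<close>.\<close>
    have ui: "u i < d" using u i by simp
    have card': "card (S - {i}) - 1 = card S - 2" using i S by simp
    have "card (S - {i}) \<noteq> 0" using i(1) S by (simp add: card_Diff_singleton)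
    then have ne': "S - {i} \<noteq> {}" by force
    have "D ^ (card (S - {i}) - 1) * (D - (\<Sum>j\<in>S - {i}. int (u j))) \<le> (\<Prod>j\<in>S - {i}. D - int (u j))"
      using S ne' s' ui by (intro power_times_diff_le_prod_diff) auto
    then have "D ^ (card S - 2) * int (u i) \<le> (\<Prod>j\<in>S - {i}. D - int (u j))"
      unfolding card' s' by simp
    then have "(D - int (u i)) * (D ^ (card S - 2) * int (u i)) \<le> (D - int (u i)) * (\<Prod>j\<in>S - {i}. D - int (u j))"
      using ui by (intro mult_left_mono) (auto simp: D_def)
    also have "\<dots> = (\<Prod>j\<in>S. D - int (u j))" using S i by (simp add: prod.remove)
    finally have A: "(D - int (u i)) * int (u i) * D ^ (card S - 2) \<le> (\<Prod>j\<in>S. D - int (u j))"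
      by (simp add: mult_ac)
    have "0 \<le> (int (u i) - 1) * (D - int (u i) - 1)" using i ui by (auto simp: D_def)
    then have "D - 1 \<le> (D - int (u i)) * int (u i)" by (simp add: algebra_simps)
    then have "(D - 1) * D ^ (card S - 2) \<le> (D - int (u i)) * int (u i) * D ^ (card S - 2)"
      by (intro mult_right_mono) (auto simp: D_def)
    then have "int ((d - 1) * d ^ (card S - 2)) \<le> int (\<Prod>i\<in>S. d - u i)"
      unfolding pr lhs using A by linarith
    then show ?thesis by (simp only: of_nat_le_iff)
  qed
qed

section \<open>Numerical semigroups and standard exponents\<close>

definition deg :: "expo \<Rightarrow> nat" where "deg = weight (\<lambda>_. 1)"

lemma deg_zero [simp]: "deg 0 = 0"
  by (simp add: deg_def)

lemma deg_single [simp]: "deg (single i k) = k"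
  by (simp add: deg_def)

lemma deg_add: "deg (a + b) = deg a + deg b"
  by (simp add: deg_def weight_add)

lemma deg_superset:
  "finite S \<Longrightarrow> keys a \<subseteq> S \<Longrightarrow> deg a = (\<Sum>i\<in>S. lookup a i)"
  by (simp add: deg_def weight_superset)

text \<open>The exponent after dehomogenising at \<open>x\<^sub>0 = 1\<close>.\<close>

definition drop0 :: "expo \<Rightarrow> expo" where
  "drop0 a = a - single 0 (lookup a 0)"

lemma lookup_drop0: "lookup (drop0 a) i = (if i = 0 then 0 else lookup a i)"
  by (simp add: drop0_def lookup_minus lookup_single when_def)

lemma drop0_split: "a = drop0 a + single 0 (lookup a 0)"
  by (rule poly_mapping_eqI) (simp add: lookup_add lookup_drop0 lookup_single when_def)

lemma drop0_add: "drop0 (a + b) = drop0 a + drop0 b"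
  by (rule poly_mapping_eqI) (simp add: lookup_add lookup_drop0)

lemma drop0_single0 [simp]: "drop0 (single 0 k) = 0"
  by (rule poly_mapping_eqI) (simp add: lookup_drop0 lookup_single when_def)

lemma drop0_id: "lookup a 0 = 0 \<Longrightarrow> drop0 a = a"
  by (rule poly_mapping_eqI) (simp add: lookup_drop0)

lemma drop0_drop0 [simp]: "drop0 (drop0 a) = drop0 a"
  by (simp add: drop0_id lookup_drop0)

lemma deg_drop0_eqD:
  assumes "drop0 a = drop0 b" "deg a = deg b" shows "a = b"
proof -
  have "deg a = deg (drop0 a) + lookup a 0" "deg b = deg (drop0 b) + lookup b 0"
    using drop0_split[of a] drop0_split[of b] by (metis deg_add deg_single)+
  then have "lookup a 0 = lookup b 0" using assms by simp
  then show ?thesis using drop0_split[of a] drop0_split[of b] assms by simp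
qed

locale monoid_generators =
  fixes n :: "nat \<Rightarrow> nat" and m :: nat
  assumes m_pos: "0 < m"
    and n_mono: "\<And>i j. i < j \<Longrightarrow> j < m \<Longrightarrow> n i < n j"
    and n0_pos: "0 < n 0"
    and cofinite: "finite (UNIV - weight n ` {a. keys a \<subseteq> {..<m}})"
begin

definition exps :: "expo set" where
  "exps = {a. keys a \<subseteq> {..<m}}"

abbreviation val :: "expo \<Rightarrow> nat" where "val \<equiv> weight n"

definition sgp :: "nat set" where "sgp = val ` exps"

definition max_len :: "nat \<Rightarrow> nat" where
  "max_len s = Max (deg ` {a \<in> exps. val a = s})"

text \<open>Modulo \<open>n 0\<close>, multiplying by \<open>x\<^sub>0\<close> does nothing, so the weights below ignore \<open>x\<^sub>0\<close>. For
  exponents of equal value, a smaller excess means a longer factorisation.\<close>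

definition excess :: "expo \<Rightarrow> nat" where "excess = weight (\<lambda>i. n i - n 0)"

definition spread :: "expo \<Rightarrow> nat" where "spread = weight (\<lambda>i. (n i - n 0)^2)"

text \<open>Larger spread comes first. This makes every pure power a leading monomial; the lexicographic
  comparison only breaks ties.\<close>

definition prec :: "expo \<Rightarrow> expo \<Rightarrow> bool" (infix "\<prec>" 50) where
  "a \<prec> b \<longleftrightarrow> excess a < excess b \<or> excess a = excess b \<and>
     (spread b < spread a \<or> spread a = spread b \<and> drop0 a < drop0 b)"

text \<open>Standard exponents represent residue classes modulo \<open>n 0\<close>; normal exponents represent the
  elements of the semigroup and give a basis of the associated graded ring.\<close>

definition standard :: "expo \<Rightarrow> bool" where
  "standard a \<longleftrightarrow> (\<forall>b\<in>exps. val b mod n 0 = val a mod n 0 \<longrightarrow> \<not> b \<prec> a)"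

definition normal :: "expo \<Rightarrow> bool" where
  "normal a \<longleftrightarrow> deg a = max_len (val a) \<and>
     (\<forall>b\<in>exps. deg b = deg a \<and> val b = val a \<longrightarrow> \<not> b \<prec> a)"

definition std :: "expo set" where
  "std = {b \<in> exps. lookup b 0 = 0 \<and> standard b}"

lemma n_ge: "i < m \<Longrightarrow> n 0 \<le> n i"
  using n_mono[of 0 i] by (cases i) auto

lemma n_pos: "i < m \<Longrightarrow> 0 < n i"
  using n_ge n0_pos by (meson less_le_trans)

lemma n_inj: "i < m \<Longrightarrow> j < m \<Longrightarrow> n i = n j \<Longrightarrow> i = j"
  by (metis linorder_neqE_nat n_mono nat_neq_iff)

lemma n_gt: "0 < i \<Longrightarrow> i < m \<Longrightarrow> n 0 < n i"
  using n_mono by blast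

lemma exps_zero [simp]: "0 \<in> exps"
  by (simp add: exps_def)

lemma exps_add_iff: "a + b \<in> exps \<longleftrightarrow> a \<in> exps \<and> b \<in> exps"
  by (simp add: exps_def keys_add_nat)

lemma exps_single [simp]: "i < m \<Longrightarrow> single i k \<in> exps"
  by (simp add: exps_def)

lemma exps_minus: "a \<in> exps \<Longrightarrow> a - b \<in> exps"
  using keys_minus_subset[of a b] by (auto simp: exps_def)

lemma exps_drop0 [simp]: "drop0 a \<in> exps \<longleftrightarrow> a \<in> exps"
  using drop0_split[of a] m_pos by (metis exps_add_iff exps_single)

lemma val_eq: assumes "a \<in> exps" shows "val a = excess a + n 0 * deg a"
proof -
  have "val a = (\<Sum>i<m. n i * lookup a i)"
    using assms by (intro weight_superset) (auto simp: exps_def)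
  also have "\<dots> = (\<Sum>i<m. (n i - n 0) * lookup a i + n 0 * lookup a i)"
    using n_ge by (intro sum.cong) (auto simp flip: distrib_right)
  also have "\<dots> = excess a + n 0 * deg a"
    unfolding excess_def using assms
    by (simp add: sum.distrib sum_distrib_left weight_superset[of "{..<m}" a] deg_superset[of "{..<m}" a] exps_def)
  finally show ?thesis .
qed

lemma excess_add: "excess (a + b) = excess a + excess b"
  by (simp add: excess_def weight_add)
lemma spread_add: "spread (a + b) = spread a + spread b"
  by (simp add: spread_def weight_add)
lemma excess_single0 [simp]: "excess (single 0 k) = 0"
  by (simp add: excess_def)
lemma spread_single0 [simp]: "spread (single 0 k) = 0"
  by (simp add: spread_def)

lemma excess_drop0 [simp]: "excess (drop0 a) = excess a"
  using excess_add[of "drop0 a"] drop0_split[of a] by (metis add.right_neutral excess_single0)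
lemma spread_drop0 [simp]: "spread (drop0 a) = spread a"
  using spread_add[of "drop0 a"] drop0_split[of a] by (metis add.right_neutral spread_single0)

lemma val_drop0_mod [simp]: "val (drop0 a) mod n 0 = val a mod n 0"
  using weight_add[of n "drop0 a"] drop0_split[of a] by (metis mod_mult_self2 weight_single)

lemma finite_fibre: "finite {a \<in> exps. val a = s}"
  using finite_weight_eq[of "{..<m}" n s] n_pos by (auto simp: exps_def)

lemma max_len_ge: "a \<in> exps \<Longrightarrow> deg a \<le> max_len (val a)"
  unfolding max_len_def by (rule Max_ge) (use finite_fibre[of "val a"] in auto)

lemma max_len_attained:
  assumes "s \<in> sgp" obtains a where "a \<in> exps" "val a = s" "deg a = max_len s"
proof -
  have "max_len s \<in> deg ` {a \<in> exps. val a = s}"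
    unfolding max_len_def by (rule Max_in) (use finite_fibre[of s] assms in \<open>auto simp: sgp_def\<close>)
  then show ?thesis using that by auto
qed

lemma val_sgp: "a \<in> exps \<Longrightarrow> val a \<in> sgp"
  by (simp add: sgp_def)

lemma sgp_add: "s \<in> sgp \<Longrightarrow> t \<in> sgp \<Longrightarrow> s + t \<in> sgp"
  by (auto simp: sgp_def weight_add[symmetric] exps_add_iff intro!: imageI)

lemma sgp_zero [simp]: "0 \<in> sgp"
  using val_sgp[of 0] by simp

lemma max_len_add: assumes "s \<in> sgp" "t \<in> sgp" shows "max_len s + max_len t \<le> max_len (s + t)"
proof -
  obtain a b where a: "a \<in> exps" "val a = s" "deg a = max_len s" and b: "b \<in> exps" "val b = t" "deg b = max_len t"
    using max_len_attained assms by metis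
  have "deg (a + b) \<le> max_len (val (a + b))" by (rule max_len_ge) (use a b in \<open>simp add: exps_add_iff\<close>)
  then show ?thesis using a b by (simp add: weight_add deg_add)
qed

lemma max_len_mult_le: "s \<in> sgp \<Longrightarrow> n 0 * max_len s \<le> s"
  by (metis le_add2 max_len_attained val_eq)

subsection \<open>The order on exponents\<close>

lemma prec_irrefl: "\<not> a \<prec> a"
  by (simp add: prec_def)
lemma prec_trans: "a \<prec> b \<Longrightarrow> b \<prec> c \<Longrightarrow> a \<prec> c"
  by (auto simp: prec_def)
lemma prec_asym: "a \<prec> b \<Longrightarrow> \<not> b \<prec> a"
  using prec_irrefl prec_trans by blast
lemma prec_total: "drop0 a \<noteq> drop0 b \<Longrightarrow> a \<prec> b \<or> b \<prec> a"
  by (auto simp: prec_def)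
lemma prec_add: "a \<prec> b \<Longrightarrow> a + c \<prec> b + c"
  by (auto simp: prec_def excess_add spread_add drop0_add)
lemma prec_drop0 [simp]: "drop0 a \<prec> b \<longleftrightarrow> a \<prec> b" "a \<prec> drop0 b \<longleftrightarrow> a \<prec> b"
  by (simp_all add: prec_def)

lemma prec_minimal:
  assumes "finite A" "A \<noteq> {}" obtains a where "a \<in> A" "\<And>b. b \<in> A \<Longrightarrow> \<not> b \<prec> a"
proof -
  have wf: "wf {(a, b). a \<in> A \<and> b \<in> A \<and> a \<prec> b}"
  proof (rule finite_acyclic_wf)
    show "finite {(a, b). a \<in> A \<and> b \<in> A \<and> a \<prec> b}"
      by (rule finite_subset[of _ "A \<times> A"]) (use assms in auto)
    have "trans {(a, b). a \<in> A \<and> b \<in> A \<and> a \<prec> b}" by (auto intro!: transI dest: prec_trans)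
    then show "acyclic {(a, b). a \<in> A \<and> b \<in> A \<and> a \<prec> b}"
      by (auto simp: acyclic_def trancl_id prec_irrefl)
  qed
  show ?thesis
  proof (rule wfE_min'[OF wf assms(2)])
    fix z assume z: "z \<in> A" and min: "\<And>y. (y, z) \<in> {(a, b). a \<in> A \<and> b \<in> A \<and> a \<prec> b} \<Longrightarrow> y \<notin> A"
    show ?thesis
    proof (rule that[OF z])
      fix b assume "b \<in> A" then show "\<not> b \<prec> z"
        using min[of b] z unfolding mem_Collect_eq case_prod_conv by iprover
    qed
  qed
qed

lemma standard_drop0 [simp]: "standard (drop0 a) \<longleftrightarrow> standard a"
  by (simp add: standard_def)

text \<open>The order is compatible with multiplication, so the nonstandard monomials form a monomial ideal.\<close>

lemma not_standard_add:
  assumes "\<not> standard a" "e \<in> exps" shows "\<not> standard (a + e)"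
proof -
  obtain b where b: "b \<in> exps" "val b mod n 0 = val a mod n 0" "b \<prec> a" using assms by (auto simp: standard_def)
  have "val (b + e) mod n 0 = val (a + e) mod n 0"
    using mod_add_cong[OF b(2) refl] by (simp add: weight_add)
  then show ?thesis using b prec_add[OF b(3)] assms(2) by (auto simp: standard_def exps_add_iff)
qed

text \<open>\<open>val a = excess a + n 0 * deg a\<close>: a longer factorisation of the same value has smaller excess.\<close>

lemma longer_imp_not_standard:
  assumes "a \<in> exps" "deg a < max_len (val a)" shows "\<not> standard a"
proof -
  obtain b where b: "b \<in> exps" "val b = val a" "deg b = max_len (val a)"
    using max_len_attained[OF val_sgp[OF assms(1)]] by blast
  have "n 0 * deg a < n 0 * deg b" using assms b n0_pos by simp
  then have "excess b < excess a" using val_eq[OF b(1)] val_eq[OF assms(1)] b(2) by linarith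
  then have "b \<prec> a" by (simp add: prec_def)
  then show ?thesis unfolding standard_def using b by metis
qed

lemma standard_imp_normal:
  assumes "a \<in> exps" "standard a" shows "normal a"
proof -
  have "deg a = max_len (val a)"
    using max_len_ge[OF assms(1)] longer_imp_not_standard[OF assms(1)] assms(2) by fastforce
  then show ?thesis using assms(2) by (auto simp: normal_def standard_def)
qed

lemma not_normal_cases:
  assumes "a \<in> exps" "\<not> normal a"
  obtains "deg a < max_len (val a)"
  | b where "b \<in> exps" "deg b = deg a" "val b = val a" "b \<prec> a"
  using assms max_len_ge[OF assms(1)] by (fastforce simp: normal_def)

lemma preceded_imp_not_standard:
  assumes "b \<in> exps" "deg b = deg a" "val b = val a" "b \<prec> a" shows "\<not> standard a"
  unfolding standard_def using assms by metis

lemma normal_exists: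
  assumes "s \<in> sgp" obtains a where "a \<in> exps" "val a = s" "normal a"
proof -
  obtain a0 where a0: "a0 \<in> exps" "val a0 = s" "deg a0 = max_len s" using max_len_attained assms by blast
  let ?A = "{a \<in> exps. val a = s \<and> deg a = max_len s}"
  have "finite ?A" by (rule finite_subset[OF _ finite_fibre[of s]]) auto
  moreover have "?A \<noteq> {}" using a0 by auto
  ultimately obtain a where "a \<in> ?A" "\<And>b. b \<in> ?A \<Longrightarrow> \<not> b \<prec> a" using prec_minimal by blast
  then show ?thesis using that[of a] by (auto simp: normal_def)
qed

lemma normal_unique:
  assumes "a \<in> exps" "b \<in> exps" "normal a" "normal b" "val a = val b" shows "a = b"
proof -
  have "deg a = deg b" using assms by (simp add: normal_def)
  moreover have "drop0 a = drop0 b"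
    using prec_total[of a b] assms calculation by (auto simp: normal_def)
  ultimately show ?thesis using deg_drop0_eqD by blast
qed

text \<open>View an exponent of degree \<open>k\<close> as a distribution of mass \<open>k\<close> on the generators. Value and degree fix
  its mean, and the spread is its second moment; a pure power is the distribution without variance.\<close>

lemma pure_power_spread:
  assumes i: "i < m" and b: "b \<in> exps" "deg b = k" "val b = n i * k" "b \<noteq> single i k"
  shows "excess b = excess (single i k)" "spread (single i k) < spread b"
proof -
  define w where "w j = int (n j - n 0)" for j
  define \<beta> where "\<beta> j = int (lookup b j)" for j
  have keys: "keys b \<subseteq> {..<m}" using b by (simp add: exps_def)
  show ex: "excess b = excess (single i k)"
    using val_eq[OF b(1)] val_eq[of "single i k"] i b by simp
  have s0: "(\<Sum>j<m. \<beta> j) = int k"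
    using deg_superset[of "{..<m}" b] keys b(2) by (simp add: \<beta>_def flip: of_nat_sum)
  have s1: "(\<Sum>j<m. w j * \<beta> j) = w i * int k"
    using weight_superset[of "{..<m}" b "\<lambda>i. n i - n 0"] keys ex
    unfolding excess_def w_def \<beta>_def by (simp flip: of_nat_sum of_nat_mult)
  have s2: "(\<Sum>j<m. (w j)^2 * \<beta> j) = int (spread b)"
    unfolding spread_def w_def \<beta>_def by (simp add: weight_superset[of "{..<m}" b, OF _ keys])
  obtain j where j: "j < m" "j \<noteq> i" "0 < lookup b j"
  proof (rule ccontr)
    assume neg: "\<not> thesis"
    have z: "lookup b j = 0" if "j \<noteq> i" for j
    proof (cases "j < m")
      case True then show ?thesis using that neg \<open>\<And>j. \<lbrakk>j < m; j \<noteq> i; 0 < lookup b j\<rbrakk> \<Longrightarrow> thesis\<close> by blast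
    next
      case False then show ?thesis using keys by (auto simp: in_keys_iff)
    qed
    then have "b = single i (lookup b i)"
      by (intro poly_mapping_eqI) (auto simp: lookup_single when_def)
    then show False using b by (metis deg_single)
  qed
  \<comment> \<open>The variance is positive because \<open>b\<close> involves some variable other than \<open>x\<^sub>i\<close>.\<close>
  have "0 < (\<Sum>j<m. \<beta> j * (w j - w i)^2)"
  proof (rule sum_pos2[of _ j])
    have "w j \<noteq> w i"
      using n_inj[OF j(1) i] j(2) n_ge[OF j(1)] n_ge[OF i] by (auto simp: w_def)
    then show "0 < \<beta> j * (w j - w i)^2" using j by (simp add: \<beta>_def)
  qed (use j in \<open>auto simp: \<beta>_def\<close>)
  also have "(\<Sum>j<m. \<beta> j * (w j - w i)^2)
      = (\<Sum>j<m. (w j)^2 * \<beta> j) - 2 * w i * (\<Sum>j<m. w j * \<beta> j) + (w i)^2 * (\<Sum>j<m. \<beta> j)"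
    by (simp add: sum_distrib_left sum.distrib sum_subtractf power2_eq_square algebra_simps)
  also have "\<dots> = int (spread b) - int (spread (single i k))"
    unfolding s0 s1 s2 by (simp add: spread_def w_def power2_eq_square)
  finally show "spread (single i k) < spread b" by simp
qed

lemma pure_power_greatest:
  assumes "i < m" "b \<in> exps" "deg b = k" "val b = n i * k" "b \<noteq> single i k"
  shows "b \<prec> single i k"
  using pure_power_spread[OF assms] by (simp add: prec_def)

subsection \<open>Counting residue classes\<close>

text \<open>Every class contains semigroup elements, since almost all numbers are in the semigroup. Only
  finitely many monomials in \<open>x\<^sub>1, \<dots>, x\<^sub>m\<^sub>-\<^sub>1\<close> have a given excess, so a smallest one exists.\<close>

lemma residue_in_std:
  assumes "r < n 0" obtains b where "b \<in> std" "val b mod n 0 = r"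
proof -
  have "infinite {s. s mod n 0 = r}"
  proof -
    have "range (\<lambda>k. r + n 0 * k) \<subseteq> {s. s mod n 0 = r}" using assms by auto
    moreover have "inj (\<lambda>k. r + n 0 * k)" using n0_pos by (auto intro!: injI)
    ultimately show ?thesis using finite_subset range_inj_infinite by blast
  qed
  then have "infinite ({s. s mod n 0 = r} \<inter> sgp)"
  proof -
    have "{s. s mod n 0 = r} \<subseteq> ({s. s mod n 0 = r} \<inter> sgp) \<union> (UNIV - sgp)" by blast
    moreover have "finite (UNIV - sgp)" using cofinite by (simp add: sgp_def exps_def)
    ultimately show ?thesis using \<open>infinite {s. s mod n 0 = r}\<close> finite_subset by (metis finite_Un)
  qed
  then obtain s where "s \<in> sgp" "s mod n 0 = r" by (metis (mono_tags, lifting) Int_iff finite.emptyI ex_in_conv mem_Collect_eq)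
  then obtain a where a: "a \<in> exps" "val a mod n 0 = r" by (auto simp: sgp_def)
  define C where "C = {b \<in> exps. lookup b 0 = 0 \<and> val b mod n 0 = r}"
  have aC: "drop0 a \<in> C" using a by (simp add: C_def lookup_drop0)
  define M where "M = (LEAST k. \<exists>b\<in>C. excess b = k)"
  have ex: "\<exists>b\<in>C. excess b = M" unfolding M_def by (rule LeastI_ex) (use aC in blast)
  have least: "M \<le> excess b" if "b \<in> C" for b
    unfolding M_def by (rule Least_le) (use that in blast)
  let ?A = "{b \<in> C. excess b = M}"
  have "finite ?A"
  proof (rule finite_subset)
    show "finite {b. keys b \<subseteq> {1..<m} \<and> excess b = M}"
      unfolding excess_def by (rule finite_weight_eq) (use n_gt in auto)
    show "?A \<subseteq> {b. keys b \<subseteq> {1..<m} \<and> excess b = M}"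
    proof
      fix b assume b: "b \<in> ?A"
      have "x \<in> {1..<m}" if x: "x \<in> keys b" for x
      proof -
        have "x \<noteq> 0" using b x by (cases "x = 0") (auto simp: C_def in_keys_iff)
        moreover have "x < m" using b x by (auto simp: C_def exps_def)
        ultimately show ?thesis by auto
      qed
      then show "b \<in> {b. keys b \<subseteq> {1..<m} \<and> excess b = M}" using b by blast
    qed
  qed
  then obtain b where b: "b \<in> ?A" "\<And>b'. b' \<in> ?A \<Longrightarrow> \<not> b' \<prec> b"
    using prec_minimal ex by (metis (mono_tags, lifting) empty_iff mem_Collect_eq)
  have "standard b"
    unfolding standard_def
  proof (intro ballI impI notI)
    fix b' assume b': "b' \<in> exps" "val b' mod n 0 = val b mod n 0" "b' \<prec> b"
    have C': "drop0 b' \<in> C" using b' b by (simp add: C_def lookup_drop0)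
    then have "M \<le> excess b'" using least by fastforce
    then have "excess b' = M" using b' b by (auto simp: prec_def)
    then have "drop0 b' \<in> ?A" using C' by simp
    then show False using b(2) b'(3) by fastforce
  qed
  then show ?thesis using that[of b] b by (auto simp: C_def std_def)
qed

lemma n0_le_card_std: assumes "finite std" shows "n 0 \<le> card std"
proof -
  have "{..<n 0} \<subseteq> (\<lambda>b. val b mod n 0) ` std"
  proof
    fix r assume "r \<in> {..<n 0}"
    then obtain b where "b \<in> std" "val b mod n 0 = r" using residue_in_std by auto
    then show "r \<in> (\<lambda>b. val b mod n 0) ` std" by blast
  qed
  then have "card {..<n 0} \<le> card std" using assms surj_card_le by blast
  then show ?thesis by simp
qed

lemma std_subset_box:
  assumes "\<And>i. i \<in> {1..<m} \<Longrightarrow> \<not> standard (single i (\<alpha> i))"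
  shows "std \<subseteq> box {1..<m} (\<lambda>_. 0) \<alpha>"
proof
  fix b assume b: "b \<in> std"
  have keys: "keys b \<subseteq> {1..<m}"
  proof
    fix x assume "x \<in> keys b"
    moreover from this have "x \<noteq> 0" "x < m" using b by (cases "x = 0", auto simp: std_def exps_def in_keys_iff subset_iff)
    ultimately show "x \<in> {1..<m}" by auto
  qed
  have "lookup b i < \<alpha> i" if i: "i \<in> {1..<m}" for i
  proof (rule ccontr)
    assume "\<not> lookup b i < \<alpha> i"
    then have eq: "b = single i (\<alpha> i) + (b - single i (\<alpha> i))"
      by (intro expo_add_single_diff) simp
    have "\<not> standard b"
      by (subst eq, rule not_standard_add[OF assms[OF i]]) (use b in \<open>simp add: exps_minus std_def\<close>)
    then show False using b by (simp add: std_def)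
  qed
  then show "b \<in> box {1..<m} (\<lambda>_. 0) \<alpha>" using keys by (simp add: box_def)
qed

lemma n0_le_prod:
  assumes "\<And>i. i \<in> {1..<m} \<Longrightarrow> \<not> standard (single i (\<alpha> i))"
  shows "n 0 \<le> (\<Prod>i\<in>{1..<m}. \<alpha> i)"
proof -
  have sub: "std \<subseteq> box {1..<m} (\<lambda>_. 0) \<alpha>" using std_subset_box assms by blast
  have fin: "finite (box {1..<m} (\<lambda>_. 0) \<alpha>)" by (simp add: finite_card_box)
  have "n 0 \<le> card std" using n0_le_card_std finite_subset[OF sub fin] by blast
  also have "\<dots> \<le> card (box {1..<m} (\<lambda>_. 0) \<alpha>)" by (rule card_mono[OF fin sub])
  also have "\<dots> = (\<Prod>i\<in>{1..<m}. \<alpha> i)" by (simp add: finite_card_box)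
  finally show ?thesis .
qed

lemma n0_le_box_minus_multiples:
  assumes pure: "\<And>i. i \<in> {1..<m} \<Longrightarrow> \<not> standard (single i d)"
    and u: "\<not> standard u" "u \<in> box {1..<m} (\<lambda>_. 0) (\<lambda>_. d)"
  defines "mults \<equiv> box {1..<m} (lookup u) (\<lambda>_. d)"
  shows "n 0 \<le> d ^ (m - 1) - (\<Prod>i\<in>{1..<m}. d - lookup u i)"
    and "n 0 = d ^ (m - 1) - (\<Prod>i\<in>{1..<m}. d - lookup u i) \<Longrightarrow>
      std = box {1..<m} (\<lambda>_. 0) (\<lambda>_. d) - mults"
proof -
  let ?B = "box {1..<m} (\<lambda>_. 0) (\<lambda>_. d)"
  have uk: "keys u \<subseteq> {1..<m}" using u by (simp add: box_def)
  have sub: "std \<subseteq> ?B - mults"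
  proof
    fix b assume b: "b \<in> std"
    have "b \<in> ?B" using std_subset_box[of "\<lambda>_. d"] pure b by blast
    moreover have "b \<notin> mults"
    proof
      assume "b \<in> mults"
      then have le: "lookup u i \<le> lookup b i" for i
      proof (cases "i \<in> {1..<m}")
        case True then show ?thesis using \<open>b \<in> mults\<close> by (simp add: mults_def box_def)
      next
        case False
        then have "i \<notin> keys u" using uk by blast
        then show ?thesis by (simp add: in_keys_iff)
      qed
      have "\<not> standard b"
        by (subst expo_le_imp_add[OF le], rule not_standard_add[OF u(1)]) (use b in \<open>simp add: exps_minus std_def\<close>)
      then show False using b by (simp add: std_def)
    qed
    ultimately show "b \<in> ?B - mults" by blast
  qed
  have msub: "mults \<subseteq> ?B"
    unfolding mults_def box_def by auto
  have fin: "finite ?B" "finite mults" by (simp_all add: finite_card_box mults_def)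
  have card: "card (?B - mults) = d ^ (m - 1) - (\<Prod>i\<in>{1..<m}. d - lookup u i)"
    using fin msub by (simp add: card_Diff_subset finite_card_box mults_def)
  have fB: "finite (?B - mults)" using fin by blast
  have n0: "n 0 \<le> card std" using n0_le_card_std finite_subset[OF sub fB] by blast
  also have le: "\<dots> \<le> card (?B - mults)" by (rule card_mono[OF fB sub])
  finally show "n 0 \<le> d ^ (m - 1) - (\<Prod>i\<in>{1..<m}. d - lookup u i)" using card by simp
  assume "n 0 = d ^ (m - 1) - (\<Prod>i\<in>{1..<m}. d - lookup u i)"
  then show "std = ?B - mults" using card_subset_eq[OF fB sub] n0 le card by simp
qed

end

section \<open>Polynomial rings\<close>

type_synonym 'k mp = "expo \<Rightarrow>\<^sub>0 'k"

abbreviation mon :: "expo \<Rightarrow> 'k::field mp" where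
  "mon a \<equiv> single a 1"

lemma mpoly_ring_simps [simp]:
  "mult (mpoly_ring n) = (*)" "one (mpoly_ring n) = 1" "zero (mpoly_ring n) = 0"
  "add (mpoly_ring n) = (+)"
  by (simp_all add: mpoly_ring_def)

lemma mpoly_carrier: "f \<in> carrier (mpoly_ring n) \<longleftrightarrow> (\<forall>a\<in>keys f. keys a \<subseteq> {..<n})"
  by (simp add: mpoly_ring_def)

lemma mpoly_carrier_zero [simp]: "0 \<in> carrier (mpoly_ring n)"
  by (simp add: mpoly_carrier)

lemma mpoly_carrier_one [simp]: "1 \<in> carrier (mpoly_ring n)"
  by (simp add: mpoly_carrier)

lemma mpoly_carrier_add [simp]:
  "f \<in> carrier (mpoly_ring n) \<Longrightarrow> g \<in> carrier (mpoly_ring n) \<Longrightarrow> f + g \<in> carrier (mpoly_ring n)"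
  using Poly_Mapping.keys_add[of f g] by (auto simp: mpoly_carrier)

lemma mpoly_carrier_uminus [simp]:
  "f \<in> carrier (mpoly_ring n) \<Longrightarrow> - f \<in> carrier (mpoly_ring n)"
  by (auto simp: mpoly_carrier)

lemma mpoly_carrier_minus [simp]:
  "f \<in> carrier (mpoly_ring n) \<Longrightarrow> g \<in> carrier (mpoly_ring n) \<Longrightarrow> f - g \<in> carrier (mpoly_ring n)"
  by (metis mpoly_carrier_add mpoly_carrier_uminus diff_conv_add_uminus)

lemma mpoly_carrier_mult [simp]:
  "f \<in> carrier (mpoly_ring n) \<Longrightarrow> g \<in> carrier (mpoly_ring n) \<Longrightarrow> f * g \<in> carrier (mpoly_ring n)"
  using Poly_Mapping.keys_mult[of f g] by (fastforce simp: mpoly_carrier keys_add_nat)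

lemma mpoly_carrier_single:
  "keys a \<subseteq> {..<n} \<Longrightarrow> single a c \<in> carrier (mpoly_ring n)"
  by (auto simp: mpoly_carrier split: if_splits)

lemma mpoly_carrier_sum [simp]:
  "(\<And>i. i \<in> A \<Longrightarrow> f i \<in> carrier (mpoly_ring n)) \<Longrightarrow> sum f A \<in> carrier (mpoly_ring n)"
  by (induction A rule: infinite_finite_induct) auto

lemma mpoly_cring: "cring (mpoly_ring n :: 'k::field mp ring)"
proof (rule cringI)
  show "abelian_group (mpoly_ring n :: 'k mp ring)"
  proof (rule abelian_groupI)
    fix x :: "'k mp" assume x: "x \<in> carrier (mpoly_ring n)"
    show "\<exists>y\<in>carrier (mpoly_ring n). y \<oplus>\<^bsub>mpoly_ring n\<^esub> x = \<zero>\<^bsub>mpoly_ring n\<^esub>"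
      by (rule bexI[of _ "- x"]) (use x in auto)
  qed (auto simp: algebra_simps)
  show "comm_monoid (mpoly_ring n :: 'k mp ring)"
    by (rule comm_monoidI) (auto simp: algebra_simps)
qed (auto simp: algebra_simps)

lemma mpoly_a_inv: "f \<in> carrier (mpoly_ring n) \<Longrightarrow> \<ominus>\<^bsub>mpoly_ring n\<^esub> f = - (f :: 'k::field mp)"
proof -
  interpret cring "mpoly_ring n :: 'k mp ring" by (rule mpoly_cring)
  assume "f \<in> carrier (mpoly_ring n)"
  then show ?thesis by (intro minus_equality) auto
qed

lemma mpoly_idealI:
  fixes I :: "'k::field mp set"
  assumes "I \<subseteq> carrier (mpoly_ring n)" "0 \<in> I" "\<And>f g. f \<in> I \<Longrightarrow> g \<in> I \<Longrightarrow> f + g \<in> I"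
    "\<And>c f. c \<in> carrier (mpoly_ring n) \<Longrightarrow> f \<in> I \<Longrightarrow> c * f \<in> I"
  shows "ideal I (mpoly_ring n)"
proof (rule idealI)
  interpret cring "mpoly_ring n :: 'k mp ring" by (rule mpoly_cring)
  show "ring (mpoly_ring n :: 'k mp ring)" by (rule ring_axioms)
  show "subgroup I (add_monoid (mpoly_ring n))"
  proof (rule add.subgroupI)
    fix a assume a: "a \<in> I"
    have "(- 1) * a \<in> I" by (rule assms(4)) (use a in auto)
    then show "\<ominus>\<^bsub>mpoly_ring n\<^esub> a \<in> I" using a assms(1) by (subst mpoly_a_inv) auto
  qed (use assms in auto)
  fix a x :: "'k mp" assume "a \<in> I" "x \<in> carrier (mpoly_ring n)"
  then have "x * a \<in> I" by (rule assms(4)[rotated])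
  then show "x \<otimes>\<^bsub>mpoly_ring n\<^esub> a \<in> I" "a \<otimes>\<^bsub>mpoly_ring n\<^esub> x \<in> I" by (simp_all add: mult.commute)
qed

lemma mpoly_idealD:
  fixes I :: "'k::field mp set"
  assumes "ideal I (mpoly_ring n)"
  shows "I \<subseteq> carrier (mpoly_ring n)" "0 \<in> I" "\<And>f g. f \<in> I \<Longrightarrow> g \<in> I \<Longrightarrow> f + g \<in> I"
    "\<And>c f. c \<in> carrier (mpoly_ring n) \<Longrightarrow> f \<in> I \<Longrightarrow> c * f \<in> I"
    "\<And>c f. c \<in> carrier (mpoly_ring n) \<Longrightarrow> f \<in> I \<Longrightarrow> f * c \<in> I"
    "\<And>f. f \<in> I \<Longrightarrow> - f \<in> I"
    "\<And>f g. f \<in> I \<Longrightarrow> g \<in> I \<Longrightarrow> f - g \<in> I"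
proof -
  interpret ideal I "mpoly_ring n" by fact
  show car: "I \<subseteq> carrier (mpoly_ring n)" using Icarr by blast
  show "0 \<in> I" using additive_subgroup.zero_closed[OF is_additive_subgroup] by simp
  show add: "f + g \<in> I" if "f \<in> I" "g \<in> I" for f g using additive_subgroup.a_closed[OF is_additive_subgroup that] by simp
  show "c * f \<in> I" if "c \<in> carrier (mpoly_ring n)" "f \<in> I" for c f using I_l_closed that by simp
  show "f * c \<in> I" if "c \<in> carrier (mpoly_ring n)" "f \<in> I" for c f using I_r_closed that by simp
  show neg: "- f \<in> I" if "f \<in> I" for f
    using additive_subgroup.a_inv_closed[OF is_additive_subgroup that] that car by (subst (asm) mpoly_a_inv) auto
  show "f - g \<in> I" if "f \<in> I" "g \<in> I" for f g
    using add[OF that(1) neg[OF that(2)]] by simp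
qed

lemma mpoly_ideal_sum:
  fixes I :: "'k::field mp set"
  assumes "ideal I (mpoly_ring n)" "\<And>i. i \<in> A \<Longrightarrow> f i \<in> I" shows "sum f A \<in> I"
  using assms(2) mpoly_idealD(2,3)[OF assms(1)]
  by (induction A rule: infinite_finite_induct) auto

lemma mpoly_genideal:
  fixes S :: "'k::field mp set"
  assumes "S \<subseteq> carrier (mpoly_ring n)"
  shows "ideal (genideal (mpoly_ring n) S) (mpoly_ring n)" "S \<subseteq> genideal (mpoly_ring n) S"
    "\<And>I. ideal I (mpoly_ring n) \<Longrightarrow> S \<subseteq> I \<Longrightarrow> genideal (mpoly_ring n) S \<subseteq> I"
proof -
  interpret cring "mpoly_ring n :: 'k mp ring" by (rule mpoly_cring)
  show "ideal (genideal (mpoly_ring n) S) (mpoly_ring n)" "S \<subseteq> genideal (mpoly_ring n) S"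
    using genideal_ideal genideal_self assms by auto
  show "\<And>I. ideal I (mpoly_ring n) \<Longrightarrow> S \<subseteq> I \<Longrightarrow> genideal (mpoly_ring n) S \<subseteq> I"
    by (rule genideal_minimal)
qed

lemma mpoly_eq_sum: "f = (\<Sum>a\<in>keys f. single a (lookup f a))"
  by (rule poly_mapping_eqI) (auto simp: lookup_sum lookup_single when_def in_keys_iff sum.delta')

lemma mpoly_eq_sum_superset:
  assumes "finite S" "keys f \<subseteq> S"
  shows "f = (\<Sum>a\<in>S. single a (lookup f a))"
proof -
  have "(\<Sum>a\<in>keys f. single a (lookup f a))
      = (\<Sum>a\<in>S. single a (lookup f a))"
    by (rule sum.mono_neutral_left) (use assms in \<open>auto simp: in_keys_iff\<close>)
  then show ?thesis using mpoly_eq_sum[of f] by simp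
qed

lemma mpoly_mult_eq_sum:
  "f * g = (\<Sum>a\<in>keys f. single a (lookup f a) * g)"
  by (subst mpoly_eq_sum[of f]) (simp add: sum_distrib_right)

lemma single_mult_eq_sum:
  "single a c * f = (\<Sum>b\<in>keys f. single (a + b) (c * lookup (f :: 'k::field mp) b))"
  by (subst (1) mpoly_eq_sum[of f]) (simp add: sum_distrib_left mult_single)

lemma mon_power: "mon (single i 1) ^ k = mon (single i k)"
  by (induction k) (auto simp: mult_single single_add[symmetric])

text \<open>The additive extension of a function of the terms of a polynomial.\<close>

definition extend :: "(expo \<Rightarrow> 'k::field \<Rightarrow> 'b::comm_monoid_add) \<Rightarrow> 'k mp \<Rightarrow> 'b" where
  "extend h f = (\<Sum>a\<in>keys f. h a (lookup f a))"

lemma extend_add: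
  assumes "\<And>a. h a 0 = 0" "\<And>a x y. h a (x + y) = h a x + h a y"
  shows "extend h (f + g) = extend h f + extend h g"
proof -
  let ?S = "keys f \<union> keys g"
  have S: "extend h p = (\<Sum>a\<in>?S. h a (lookup p a))" if "keys p \<subseteq> ?S" for p
    unfolding extend_def by (rule sum.mono_neutral_left) (use that assms(1) in \<open>auto simp: in_keys_iff\<close>)
  have "keys (f + g) \<subseteq> ?S" by (rule Poly_Mapping.keys_add)
  then show ?thesis by (simp add: S lookup_add assms(2) sum.distrib)
qed

lemma homogeneous_iff: "homogeneous e f \<longleftrightarrow> (\<forall>a\<in>keys f. deg a = e)"
  by (simp add: homogeneous_def deg_def weight_def)

lemma lookup_mono_mult:
  "lookup (single a c * f) (a + b) = c * lookup (f :: 'k::field mp) b"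
  by (auto simp: single_mult_eq_sum lookup_sum lookup_single when_def in_keys_iff sum.delta')

lemma keys_mono_mult:
  "keys (single a c * f) \<subseteq> (+) a ` keys (f :: 'k::field mp)"
  using Poly_Mapping.keys_mult[of "single a c" f] by (auto split: if_splits)

section \<open>The tangent cone ideal\<close>

context monoid_generators
begin

lemma carrier_exps: "f \<in> carrier (mpoly_ring m) \<longleftrightarrow> keys f \<subseteq> exps"
  by (auto simp: mpoly_carrier exps_def)

lemma single_carrier [simp]: "a \<in> exps \<Longrightarrow> single a c \<in> carrier (mpoly_ring m)"
  by (auto simp: carrier_exps)

text \<open>The coefficient of the image of \<open>f\<close> at \<open>t\<^sup>s\<close>: in the associated graded ring a monomial of value
  \<open>s\<close> survives exactly if its degree is the greatest possible. The ideal \<open>tangent\<close> is shown to be the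
  defining ideal in \<open>kernel_presentation\<close>.\<close>

definition coef :: "'k::field mp \<Rightarrow> nat \<Rightarrow> 'k" where
  "coef f s = (\<Sum>a\<in>keys f. if val a = s \<and> deg a = max_len s then lookup f a else 0)"

definition tangent :: "'k::field mp set" where
  "tangent = {f \<in> carrier (mpoly_ring m). \<forall>s. coef f s = 0}"

lemma coef_zero [simp]: "coef 0 s = 0"
  by (simp add: coef_def)

lemma coef_add: "coef (f + g) s = coef f s + coef g s"
  using extend_add[of "\<lambda>a c. if val a = s \<and> deg a = max_len s then c else 0" f g]
  by (simp add: coef_def extend_def)

lemma coef_uminus: "coef (- f) s = - coef f s"
  using coef_add[of f "- f" s] by (simp add: eq_neg_iff_add_eq_0 add.commute)

lemma coef_minus: "coef (f - g) s = coef f s - coef g s"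
  using coef_add[of f "- g" s] by (simp add: coef_uminus)

lemma coef_sum: "coef (sum f A) s = (\<Sum>i\<in>A. coef (f i) s)"
  by (induction A rule: infinite_finite_induct) (auto simp: coef_add)

lemma coef_single: "coef (single a c) s = (if val a = s \<and> deg a = max_len s then c else 0)"
  by (simp add: coef_def)

text \<open>Lengths are superadditive, so a product of monomials that is a longest factorisation has factors
  that are longest factorisations.\<close>

lemma coef_mono_mult:
  assumes a: "a \<in> exps" and f: "f \<in> carrier (mpoly_ring m)"
  shows "coef (single a c * f) s =
    (if val a \<le> s \<and> deg a + max_len (s - val a) = max_len s then c * coef f (s - val a) else 0)"
proof -
  have "coef (single a c * f) s =
      (\<Sum>b\<in>keys f. if val (a + b) = s \<and> deg (a + b) = max_len s then c * lookup f b else 0)"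
    by (simp add: single_mult_eq_sum coef_sum coef_single)
  also have "\<dots> = (\<Sum>b\<in>keys f.
      if val a \<le> s \<and> deg a + max_len (s - val a) = max_len s then
        c * (if val b = s - val a \<and> deg b = max_len (s - val a) then lookup f b else 0) else 0)"
  proof (rule sum.cong[OF refl])
    fix b assume "b \<in> keys f"
    then have b: "b \<in> exps" using f by (auto simp: carrier_exps)
    have "(val (a + b) = s \<and> deg (a + b) = max_len s) \<longleftrightarrow>
        (val a \<le> s \<and> deg a + max_len (s - val a) = max_len s) \<and> (val b = s - val a \<and> deg b = max_len (s - val a))"
    proof (cases "val (a + b) = s")
      case False then show ?thesis by (auto simp: weight_add)
    next
      case True
      then have s: "s = val a + val b" by (simp add: weight_add)
      have "deg b \<le> max_len (val b)" "deg a \<le> max_len (val a)" using a b max_len_ge by auto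
      moreover have "max_len (val a) + max_len (val b) \<le> max_len s"
        unfolding s by (rule max_len_add) (use a b val_sgp in auto)
      ultimately show ?thesis by (auto simp: s weight_add deg_add)
    qed
    then show "(if val (a + b) = s \<and> deg (a + b) = max_len s then c * lookup f b else 0) =
      (if val a \<le> s \<and> deg a + max_len (s - val a) = max_len s then
        c * (if val b = s - val a \<and> deg b = max_len (s - val a) then lookup f b else 0) else 0)"
      by simp
  qed
  also have "\<dots> = (if val a \<le> s \<and> deg a + max_len (s - val a) = max_len s then c * coef f (s - val a) else 0)"
    unfolding coef_def sum_distrib_left
    by (cases "val a \<le> s \<and> deg a + max_len (s - val a) = max_len s") (auto intro!: sum.neutral sum.cong)
  finally show ?thesis .
qed

lemma tangent_ideal: "ideal (tangent :: 'k::field mp set) (mpoly_ring m)"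
proof (rule mpoly_idealI)
  fix c f :: "'k mp" assume c: "c \<in> carrier (mpoly_ring m)" and f: "f \<in> tangent"
  have "coef (c * f) s = 0" for s
  proof -
    have "coef (single a (lookup c a) * f) s = 0" if "a \<in> keys c" for a
      using that c f by (subst coef_mono_mult) (auto simp: tangent_def carrier_exps)
    then show ?thesis by (subst mpoly_mult_eq_sum) (simp add: coef_sum)
  qed
  then show "c * f \<in> tangent" using c f by (simp add: tangent_def)
qed (auto simp: tangent_def coef_add)

lemma mono_in_tangent_iff: assumes "a \<in> exps" shows "(mon a :: 'k::field mp) \<in> tangent \<longleftrightarrow> deg a < max_len (val a)"
  using assms max_len_ge[OF assms] by (auto simp: tangent_def coef_single split: if_splits)

lemma binomial_in_tangent:
  assumes "a \<in> exps" "b \<in> exps" "deg a = deg b" "val a = val b"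
  shows "(mon a - mon b :: 'k::field mp) \<in> tangent"
  using assms by (auto simp: tangent_def coef_minus coef_single)

text \<open>The monomial \<open>x\<^sup>a\<close> is congruent modulo \<open>I\<close> to zero or to a preceding monomial of the same degree.\<close>

definition reducible :: "'k::field mp set \<Rightarrow> expo \<Rightarrow> bool" where
  "reducible I a \<longleftrightarrow> mon a \<in> I \<or> (\<exists>b\<in>exps. deg b = deg a \<and> b \<prec> a \<and> mon a - mon b \<in> I)"

lemma finite_exps_deg: "finite {a \<in> exps. deg a = e}"
  unfolding deg_def exps_def mem_Collect_eq by (rule finite_weight_eq) auto

text \<open>Only finitely many exponents have degree \<open>e\<close>, so replacing monomials by preceding ones stops.\<close>

lemma reduce_mono:
  fixes I :: "'k::field mp set"
  assumes I: "ideal I (mpoly_ring m)"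
    and red: "\<And>a. a \<in> exps \<Longrightarrow> deg a = e \<Longrightarrow> \<not> normal a \<Longrightarrow> reducible I a"
  shows "a \<in> exps \<Longrightarrow> deg a = e \<Longrightarrow>
    \<exists>t. mon a - t \<in> I \<and> keys t \<subseteq> {b \<in> exps. normal b}"
proof (induction "card {b \<in> exps. deg b = e \<and> b \<prec> a}" arbitrary: a rule: less_induct)
  case less
  show ?case
  proof (cases "normal a")
    case True
    show ?thesis using True less.prems mpoly_idealD(2)[OF I] by (intro exI[of _ "mon a"]) auto
  next
    case False
    with red less.prems consider "mon a \<in> I" | b where "b \<in> exps" "deg b = deg a" "b \<prec> a" "mon a - mon b \<in> I"
      unfolding reducible_def by blast
    then show ?thesis
    proof cases
      case 1 then show ?thesis by (intro exI[of _ 0]) auto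
    next
      case (2 b)
      have "{c \<in> exps. deg c = e \<and> c \<prec> b} \<subset> {c \<in> exps. deg c = e \<and> c \<prec> a}"
        using 2 less.prems prec_trans prec_irrefl by blast
      moreover have "finite {c \<in> exps. deg c = e \<and> c \<prec> a}"
        by (rule finite_subset[OF _ finite_exps_deg[of e]]) auto
      ultimately have "card {c \<in> exps. deg c = e \<and> c \<prec> b} < card {c \<in> exps. deg c = e \<and> c \<prec> a}"
        by (rule psubset_card_mono[rotated])
      then obtain t where t: "mon b - t \<in> I" "keys t \<subseteq> {b \<in> exps. normal b}"
        using less.hyps[of b] 2 less.prems by auto
      have "(mon a - mon b) + (mon b - t) \<in> I" by (rule mpoly_idealD(3)[OF I 2(4) t(1)])
      then show ?thesis using t(2) by (intro exI[of _ t]) simp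
    qed
  qed
qed

lemma normal_support_tangent_zero:
  assumes "t \<in> tangent" "keys t \<subseteq> {b \<in> exps. normal b}" shows "t = 0"
proof (rule ccontr)
  assume "t \<noteq> 0"
  then obtain b where b: "b \<in> keys t" by (metis all_not_in_conv keys_eq_empty)
  have "coef t (val b) = (\<Sum>a\<in>keys t. if a = b then lookup t a else 0)"
    unfolding coef_def
  proof (rule sum.cong[OF refl])
    fix a assume a: "a \<in> keys t"
    have "val a = val b \<and> deg a = max_len (val b) \<longleftrightarrow> a = b"
    proof
      assume "val a = val b \<and> deg a = max_len (val b)"
      moreover have "a \<in> exps" "b \<in> exps" "normal a" "normal b" using a b assms(2) by auto
      ultimately show "a = b" using normal_unique[of a b] by blast
    next
      have "normal b" using b assms(2) by auto
      then show "a = b \<Longrightarrow> val a = val b \<and> deg a = max_len (val b)" by (simp add: normal_def)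
    qed
    then show "(if val a = val b \<and> deg a = max_len (val b) then lookup t a else 0) =
        (if a = b then lookup t a else 0)" by simp
  qed
  also have "\<dots> = lookup t b" using b by simp
  finally show False using assms(1) b by (auto simp: tangent_def in_keys_iff)
qed

text \<open>After reduction modulo \<open>I\<close> an element of the tangent cone ideal is supported on normal monomials,
  and these are linearly independent in the associated graded ring.\<close>

lemma homogeneous_tangent_subset:
  fixes I :: "'k::field mp set"
  assumes I: "ideal I (mpoly_ring m)" "I \<subseteq> tangent"
    and red: "\<And>a. a \<in> exps \<Longrightarrow> deg a = e \<Longrightarrow> \<not> normal a \<Longrightarrow> reducible I a"
    and f: "f \<in> tangent" "homogeneous e f"
  shows "f \<in> I"
proof -
  have car: "keys f \<subseteq> exps" using f by (simp add: tangent_def carrier_exps)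
  have "\<exists>t. mon a - t \<in> I \<and> keys t \<subseteq> {b \<in> exps. normal b}" if "a \<in> keys f" for a
    using reduce_mono[OF I(1) red] that car f(2) by (auto simp: homogeneous_iff)
  then obtain t where t: "\<And>a. a \<in> keys f \<Longrightarrow> mon a - t a \<in> I"
      "\<And>a. a \<in> keys f \<Longrightarrow> keys (t a) \<subseteq> {b \<in> exps. normal b}" by metis
  define c where "c a = (single 0 (lookup f a) :: 'k mp)" for a
  define T where "T = (\<Sum>a\<in>keys f. c a * t a)"
  have "f - T = (\<Sum>a\<in>keys f. c a * (mon a - t a))"
  proof -
    have "f = (\<Sum>a\<in>keys f. c a * mon a)"
      by (subst mpoly_eq_sum) (simp add: c_def mult_single)
    then show ?thesis by (simp add: T_def right_diff_distrib sum_subtractf)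
  qed
  also have "\<dots> \<in> I"
    by (rule mpoly_ideal_sum[OF I(1)], rule mpoly_idealD(4)[OF I(1)]) (use t in \<open>auto simp: c_def\<close>)
  finally have fT: "f - T \<in> I" .
  then have "f - (f - T) \<in> tangent" using I(2) f(1) mpoly_idealD(7)[OF tangent_ideal] by blast
  then have "T \<in> tangent" by simp
  moreover have "keys T \<subseteq> {b \<in> exps. normal b}"
  proof
    fix b assume "b \<in> keys T"
    then obtain a where a: "a \<in> keys f" "b \<in> keys (c a * t a)"
      unfolding T_def using Poly_Mapping.keys_sum[of "\<lambda>a. c a * t a"] by blast
    then have "b \<in> keys (t a)"
      using keys_mono_mult[of 0 _ "t a"] unfolding c_def by fastforce
    then show "b \<in> {b \<in> exps. normal b}" using t(2)[OF a(1)] by blast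
  qed
  ultimately have "T = 0" by (rule normal_support_tangent_zero)
  then show ?thesis using fT by simp
qed

subsection \<open>Pure powers\<close>

text \<open>Exactly then the coefficient of \<open>x\<^sub>i\<^sup>k\<close> in an element of the tangent cone ideal may be nonzero.\<close>

definition pure_relation :: "nat \<Rightarrow> nat \<Rightarrow> bool" where
  "pure_relation i k \<longleftrightarrow> k < max_len (n i * k) \<or>
     (\<exists>b\<in>exps. deg b = k \<and> val b = n i * k \<and> b \<noteq> single i k)"

lemma pure_relation_not_standard:
  assumes "i < m" "pure_relation i k" shows "\<not> standard (single i k)"
  using assms(2) unfolding pure_relation_def
proof
  assume "k < max_len (n i * k)"
  then show ?thesis using assms(1) by (intro longer_imp_not_standard) auto
next
  assume "\<exists>b\<in>exps. deg b = k \<and> val b = n i * k \<and> b \<noteq> single i k"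
  then obtain b where b: "b \<in> exps" "deg b = k" "val b = n i * k" "b \<noteq> single i k" by blast
  then show ?thesis
    using pure_power_greatest[OF assms(1) b] by (intro preceded_imp_not_standard[of b]) auto
qed

text \<open>\<open>n\<^sub>i\<close> copies of \<open>n\<^sub>0\<close> are a longer factorisation of \<open>n\<^sub>0 n\<^sub>i\<close> than \<open>n\<^sub>0\<close> copies of \<open>n\<^sub>i\<close>.\<close>

lemma power_in_tangent:
  assumes "0 < i" "i < m" shows "(mon (single i (n 0)) :: 'k::field mp) \<in> tangent"
proof -
  have "deg (single 0 (n i)) \<le> max_len (val (single 0 (n i)))"
    by (rule max_len_ge) (use m_pos in simp)
  then have "n i \<le> max_len (n i * n 0)" by (simp add: mult.commute)
  then show ?thesis using n_gt[OF assms] assms by (subst mono_in_tangent_iff) auto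
qed

text \<open>The polynomials without a power of \<open>x\<^sub>i\<close> among their monomials form an ideal. It does not contain
  all generators, because \<open>x\<^sub>i\<close> is nilpotent modulo the tangent cone ideal.\<close>

lemma exists_pure_relation:
  fixes d :: nat
  assumes gen: "generated_in_degree_le m d (tangent :: 'k::field mp set)" and i: "0 < i" "i < m"
  obtains k where "k \<le> d" "pure_relation i k"
proof -
  obtain S :: "'k mp set" where S: "S \<subseteq> carrier (mpoly_ring m)" "\<And>f. f \<in> S \<Longrightarrow> \<exists>e\<le>d. homogeneous e f"
    "tangent = genideal (mpoly_ring m) S"
    using gen unfolding generated_in_degree_le_def by blast
  have "\<exists>f\<in>S. \<exists>k. single i k \<in> keys f"
  proof (rule ccontr)
    assume neg: "\<not> ?thesis"
    let ?I = "{f \<in> carrier (mpoly_ring m). \<forall>k. single i k \<notin> keys (f :: 'k mp)}"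
    have "ideal ?I (mpoly_ring m)"
    proof (rule mpoly_idealI)
      fix c f :: "'k mp" assume c: "c \<in> carrier (mpoly_ring m)" and f: "f \<in> ?I"
      have "single i k \<notin> keys (c * f)" for k
      proof
        assume "single i k \<in> keys (c * f)"
        then obtain a b where ab: "single i k = a + b" "b \<in> keys f"
          using Poly_Mapping.keys_mult[of c f] by blast
        have "lookup b j = 0" if "j \<noteq> i" for j
          using arg_cong[OF ab(1), of "\<lambda>x. lookup x j"] that by (simp add: lookup_add lookup_single when_def)
        then have "b = single i (lookup b i)"
          by (intro poly_mapping_eqI) (auto simp: lookup_single when_def)
        then show False using f ab(2) by (metis (mono_tags, lifting) mem_Collect_eq)
      qed
      then show "c * f \<in> ?I" using c f by simp
    next
      fix f g :: "'k mp" assume "f \<in> ?I" "g \<in> ?I"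
      then show "f + g \<in> ?I" using Poly_Mapping.keys_add[of f g] by auto
    qed auto
    then have "tangent \<subseteq> ?I" unfolding S(3) by (rule mpoly_genideal(3)[OF S(1)]) (use neg S(1) in auto)
    then have "(mon (single i (n 0)) :: 'k mp) \<in> ?I" using power_in_tangent[OF i] by blast
    then have "\<forall>k. single i k \<noteq> single i (n 0)" by simp
    then show False by blast
  qed
  then obtain f k where f: "f \<in> S" "single i k \<in> keys f" by blast
  then have ft: "f \<in> tangent" using S(3) mpoly_genideal(2)[OF S(1)] by blast
  obtain e where e: "e \<le> d" "homogeneous e f" using S(2) f(1) by blast
  have "k = e" using e(2) f(2) by (auto simp: homogeneous_iff)
  then have "k \<le> d" using e by simp
  moreover have "pure_relation i k"
  proof (rule ccontr)
    assume neg: "\<not> pure_relation i k"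
    have dk: "max_len (n i * k) = k"
      using neg max_len_ge[of "single i k"] i by (simp add: pure_relation_def)
    have "coef f (n i * k) = (\<Sum>a\<in>keys f. if a = single i k then lookup f a else 0)"
      unfolding coef_def
    proof (rule sum.cong[OF refl])
      fix a assume "a \<in> keys f"
      then have "a \<in> exps" using ft by (auto simp: tangent_def carrier_exps)
      then have "val a = n i * k \<and> deg a = max_len (n i * k) \<longleftrightarrow> a = single i k"
        using neg dk by (auto simp: pure_relation_def)
      then show "(if val a = n i * k \<and> deg a = max_len (n i * k) then lookup f a else 0) =
        (if a = single i k then lookup f a else 0)" by simp
    qed
    also have "\<dots> = lookup f (single i k)" using f(2) by simp
    finally show False using ft f(2) by (auto simp: tangent_def in_keys_iff)
  qed
  ultimately show ?thesis using that by blast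
qed

end

section \<open>Regular sequences with pure leading powers\<close>

lemma keys_single_subset [simp]: "i < k \<Longrightarrow> keys (single i c) \<subseteq> {..<k}"
  by (auto split: if_splits)

lemma lookup_scale [simp]:
  "lookup (single 0 c * f) a = c * lookup (f :: 'k::field mp) a"
  using lookup_mono_mult[of 0 c f a] by simp

text \<open>Equations \<open>x\<^sub>i\<^sup>d - r\<^sub>i\<close> for \<open>1 \<le> i < m\<close> in which \<open>x\<^sub>i\<^sup>d\<close> has larger weight than every monomial of
  \<open>r\<^sub>i\<close>. The pure powers themselves are a regular sequence for trivial reasons. The map \<open>E\<close> below, which
  substitutes \<open>x\<^sub>i\<^sup>d - r\<^sub>i\<close> for \<open>x\<^sub>i\<^sup>d\<close> after writing exponents as \<open>a = (a mod d) + d (a div d)\<close>, is a linear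
  bijection that carries the pure powers to the given equations.\<close>

locale pure_power_system =
  fixes m d :: nat and w :: "nat \<Rightarrow> nat" and r :: "nat \<Rightarrow> 'k::field mp"
  assumes d_pos: "0 < d"
    and r_carrier: "\<And>i. i \<in> {1..<m} \<Longrightarrow> r i \<in> carrier (mpoly_ring m)"
    and r_lower: "\<And>i b. i \<in> {1..<m} \<Longrightarrow> b \<in> keys (r i) \<Longrightarrow> weight w b < w i * d"
begin

definition lower :: "'k mp \<Rightarrow> nat \<Rightarrow> bool" where
  "lower p N \<longleftrightarrow> (\<forall>b\<in>keys p. weight w b < N)"

definition monic :: "'k mp \<Rightarrow> expo \<Rightarrow> bool" where
  "monic p a \<longleftrightarrow> lower (p - mon a) (weight w a)"

definition eq :: "nat \<Rightarrow> 'k mp" where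
  "eq i = mon (single i d) - r i"

text \<open>The variable \<open>x\<^sub>0\<close> is not subject to an equation and is left alone.\<close>

definition factor :: "nat \<Rightarrow> nat \<Rightarrow> 'k mp" where
  "factor i k = (if i = 0 then mon (single 0 k)
     else mon (single i (k mod d)) * eq i ^ (k div d))"

definition M :: "expo \<Rightarrow> 'k mp" where
  "M a = (\<Prod>i<m. factor i (lookup a i))"

definition E :: "'k mp \<Rightarrow> 'k mp" where
  "E f = (\<Sum>a\<in>keys f. single 0 (lookup f a) * M a)"

abbreviation P :: "'k mp ring" where "P \<equiv> mpoly_ring m"

lemma lower_add: "lower p N \<Longrightarrow> lower q N \<Longrightarrow> lower (p + q) N"
  using Poly_Mapping.keys_add[of p q] by (auto simp: lower_def)

lemma lower_mult:
  assumes "lower p N" "\<And>b. b \<in> keys q \<Longrightarrow> weight w b \<le> K" shows "lower (p * q) (N + K)"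
  unfolding lower_def
proof
  fix b assume "b \<in> keys (p * q)"
  then obtain x y where "b = x + y" "x \<in> keys p" "y \<in> keys q"
    using Poly_Mapping.keys_mult[of p q] by blast
  then show "weight w b < N + K"
    using assms by (fastforce simp: lower_def weight_add intro: add_less_le_mono)
qed

lemma monic_mult:
  assumes "monic p a" "monic q b" shows "monic (p * q) (a + b)"
proof -
  have "p * q - mon (a + b) =
      ((q - mon b) * mon a + (p - mon a) * mon b) + (p - mon a) * (q - mon b)"
    using mult_single[of a "1::'k" b 1] by (simp add: algebra_simps)
  moreover have "lower ((q - mon b) * mon a) (weight w b + weight w a)"
    by (rule lower_mult) (use assms in \<open>auto simp: monic_def\<close>)
  moreover have "lower ((p - mon a) * mon b) (weight w a + weight w b)"
    by (rule lower_mult) (use assms in \<open>auto simp: monic_def\<close>)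
  moreover have "lower ((p - mon a) * (q - mon b)) (weight w a + weight w b)"
    by (rule lower_mult) (use assms in \<open>auto simp: monic_def lower_def less_imp_le\<close>)
  ultimately show ?thesis
    unfolding monic_def by (simp only: weight_add add.commute lower_add)
qed

lemma monic_mon: "monic (mon a) a"
  by (simp add: monic_def lower_def)

lemma monic_one: "monic 1 0"
  using monic_mon[of 0] by simp

lemma monic_eq: assumes "i \<in> {1..<m}" shows "monic (eq i) (single i d)"
  using r_lower[OF assms] by (auto simp: monic_def lower_def eq_def)

lemma single_add_same: "single i (k::nat) + single i l = single i (k + l)"
  by (simp add: single_add)

lemma monic_power:
  assumes "monic p (single i k)" shows "monic (p ^ j) (single i (k * j))"
proof (induction j)
  case (Suc j)
  show ?case using monic_mult[OF assms Suc] by (simp add: single_add_same)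
qed (simp add: monic_one)

lemma monic_factor: assumes "i < m" shows "monic (factor i k) (single i k)"
proof (cases "i = 0")
  case True then show ?thesis by (simp add: factor_def monic_mon)
next
  case False
  then have "monic (eq i ^ (k div d)) (single i (d * (k div d)))"
    using assms by (intro monic_power monic_eq) auto
  from monic_mult[OF monic_mon[of "single i (k mod d)"] this]
  show ?thesis using False by (simp add: factor_def single_add_same)
qed

lemma eq_carrier: "i \<in> {1..<m} \<Longrightarrow> eq i \<in> carrier P"
  unfolding eq_def by (intro mpoly_carrier_minus mpoly_carrier_single r_carrier) auto

lemma carrier_power: "f \<in> carrier P \<Longrightarrow> f ^ j \<in> carrier P"
  by (induction j) auto

lemma carrier_prod: "(\<And>i. i \<in> A \<Longrightarrow> f i \<in> carrier P) \<Longrightarrow> prod f A \<in> carrier P"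
  by (induction A rule: infinite_finite_induct) auto

lemma factor_carrier: "i < m \<Longrightarrow> factor i k \<in> carrier P"
proof -
  assume i: "i < m"
  have x: "mon (single i j) \<in> carrier P" for j
    by (rule mpoly_carrier_single[OF keys_single_subset[OF i]])
  show ?thesis
  proof (cases "i = 0")
    case True then show ?thesis using x by (simp add: factor_def)
  next
    case False
    then have "eq i \<in> carrier P" using i by (intro eq_carrier) auto
    then show ?thesis using False x by (simp add: factor_def carrier_power)
  qed
qed

lemma M_carrier: "M a \<in> carrier P"
  unfolding M_def by (intro carrier_prod factor_carrier) auto

lemma monic_M: assumes "keys a \<subseteq> {..<m}" shows "monic (M a) a"
proof -
  have "monic (\<Prod>i\<in>S. factor i (lookup a i)) (\<Sum>i\<in>S. single i (lookup a i))"
    if "finite S" "S \<subseteq> {..<m}" for S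
    using that by (induction S rule: finite_induct) (auto simp: monic_one intro!: monic_mult monic_factor)
  from this[of "{..<m}"] have "monic (M a) (\<Sum>i<m. single i (lookup a i))"
    by (simp add: M_def)
  moreover have "(\<Sum>i<m. single i (lookup a i)) = a"
    using mpoly_eq_sum_superset[OF finite_lessThan assms] by simp
  ultimately show ?thesis by simp
qed

lemma M_zero: "M 0 = 1"
  unfolding M_def factor_def by (intro prod.neutral) auto

lemma M_shift:
  assumes i: "i \<in> {1..<m}" shows "M (single i d + a) = eq i * M a"
proof -
  have "factor j (lookup (single i d + a) j) =
      (if j = i then eq i else 1) * factor j (lookup a j)" for j
    using i d_pos by (auto simp: factor_def lookup_add lookup_single when_def mult_ac)
  then have "M (single i d + a) = (\<Prod>j<m. if j = i then eq i else 1) * M a"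
    by (simp add: M_def prod.distrib)
  also have "(\<Prod>j<m. if j = i then eq i else 1) = eq i"
    using i by (subst prod.delta) auto
  finally show ?thesis .
qed

lemma E_add: "E (f + g) = E f + E g"
  using extend_add[of "\<lambda>a c. single 0 c * M a" f g]
  by (simp add: E_def extend_def single_add distrib_right)

lemma E_zero [simp]: "E 0 = 0"
  by (simp add: E_def)

lemma E_minus: "E (f - g) = E f - E g"
  using E_add[of "f - g" g] by (simp add: algebra_simps)

lemma E_sum: "E (sum f A) = (\<Sum>i\<in>A. E (f i))"
  by (induction A rule: infinite_finite_induct) (auto simp: E_add)

lemma E_single: "E (single a c) = single 0 c * M a"
  by (simp add: E_def)

lemma E_carrier: "E f \<in> carrier P"
  unfolding E_def by (intro mpoly_carrier_sum mpoly_carrier_mult M_carrier mpoly_carrier_single) auto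

lemma E_shift:
  assumes "i \<in> {1..<m}" shows "E (mon (single i d) * f) = eq i * E f"
proof -
  have "E (mon (single i d) * f) =
      (\<Sum>b\<in>keys f. single 0 (lookup f b) * M (single i d + b))"
    by (simp add: single_mult_eq_sum E_sum E_single)
  also have "\<dots> = (\<Sum>b\<in>keys f. eq i * (single 0 (lookup f b) * M b))"
    unfolding M_shift[OF assms] by (rule sum.cong) (auto simp: mult_ac)
  finally show ?thesis by (simp add: E_def sum_distrib_left)
qed

lemma E_scale: "E (single 0 c * f) = single 0 c * E f"
proof -
  have "E (single 0 c * f) = (\<Sum>b\<in>keys f. E (single b (c * lookup f b)))"
    by (simp add: single_mult_eq_sum[of 0 c f] E_sum)
  also have "\<dots> = (\<Sum>b\<in>keys f. single 0 c * (single 0 (lookup f b) * M b))"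
    by (rule sum.cong) (auto simp: E_single mult_single mult.assoc[symmetric])
  finally show ?thesis by (simp add: E_def[of f] sum_distrib_left)
qed

text \<open>Since \<open>M a\<close> is \<open>x\<^sup>a\<close> plus terms of lower weight, \<open>E\<close> is unitriangular.\<close>

lemma lookup_M:
  assumes "keys b \<subseteq> {..<m}" "weight w b \<le> weight w a"
  shows "lookup (M b) a = (if a = b then 1 else 0)"
proof -
  have "lookup (M b - mon b) a = 0"
    using monic_M[OF assms(1)] assms(2) unfolding monic_def lower_def by (metis in_keys_iff not_le)
  then show ?thesis by (simp add: lookup_minus lookup_single when_def)
qed

text \<open>A monomial of greatest weight in \<open>f\<close> keeps its coefficient.\<close>

lemma E_eq_zero_imp:
  assumes f: "f \<in> carrier P" "E f = 0" shows "f = 0"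
proof (rule ccontr)
  assume "f \<noteq> 0"
  then have ne: "keys f \<noteq> {}" by simp
  define N where "N = Max (weight w ` keys f)"
  have "N \<in> weight w ` keys f" unfolding N_def by (rule Max_in) (use ne in auto)
  then obtain a where a: "a \<in> keys f" "weight w a = N" by blast
  have "lookup (E f) a = (\<Sum>b\<in>keys f. lookup f b * lookup (M b) a)"
    unfolding E_def lookup_sum by simp
  also have "\<dots> = (\<Sum>b\<in>keys f. if a = b then lookup f b else 0)"
  proof (rule sum.cong[OF refl])
    fix b assume b: "b \<in> keys f"
    have "weight w b \<le> N" unfolding N_def by (rule Max_ge) (use b in auto)
    then show "lookup f b * lookup (M b) a = (if a = b then lookup f b else 0)"
      using lookup_M[of b a] b f(1) a by (auto simp: mpoly_carrier)
  qed
  also have "\<dots> = lookup f a" using a by simp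
  finally show False using f(2) a by (simp add: in_keys_iff)
qed

lemma E_surj_mon:
  "keys a \<subseteq> {..<m} \<Longrightarrow> \<exists>g\<in>carrier P. E g = mon a"
proof (induction "weight w a" arbitrary: a rule: less_induct)
  case less
  let ?t = "M a - mon a"
  have t: "?t \<in> carrier P" by (intro mpoly_carrier_minus M_carrier mpoly_carrier_single less.prems)
  have "\<exists>g\<in>carrier P. E g = mon b" if b: "b \<in> keys ?t" for b
  proof (rule less.hyps)
    show "weight w b < weight w a" using monic_M[OF less.prems] b by (auto simp: monic_def lower_def)
    show "keys b \<subseteq> {..<m}" using t b unfolding mpoly_carrier by blast
  qed
  then obtain g where g: "\<And>b. b \<in> keys ?t \<Longrightarrow> g b \<in> carrier P \<and> E (g b) = mon b" by metis
  let ?h = "\<Sum>b\<in>keys ?t. single 0 (lookup ?t b) * g b"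
  have "E ?h = (\<Sum>b\<in>keys ?t. single b (lookup ?t b))"
    unfolding E_sum E_scale by (rule sum.cong) (use g in \<open>auto simp: mult_single\<close>)
  also have "\<dots> = ?t" by (rule mpoly_eq_sum[symmetric])
  finally have Eh: "E ?h = ?t" .
  have "E (mon a - ?h) = mon a"
    unfolding E_minus Eh by (simp add: E_single)
  moreover have "mon a - ?h \<in> carrier P"
    by (intro mpoly_carrier_minus mpoly_carrier_sum mpoly_carrier_mult mpoly_carrier_single less.prems) (use g in auto)
  ultimately show ?case by blast
qed

lemma E_surj:
  assumes f: "f \<in> carrier P" obtains g where "g \<in> carrier P" "E g = f"
proof -
  have "\<exists>g\<in>carrier P. E g = mon b" if "b \<in> keys f" for b
    by (rule E_surj_mon) (use f that in \<open>auto simp: mpoly_carrier\<close>)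
  then obtain g where g: "\<And>b. b \<in> keys f \<Longrightarrow> g b \<in> carrier P \<and> E (g b) = mon b" by metis
  let ?h = "\<Sum>b\<in>keys f. single 0 (lookup f b) * g b"
  have "E ?h = (\<Sum>b\<in>keys f. single b (lookup f b))"
    unfolding E_sum E_scale by (rule sum.cong) (use g in \<open>auto simp: mult_single\<close>)
  also have "\<dots> = f" by (rule mpoly_eq_sum[symmetric])
  finally show ?thesis
    by (intro that[of ?h]) (auto intro!: mpoly_carrier_sum mpoly_carrier_mult mpoly_carrier_single simp: g)
qed

text \<open>The ideal generated by the powers \<open>x\<^sub>j\<^sup>d\<close> with \<open>1 \<le> j < k\<close>.\<close>

definition V :: "nat \<Rightarrow> 'k mp set" where
  "V k = {g \<in> carrier P. \<forall>a\<in>keys g. \<exists>j\<in>{1..<k}. d \<le> lookup a j}"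

text \<open>\<open>E\<close> is not multiplicative, but it commutes with replacing a factor \<open>x\<^sub>j\<^sup>d\<close> by its equation
  (\<open>E_shift\<close>), and the cofactor has a preimage by surjectivity.\<close>

lemma E_V_mult:
  assumes k: "k \<le> m" and c: "c \<in> carrier P" and g: "g \<in> V k" shows "c * E g \<in> E ` V k"
proof -
  have "\<exists>h. h \<in> V k \<and> E h = c * (single 0 (lookup g a) * M a)"
    if a: "a \<in> keys g" for a
  proof -
    obtain j where j: "j \<in> {1..<k}" "d \<le> lookup a j" using g a by (auto simp: V_def)
    have jm: "j \<in> {1..<m}" using j k by auto
    define a' where "a' = a - single j d"
    have a': "a = single j d + a'" unfolding a'_def by (rule expo_add_single_diff[OF j(2)])
    have "c * (single 0 (lookup g a) * M a') \<in> carrier P"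
      by (intro mpoly_carrier_mult c M_carrier mpoly_carrier_single) auto
    then obtain h where h: "h \<in> carrier P" "E h = c * (single 0 (lookup g a) * M a')"
      using E_surj by blast
    have "E (mon (single j d) * h) = c * (single 0 (lookup g a) * M a)"
      unfolding E_shift[OF jm] h(2) a' M_shift[OF jm] by (simp add: mult_ac)
    moreover have "mon (single j d) * h \<in> V k"
    proof -
      have "\<exists>i\<in>{1..<k}. d \<le> lookup b i" if "b \<in> keys (mon (single j d) * h)" for b
        using keys_mono_mult[of "single j d" 1 h] that j(1)
        by (intro bexI[of _ j]) (auto simp: lookup_add)
      moreover have "mon (single j d) * h \<in> carrier P"
        by (intro mpoly_carrier_mult h mpoly_carrier_single) (use jm in auto)
      ultimately show ?thesis by (simp add: V_def)
    qed
    ultimately show ?thesis by blast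
  qed
  then obtain h where h: "\<And>a. a \<in> keys g \<Longrightarrow>
      h a \<in> V k \<and> E (h a) = c * (single 0 (lookup g a) * M a)" by metis
  have "sum h A \<in> V k" if "A \<subseteq> keys g" for A
    using finite_subset[OF that finite_keys] that
  proof (induction A rule: finite_induct)
    case (insert x F)
    then have "h x \<in> V k" "sum h F \<in> V k" using h by auto
    then show ?case using insert Poly_Mapping.keys_add[of "h x" "sum h F"] by (auto simp: V_def)
  qed (simp add: V_def)
  then have "sum h (keys g) \<in> V k" by blast
  moreover have "E (sum h (keys g)) = c * E g"
    unfolding E_sum E_def[of g] sum_distrib_left by (rule sum.cong) (use h in auto)
  ultimately show ?thesis by (metis image_eqI)
qed

lemma genideal_eq_image:
  assumes k: "k \<le> m" shows "genideal P (eq ` {1..<k}) = E ` V k"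
proof
  have car: "eq ` {1..<k} \<subseteq> carrier P" using eq_carrier k by auto
  show "genideal P (eq ` {1..<k}) \<subseteq> E ` V k"
  proof (rule mpoly_genideal(3)[OF car])
    show "ideal (E ` V k) P"
    proof (rule mpoly_idealI)
      show "E ` V k \<subseteq> carrier P" using E_carrier by blast
      show "0 \<in> E ` V k" by (rule image_eqI[of _ _ 0]) (auto simp: V_def)
      fix f g assume "f \<in> E ` V k" "g \<in> E ` V k"
      then obtain f' g' where fg: "f = E f'" "g = E g'" "f' \<in> V k" "g' \<in> V k" by blast
      have "f' + g' \<in> V k" using fg Poly_Mapping.keys_add[of f' g'] by (auto simp: V_def)
      then show "f + g \<in> E ` V k" unfolding fg E_add[symmetric] by blast
    next
      fix c f assume "c \<in> carrier P" "f \<in> E ` V k"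
      then show "c * f \<in> E ` V k" using E_V_mult[OF k] by blast
    qed
    show "eq ` {1..<k} \<subseteq> E ` V k"
    proof
      fix f assume "f \<in> eq ` {1..<k}"
      then obtain j where j: "j \<in> {1..<k}" "f = eq j" by blast
      have "E (mon (single j d)) = eq j"
        using E_shift[of j 1] M_zero j k E_single[of 0 1] by simp
      moreover have "mon (single j d) \<in> V k"
        using j k by (auto simp: V_def lookup_single intro!: mpoly_carrier_single keys_single_subset bexI[of _ j])
      ultimately show "f \<in> E ` V k" using j by (metis image_eqI)
    qed
  qed
  show "E ` V k \<subseteq> genideal P (eq ` {1..<k})"
  proof clarify
    fix g assume g: "g \<in> V k"
    show "E g \<in> genideal P (eq ` {1..<k})"
      unfolding E_def
    proof (rule mpoly_ideal_sum[OF mpoly_genideal(1)[OF car]])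
      fix a assume "a \<in> keys g"
      then obtain j where j: "j \<in> {1..<k}" "d \<le> lookup a j" using g by (auto simp: V_def)
      have jm: "j \<in> {1..<m}" using j k by auto
      have "a = single j d + (a - single j d)" by (rule expo_add_single_diff[OF j(2)])
      then have "M a = eq j * M (a - single j d)" using M_shift[OF jm] by metis
      then have *: "single 0 (lookup g a) * M a =
          (single 0 (lookup g a) * M (a - single j d)) * eq j" by (simp add: mult_ac)
      have ej: "eq j \<in> genideal P (eq ` {1..<k})" using mpoly_genideal(2)[OF car] j by blast
      show "single 0 (lookup g a) * M a \<in> genideal P (eq ` {1..<k})"
        unfolding * by (rule mpoly_idealD(4)[OF mpoly_genideal(1)[OF car] _ ej])
          (intro mpoly_carrier_mult M_carrier mpoly_carrier_single, auto)
    qed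
  qed
qed

theorem regular_sequence_eq:
  assumes proper: "genideal P (eq ` {1..<m}) \<noteq> carrier P"
  shows "regular_sequence P (map eq [1..<m])"
  unfolding regular_sequence_def
proof (intro conjI allI impI ballI)
  show "set (map eq [1..<m]) \<subseteq> carrier P" using eq_carrier by auto
  show "genideal P (set (map eq [1..<m])) \<noteq> carrier P" using proper by simp
  fix i y
  assume i: "i < length (map eq [1..<m])" and y: "y \<in> carrier P"
    and mem: "map eq [1..<m] ! i \<otimes>\<^bsub>P\<^esub> y \<in> genideal P (set (take i (map eq [1..<m])))"
  let ?i = "Suc i"
  have im: "?i \<in> {1..<m}" using i by auto
  have "take i [1..<m] = [1..<?i]" using i by (simp add: take_upt)
  then have take: "set (take i (map eq [1..<m])) = eq ` {1..<?i}" by (simp only: take_map set_map set_upt)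
  have gen: "genideal P (eq ` {1..<?i}) = E ` V ?i" by (rule genideal_eq_image) (use im in auto)
  have "eq ?i * y \<in> E ` V ?i" using mem i unfolding take gen by simp
  then obtain v where v: "v \<in> V ?i" "eq ?i * y = E v" by blast
  obtain y' where y': "y' \<in> carrier P" "E y' = y" using E_surj[OF y] .
  let ?x = "mon (single ?i d)"
  \<comment> \<open>Pulling back along \<open>E\<close> turns the claim into one about the monomial \<open>x\<^sub>i\<^sup>d\<close> and a monomial ideal
    generated by powers of other variables.\<close>
  have "?x * y' - v = 0"
  proof (rule E_eq_zero_imp)
    show "?x * y' - v \<in> carrier P"
      using v y' im by (intro mpoly_carrier_minus mpoly_carrier_mult mpoly_carrier_single) (auto simp: V_def)
    show "E (?x * y' - v) = 0" unfolding E_minus E_shift[OF im] using v y' by simp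
  qed
  then have xv: "?x * y' = v" by simp
  have "y' \<in> V ?i"
  proof -
    have "\<exists>j\<in>{1..<?i}. d \<le> lookup a j" if a: "a \<in> keys y'" for a
    proof -
      have "single ?i d + a \<in> keys v"
        using a lookup_mono_mult[of "single ?i d" 1 y' a] by (simp add: in_keys_iff flip: xv)
      then obtain j where "j \<in> {1..<?i}" "d \<le> lookup (single ?i d + a) j"
        using v(1) by (auto simp: V_def)
      then show ?thesis by (intro bexI[of _ j]) (auto simp: lookup_add lookup_single when_def)
    qed
    then show ?thesis using y'(1) by (simp add: V_def)
  qed
  then show "y \<in> genideal P (set (take i (map eq [1..<m])))"
    unfolding take gen using y' by blast
qed

end

section \<open>The multiplicity bound for the semigroup\<close>

lemma bound_arith:
  fixes d c :: nat
  assumes "2 \<le> d" "2 \<le> c"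
  shows "d ^ (c - 1) < d ^ c - (d - 1) * d ^ (c - 2)"
    and "(d - 1) * d ^ (c - 1) < d ^ c - (d - 1) * d ^ (c - 2)"
    and "(d - 1) * d ^ (c - 2) \<le> d ^ c"
proof -
  obtain e where e: "d = Suc (Suc e)" using assms(1) by (metis add_2_eq_Suc le_iff_add)
  obtain k where k: "c = Suc (Suc k)" using assms(2) by (metis add_2_eq_Suc le_iff_add)
  define q where "q = d ^ k"
  have q: "0 < q" using e by (simp add: q_def)
  have pw: "d ^ c = d * d * q" "d ^ (c - 1) = d * q" "d ^ (c - 2) = q" by (simp_all add: k q_def)
  have ee: "d * d * q = e * e * q + 4 * (e * q) + 4 * q" "d * q = e * q + 2 * q" "(d - 1) * q = e * q + q"
    "(d - 1) * (d * q) = e * e * q + 3 * (e * q) + 2 * q"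
    by (simp_all add: e algebra_simps)
  show "d ^ (c - 1) < d ^ c - (d - 1) * d ^ (c - 2)" unfolding pw ee using q by linarith
  show "(d - 1) * d ^ (c - 1) < d ^ c - (d - 1) * d ^ (c - 2)" unfolding pw ee(4) ee(1,3) using q by linarith
  show "(d - 1) * d ^ (c - 2) \<le> d ^ c" unfolding pw ee by linarith
qed

context monoid_generators
begin

definition tail :: "nat \<Rightarrow> nat \<Rightarrow> 'k::field mp" where
  "tail d i = (if d < max_len (n i * d) then 0
     else mon (SOME b. b \<in> exps \<and> deg b = d \<and> val b = n i * d \<and> b \<noteq> single i d))"

definition eqn :: "nat \<Rightarrow> nat \<Rightarrow> 'k::field mp" where
  "eqn d i = mon (single i d) - tail d i"

text \<open>On exponents of a fixed degree this weight decreases when the spread increases; the constant keeps it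
  nonnegative.\<close>

definition cowt :: "nat \<Rightarrow> nat" where
  "cowt j = (\<Sum>i<m. (n i - n 0)^2) - (n j - n 0)^2"

lemma cowt_spread: assumes "a \<in> exps" shows "weight cowt a + spread a = (\<Sum>i<m. (n i - n 0)^2) * deg a"
proof -
  have k: "keys a \<subseteq> {..<m}" using assms by (simp add: exps_def)
  have le: "(n j - n 0)^2 \<le> (\<Sum>i<m. (n i - n 0)^2)" if "j < m" for j
    by (rule member_le_sum) (use that in auto)
  have "weight cowt a + spread a = (\<Sum>j<m. (cowt j + (n j - n 0)^2) * lookup a j)"
    unfolding spread_def weight_superset[OF finite_lessThan k] by (simp add: sum.distrib algebra_simps)
  also have "\<dots> = (\<Sum>j<m. (\<Sum>i<m. (n i - n 0)^2) * lookup a j)"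
    by (rule sum.cong) (use le in \<open>auto simp: cowt_def\<close>)
  also have "\<dots> = (\<Sum>i<m. (n i - n 0)^2) * deg a"
    unfolding deg_superset[OF finite_lessThan k] sum_distrib_left ..
  finally show ?thesis .
qed

lemma tail_cases:
  assumes "i < m" "pure_relation i d"
  obtains "(tail d i :: 'k::field mp) = 0" "d < max_len (n i * d)"
  | b where "(tail d i :: 'k mp) = mon b" "b \<in> exps" "deg b = d" "val b = n i * d" "b \<noteq> single i d"
proof (cases "d < max_len (n i * d)")
  case True then show ?thesis using that(1) by (simp add: tail_def)
next
  case False
  let ?b = "SOME b. b \<in> exps \<and> deg b = d \<and> val b = n i * d \<and> b \<noteq> single i d"
  have "\<exists>b. b \<in> exps \<and> deg b = d \<and> val b = n i * d \<and> b \<noteq> single i d"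
    using assms(2) False unfolding pure_relation_def by blast
  then have "?b \<in> exps \<and> deg ?b = d \<and> val ?b = n i * d \<and> ?b \<noteq> single i d" by (rule someI_ex)
  then show ?thesis using that(2)[of ?b] False by (simp add: tail_def)
qed

lemma pure_power_system_tail:
  assumes "0 < d" "\<And>i. i \<in> {1..<m} \<Longrightarrow> pure_relation i d"
  shows "pure_power_system m d cowt (tail d :: nat \<Rightarrow> 'k::field mp)"
proof
  show "0 < d" by fact
  fix i assume i: "i \<in> {1..<m}"
  then have im: "i < m" by simp
  show "(tail d i :: 'k mp) \<in> carrier (mpoly_ring m)"
    using tail_cases[OF im assms(2)[OF i], where ?'k = 'k] by (metis mpoly_carrier_zero single_carrier)
  fix b assume b: "b \<in> keys (tail d i :: 'k mp)"
  show "weight cowt b < cowt i * d"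
  proof (rule tail_cases[OF im assms(2)[OF i], where ?'k = 'k])
    assume "(tail d i :: 'k mp) = 0" then show ?thesis using b by simp
  next
    fix b' assume b': "(tail d i :: 'k mp) = mon b'" "b' \<in> exps" "deg b' = d" "val b' = n i * d"
      "b' \<noteq> single i d"
    then have bb: "b = b'" using b by simp
    have "spread (single i d) < spread b'" by (rule pure_power_spread(2)[OF im b'(2-5)])
    moreover have "weight cowt b' + spread b' = weight cowt (single i d) + spread (single i d)"
      using cowt_spread[OF b'(2)] cowt_spread[of "single i d"] im b'(3) by simp
    ultimately show ?thesis unfolding bb weight_single[symmetric] by linarith
  qed
qed

lemma eqn_tangent:
  assumes "i < m" "pure_relation i d" shows "(eqn d i :: 'k::field mp) \<in> tangent"
proof (rule tail_cases[OF assms, where ?'k = 'k])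
  assume "(tail d i :: 'k mp) = 0" "d < max_len (n i * d)"
  then show ?thesis using assms by (simp add: eqn_def mono_in_tangent_iff)
next
  fix b assume "(tail d i :: 'k mp) = mon b" "b \<in> exps" "deg b = d" "val b = n i * d"
  then show ?thesis using assms by (simp add: eqn_def binomial_in_tangent)
qed

lemma lookup_tail_pure:
  assumes "i < m" "pure_relation i d" "0 < d" "j < m"
  shows "lookup (tail d i :: 'k::field mp) (single j d) = 0"
proof (rule tail_cases[OF assms(1,2), where ?'k = 'k])
  fix b assume b: "(tail d i :: 'k mp) = mon b" "val b = n i * d" "b \<noteq> single i d"
  have "b \<noteq> single j d"
  proof
    assume "b = single j d"
    then have "n j * d = n i * d" using b(2) by simp
    then have "j = i" using n_inj[OF assms(4,1)] assms(3) by simp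
    then show False using b(3) \<open>b = single j d\<close> by simp
  qed
  then show ?thesis using b(1) by (simp add: lookup_single when_def)
qed simp

lemma reducibleI_mon:
  fixes I :: "'k::field mp set"
  assumes "ideal I (mpoly_ring m)" "mon a \<in> I" "e \<in> exps" shows "reducible I (a + e)"
proof -
  have "mon (a + e) = mon a * (mon e :: 'k mp)" by (simp add: mult_single)
  then have "(mon (a + e) :: 'k mp) \<in> I"
    using mpoly_idealD(5)[OF assms(1) single_carrier[OF assms(3)] assms(2)] by simp
  then show ?thesis by (simp add: reducible_def)
qed

lemma reducibleI_binomial:
  fixes I :: "'k::field mp set"
  assumes "ideal I (mpoly_ring m)" "mon a - mon b \<in> I" "b \<in> exps" "deg b = deg a" "b \<prec> a" "e \<in> exps"
  shows "reducible I (a + e)"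
proof -
  have "mon (a + e) - mon (b + e) = (mon a - mon b) * (mon e :: 'k mp)"
    by (simp add: mult_single left_diff_distrib)
  then have "mon (a + e) - mon (b + e) \<in> I"
    using mpoly_idealD(5)[OF assms(1) single_carrier[OF assms(6)] assms(2)] by simp
  then show ?thesis using assms prec_add[OF assms(5)]
    unfolding reducible_def by (auto intro!: bexI[of _ "b + e"] simp: deg_add exps_add_iff)
qed

lemma reducible_pure:
  fixes I :: "'k::field mp set"
  assumes I: "ideal I (mpoly_ring m)" "eqn d i \<in> I" and i: "i < m" "pure_relation i d"
    and a: "a \<in> exps" "d \<le> lookup a i"
  shows "reducible I a"
proof -
  let ?e = "a - single i d"
  have e: "?e \<in> exps" using a exps_minus by blast
  have "reducible I (single i d + ?e)"
  proof (rule tail_cases[OF i, where ?'k = 'k])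
    assume "(tail d i :: 'k mp) = 0"
    then show ?thesis using I e by (intro reducibleI_mon) (auto simp: eqn_def)
  next
    fix b assume b: "(tail d i :: 'k mp) = mon b" "b \<in> exps" "deg b = d" "val b = n i * d" "b \<noteq> single i d"
    then show ?thesis
      using I e b pure_power_greatest[OF i(1) b(2-5)] by (intro reducibleI_binomial[of _ _ b]) (auto simp: eqn_def)
  qed
  then show ?thesis using expo_add_single_diff[OF a(2)] by simp
qed

lemma one_notin_tangent: "(1 :: 'k::field mp) \<notin> tangent"
proof -
  have "max_len 0 = 0" using max_len_mult_le[of 0] n0_pos by simp
  then show ?thesis using mono_in_tangent_iff[of 0, where ?'k = 'k] by simp
qed

lemma homogeneous_generators_subset:
  fixes I :: "'k::field mp set"
  assumes gen: "generated_in_degree_le m d (tangent :: 'k mp set)"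
    and I: "ideal I (mpoly_ring m)" "I \<subseteq> tangent"
    and red: "\<And>a. a \<in> exps \<Longrightarrow> deg a \<le> d \<Longrightarrow> \<not> normal a \<Longrightarrow> reducible I a"
  shows "tangent = I"
proof -
  obtain S :: "'k mp set" where S: "S \<subseteq> carrier (mpoly_ring m)" "\<And>f. f \<in> S \<Longrightarrow> \<exists>e\<le>d. homogeneous e f"
    "tangent = genideal (mpoly_ring m) S"
    using gen unfolding generated_in_degree_le_def by blast
  have "S \<subseteq> I"
  proof
    fix f assume f: "f \<in> S"
    then have "f \<in> tangent" using S(3) mpoly_genideal(2)[OF S(1)] by blast
    moreover obtain e where "e \<le> d" "homogeneous e f" using S(2) f by blast
    ultimately show "f \<in> I" using homogeneous_tangent_subset[OF I red, of e f] by auto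
  qed
  then have "tangent \<subseteq> I" unfolding S(3) by (rule mpoly_genideal(3)[OF S(1) I(1)])
  then show ?thesis using I(2) by blast
qed

text \<open>Each variable \<open>x\<^sub>1, \<dots>, x\<^sub>m\<^sub>-\<^sub>1\<close> bounds one side of the box that contains the standard exponents.\<close>

lemma n0_le_power:
  assumes gen: "generated_in_degree_le m d (tangent :: 'k::field mp set)"
  shows "n 0 \<le> d ^ (m - 1)"
    and "2 \<le> d \<Longrightarrow> (\<forall>i\<in>{1..<m}. pure_relation i d) \<or> n 0 \<le> (d - 1) * d ^ (m - 2)"
proof -
  have "\<exists>k\<le>d. pure_relation i k" if "i \<in> {1..<m}" for i
    using exists_pure_relation[OF gen, of i] that by (metis atLeastLessThan_iff less_eq_Suc_le One_nat_def)
  then obtain \<alpha> where \<alpha>: "\<And>i. i \<in> {1..<m} \<Longrightarrow> \<alpha> i \<le> d \<and> pure_relation i (\<alpha> i)" by metis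
  have ns: "\<not> standard (single i (\<alpha> i))" if "i \<in> {1..<m}" for i
    using pure_relation_not_standard[of i] \<alpha>[OF that] that by auto
  have le: "n 0 \<le> (\<Prod>i\<in>{1..<m}. \<alpha> i)" by (rule n0_le_prod) (use ns in blast)
  also have "\<dots> \<le> (\<Prod>i\<in>{1..<m}. d)" by (rule prod_mono) (use \<alpha> in auto)
  finally show "n 0 \<le> d ^ (m - 1)" by simp
  assume d: "2 \<le> d"
  show "(\<forall>i\<in>{1..<m}. pure_relation i d) \<or> n 0 \<le> (d - 1) * d ^ (m - 2)"
  proof (cases "\<forall>i\<in>{1..<m}. \<alpha> i = d")
    case True then show ?thesis using \<alpha> by metis
  next
    case False
    then obtain j where j: "j \<in> {1..<m}" "\<alpha> j \<noteq> d" by blast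
    then have "\<alpha> j \<le> d - 1" using \<alpha>[OF j(1)] by linarith
    have rest: "(\<Prod>i\<in>{1..<m} - {j}. \<alpha> i) \<le> (\<Prod>i\<in>{1..<m} - {j}. d)"
      by (rule prod_mono) (use \<alpha> in auto)
    have "(\<Prod>i\<in>{1..<m}. \<alpha> i) = \<alpha> j * (\<Prod>i\<in>{1..<m} - {j}. \<alpha> i)" using j by (intro prod.remove) auto
    also have "\<dots> \<le> (d - 1) * (\<Prod>i\<in>{1..<m} - {j}. d)"
      by (rule mult_mono[OF \<open>\<alpha> j \<le> d - 1\<close> rest]) auto
    also have "\<dots> = (d - 1) * d ^ (m - 2)"
    proof -
      have "card ({1..<m} - {j}) = m - 2" using j(1) by (subst card_Diff_singleton) auto
      then show ?thesis by simp
    qed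
    finally show ?thesis using le by simp
  qed
qed

definition slice :: "nat \<Rightarrow> 'k::field mp \<Rightarrow> 'k mp" where
  "slice e f = (\<Sum>a\<in>keys f. if deg a = e then single a (lookup f a) else 0)"

lemma lookup_slice: "lookup (slice e f) a = (if deg a = e then lookup f a else 0)"
proof -
  have "lookup (slice e f) a =
      (\<Sum>b\<in>keys f. if b = a then (if deg a = e then lookup f a else 0) else 0)"
    unfolding slice_def lookup_sum by (rule sum.cong) (auto simp: lookup_single when_def)
  also have "\<dots> = (if deg a = e then lookup f a else 0)"
    by (auto simp: in_keys_iff)
  finally show ?thesis .
qed

text \<open>Generators may be inhomogeneous, but if an ideal starts in degree \<open>d\<close>, then its part of degree \<open>d\<close> is
  spanned by the degree \<open>d\<close> parts of any generators: multiplying by \<open>c\<close> only sees the constant term of \<open>c\<close>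
  there.\<close>

lemma card_generators_ge:
  fixes I :: "'k::field mp set" and S B :: "'k mp set"
  assumes I: "I = genideal (mpoly_ring m) S" and S: "S \<subseteq> carrier (mpoly_ring m)" "finite S"
    and low: "\<And>f a. f \<in> I \<Longrightarrow> a \<in> keys f \<Longrightarrow> d \<le> deg a"
    and B: "B \<subseteq> I" "finite B" "\<And>f. f \<in> B \<Longrightarrow> homogeneous d f"
    and indep: "\<And>u. (\<Sum>f\<in>B. single 0 (u f) * f) = 0 \<Longrightarrow> \<forall>f\<in>B. u f = 0"
  shows "card B \<le> card S"
proof -
  interpret vs: vector_space "\<lambda>(c::'k) (f::'k mp). single 0 c * f"
    by unfold_locales (auto simp: algebra_simps single_add mult_single mult.assoc[symmetric])
  have slice_add: "slice d (f + g) = slice d f + slice d g" for f g :: "'k mp"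
    by (rule poly_mapping_eqI) (simp add: lookup_slice lookup_add)
  let ?T = "{f \<in> I. slice d f \<in> vs.span (slice d ` S)}"
  have idI: "ideal I (mpoly_ring m)" unfolding I by (rule mpoly_genideal(1)[OF S(1)])
  have "ideal ?T (mpoly_ring m)"
  proof (rule mpoly_idealI)
    show "?T \<subseteq> carrier (mpoly_ring m)" using mpoly_idealD(1)[OF idI] by blast
    show "0 \<in> ?T" using mpoly_idealD(2)[OF idI] vs.span_zero by (simp add: slice_def)
    fix f g assume "f \<in> ?T" "g \<in> ?T"
    then show "f + g \<in> ?T" using mpoly_idealD(3)[OF idI] by (auto simp: slice_add intro: vs.span_add)
  next
    fix c f :: "'k mp" assume c: "c \<in> carrier (mpoly_ring m)" and f: "f \<in> ?T"
    have "slice d (c * f) = single 0 (lookup c 0) * slice d f"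
    proof (rule poly_mapping_eqI)
      fix x
      show "lookup (slice d (c * f)) x = lookup (single 0 (lookup c 0) * slice d f) x"
      proof (cases "deg x = d")
        case False then show ?thesis by (simp add: lookup_slice)
      next
        case True
        have "lookup (c * f) x =
            (\<Sum>a\<in>insert 0 (keys c). lookup (single a (lookup c a) * f) x)"
        proof -
          have "(\<Sum>a\<in>insert 0 (keys c). single a (lookup c a) * f)
              = (\<Sum>a\<in>insert 0 (keys c). single a (lookup c a)) * f"
            by (rule sum_distrib_right[symmetric])
          also have "\<dots> = c * f"
            using mpoly_eq_sum_superset[OF finite.insertI[OF finite_keys[of c]] subset_insertI, of 0] by simp
          finally show ?thesis unfolding lookup_sum[symmetric] by (rule arg_cong[OF sym])
        qed
        also have "\<dots> = (\<Sum>a\<in>insert 0 (keys c). if a = 0 then lookup c 0 * lookup f x else 0)"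
        proof (rule sum.cong[OF refl])
          fix a assume "a \<in> insert 0 (keys c)"
          show "lookup (single a (lookup c a) * f) x
              = (if a = 0 then lookup c 0 * lookup f x else 0)"
          proof (cases "a = 0")
            case True then show ?thesis by simp
          next
            case False
            have da: "0 < deg a"
            proof -
              obtain i where "0 < lookup a i" using False by (metis gr0I poly_mapping_eqI lookup_zero)
              then have "a = single i 1 + (a - single i 1)"
                by (intro expo_add_single_diff) simp
              then have "deg a = 1 + deg (a - single i 1)" by (metis deg_add deg_single)
              then show ?thesis by simp
            qed
            have "x \<notin> keys (single a (lookup c a) * f)"
            proof
              assume "x \<in> keys (single a (lookup c a) * f)"
              then obtain b where b: "x = a + b" "b \<in> keys f" using keys_mono_mult by blast
              then have "d \<le> deg b" using low[of f b] f by auto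
              then show False using True da b(1) by (simp add: deg_add)
            qed
            then show ?thesis using False by (simp add: in_keys_iff)
          qed
        qed
        also have "\<dots> = lookup c 0 * lookup f x" by (simp add: sum.delta)
        finally show ?thesis using True by (simp add: lookup_slice)
      qed
    qed
    then show "c * f \<in> ?T" using f mpoly_idealD(4)[OF idI c] by (auto intro: vs.span_scale)
  qed
  moreover have "S \<subseteq> ?T" using mpoly_genideal(2)[OF S(1)] I by (auto intro: vs.span_base)
  ultimately have IT: "I \<subseteq> ?T" using mpoly_genideal(3)[OF S(1)] I by blast
  have "B \<subseteq> vs.span (slice d ` S)"
  proof
    fix f assume f: "f \<in> B"
    have "slice d f = f"
    proof (rule poly_mapping_eqI)
      fix a show "lookup (slice d f) a = lookup f a"
        using B(3)[OF f] unfolding homogeneous_iff by (cases "deg a = d") (auto simp: lookup_slice in_keys_iff)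
    qed
    then show "f \<in> vs.span (slice d ` S)" using IT B(1) f by auto
  qed
  moreover have "vs.independent B"
  proof
    assume "vs.dependent B"
    then obtain u where "\<exists>v\<in>B. u v \<noteq> 0" "(\<Sum>v\<in>B. single 0 (u v) * v) = 0"
      using vs.dependent_finite[OF B(2)] by auto
    then show False using indep by auto
  qed
  ultimately have "card B \<le> card (slice d ` S)"
    using vs.independent_span_bound[of "slice d ` S" B] S(2) by simp
  also have "\<dots> \<le> card S" by (rule card_image_le[OF S(2)])
  finally show ?thesis .
qed


definition pure_ideal :: "nat \<Rightarrow> 'k::field mp set" where
  "pure_ideal d = genideal (mpoly_ring m) (eqn d ` {1..<m})"

lemma pure_ideal:
  assumes "\<And>i. i \<in> {1..<m} \<Longrightarrow> pure_relation i d"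
  shows "ideal (pure_ideal d :: 'k::field mp set) (mpoly_ring m)" "(pure_ideal d :: 'k mp set) \<subseteq> tangent"
    "\<And>i. i \<in> {1..<m} \<Longrightarrow> (eqn d i :: 'k mp) \<in> pure_ideal d"
proof -
  have t: "(eqn d ` {1..<m} :: 'k mp set) \<subseteq> tangent"
    by (rule image_subsetI, rule eqn_tangent) (use assms in auto)
  have car: "(eqn d ` {1..<m} :: 'k mp set) \<subseteq> carrier (mpoly_ring m)" using t by (auto simp: tangent_def)
  show "ideal (pure_ideal d :: 'k::field mp set) (mpoly_ring m)"
    unfolding pure_ideal_def by (rule mpoly_genideal(1)[OF car])
  show "(pure_ideal d :: 'k mp set) \<subseteq> tangent"
    unfolding pure_ideal_def by (rule mpoly_genideal(3)[OF car tangent_ideal t])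
  show "\<And>i. i \<in> {1..<m} \<Longrightarrow> (eqn d i :: 'k mp) \<in> pure_ideal d"
    unfolding pure_ideal_def using mpoly_genideal(2)[OF car] by blast
qed

lemma complete_intersection_pure:
  assumes d: "0 < d" and pure: "\<And>i. i \<in> {1..<m} \<Longrightarrow> pure_relation i d"
    and eq: "(tangent :: 'k::field mp set) = pure_ideal d"
  shows "complete_intersection (mpoly_ring m) (tangent :: 'k mp set)"
proof -
  interpret S: pure_power_system m d cowt "tail d :: nat \<Rightarrow> 'k mp"
    by (rule pure_power_system_tail[OF d pure])
  have e: "S.eq = (eqn d :: nat \<Rightarrow> 'k mp)" by (rule ext) (simp add: S.eq_def eqn_def)
  have "(1 :: 'k mp) \<notin> pure_ideal d" using one_notin_tangent eq by metis
  moreover have "(1 :: 'k mp) \<in> carrier (mpoly_ring m)" by simp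
  ultimately have "genideal (mpoly_ring m) (S.eq ` {1..<m}) \<noteq> carrier (mpoly_ring m)"
    unfolding e pure_ideal_def[symmetric] by metis
  then have "regular_sequence (mpoly_ring m) (map S.eq [1..<m])" by (rule S.regular_sequence_eq)
  moreover have "tangent = genideal (mpoly_ring m) (set (map S.eq [1..<m]))"
    unfolding eq pure_ideal_def e by simp
  ultimately show ?thesis unfolding complete_intersection_def by blast
qed

lemma drop0_in_box:
  assumes "a \<in> exps" "\<And>i. i \<in> {1..<m} \<Longrightarrow> lookup a i < d"
  shows "drop0 a \<in> box {1..<m} (\<lambda>_. 0) (\<lambda>_. d)"
proof -
  have "x \<in> {1..<m}" if "x \<in> keys (drop0 a)" for x
  proof -
    have "x \<noteq> 0" using that by (cases "x = 0") (auto simp: in_keys_iff lookup_drop0)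
    moreover have "drop0 a \<in> exps" using assms(1) by simp
    ultimately show ?thesis using that by (auto simp: exps_def)
  qed
  then show ?thesis using assms(2) by (auto simp: box_def lookup_drop0)
qed

lemma sum_drop0: assumes "a \<in> exps" shows "(\<Sum>i\<in>{1..<m}. lookup a i) + lookup a 0 = deg a"
proof -
  have "deg a = (\<Sum>i\<in>{..<m}. lookup a i)"
    using assms by (intro deg_superset) (auto simp: exps_def)
  also have "{..<m} = insert 0 {1..<m}" using m_pos by auto
  finally show ?thesis by simp
qed

text \<open>The multiples of a nonstandard monomial are missing from the standard monomials in the box. If the
  bound is attained, \<open>prod_diff_lower_bound\<close> forces degree exactly \<open>d\<close>, which leaves no room for \<open>x\<^sub>0\<close>.\<close>

lemma box_bound:
  assumes dc: "2 \<le> d" "2 \<le> m - 1"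
    and pure: "\<And>i. i \<in> {1..<m} \<Longrightarrow> pure_relation i d"
    and a: "a \<in> exps" "\<not> standard a" "deg a \<le> d" "\<And>i. i \<in> {1..<m} \<Longrightarrow> lookup a i < d"
  shows "n 0 \<le> d ^ (m - 1) - (d - 1) * d ^ (m - 1 - 2)"
    and "n 0 = d ^ (m - 1) - (d - 1) * d ^ (m - 1 - 2) \<Longrightarrow>
      deg a = d \<and> lookup a 0 = 0 \<and>
      std = box {1..<m} (\<lambda>_. 0) (\<lambda>_. d) - box {1..<m} (lookup a) (\<lambda>_. d)"
proof -
  have ns: "\<not> standard (single i d)" if "i \<in> {1..<m}" for i
    using pure_relation_not_standard pure that by auto
  let ?u = "drop0 a"
  have u: "\<not> standard ?u" "?u \<in> box {1..<m} (\<lambda>_. 0) (\<lambda>_. d)" using a drop0_in_box by auto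
  have lu: "lookup ?u i = lookup a i" if "i \<in> {1..<m}" for i
    using that by (simp add: lookup_drop0)
  let ?p = "\<Prod>i\<in>{1..<m}. d - lookup a i"
  have pu: "(\<Prod>i\<in>{1..<m}. d - lookup ?u i) = ?p"
    by (rule prod.cong) (use lu in auto)
  have n0: "n 0 \<le> d ^ (m - 1) - ?p" using n0_le_box_minus_multiples(1)[OF ns u] unfolding pu .
  have s: "(\<Sum>i\<in>{1..<m}. lookup a i) \<le> d" using sum_drop0[OF a(1)] a(3) by linarith
  have c: "card {1..<m} = m - 1" by simp
  have p: "(d - 1) * d ^ (m - 1 - 2) \<le> ?p"
    using prod_diff_lower_bound(1)[of "{1..<m}" d "lookup a"] dc a(4) s unfolding c by auto
  have pstrict: "(d - 1) * d ^ (m - 1 - 2) < ?p" if "(\<Sum>i\<in>{1..<m}. lookup a i) < d"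
    using prod_diff_lower_bound(2)[of "{1..<m}" d "lookup a"] dc a(4) s that unfolding c by auto
  show "n 0 \<le> d ^ (m - 1) - (d - 1) * d ^ (m - 1 - 2)" using n0 p by linarith
  assume eq: "n 0 = d ^ (m - 1) - (d - 1) * d ^ (m - 1 - 2)"
  have "?p \<le> (\<Prod>i\<in>{1..<m}. d)" by (rule prod_mono) auto
  then have pd: "?p \<le> d ^ (m - 1)" by simp
  then have peq: "?p = (d - 1) * d ^ (m - 1 - 2)" using eq n0 p by linarith
  then have "\<not> (\<Sum>i\<in>{1..<m}. lookup a i) < d" using pstrict by linarith
  then have "deg a = d" "lookup a 0 = 0" using sum_drop0[OF a(1)] a(3) s by linarith+
  moreover from this(2) have ua: "?u = a" by (rule drop0_id)
  ultimately show "deg a = d \<and> lookup a 0 = 0 \<and>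
      std = box {1..<m} (\<lambda>_. 0) (\<lambda>_. d) - box {1..<m} (lookup a) (\<lambda>_. d)"
    using n0_le_box_minus_multiples(2)[OF ns u] eq unfolding pu peq ua by simp
qed

text \<open>If every monomial that is not normal and of degree at most \<open>d\<close> could be reduced with the pure power
  equations, these would generate the whole ideal.\<close>

lemma irreducible_witness:
  assumes d: "0 < d" and gen: "generated_in_degree_le m d (tangent :: 'k::field mp set)"
    and pure: "\<And>i. i \<in> {1..<m} \<Longrightarrow> pure_relation i d"
    and nci: "\<not> complete_intersection (mpoly_ring m) (tangent :: 'k mp set)"
  obtains a where "a \<in> exps" "\<not> normal a" "deg a \<le> d" "\<And>i. i \<in> {1..<m} \<Longrightarrow> lookup a i < d"
proof -
  have "(tangent :: 'k mp set) \<noteq> pure_ideal d" using complete_intersection_pure[OF d pure] nci by blast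
  then have "\<not> (\<forall>a. a \<in> exps \<longrightarrow> deg a \<le> d \<longrightarrow> \<not> normal a \<longrightarrow> reducible (pure_ideal d :: 'k mp set) a)"
    using homogeneous_generators_subset[OF gen pure_ideal(1,2)[OF pure]] by blast
  then obtain a where a: "a \<in> exps" "deg a \<le> d" "\<not> normal a" "\<not> reducible (pure_ideal d :: 'k mp set) a" by blast
  have "lookup a i < d" if i: "i \<in> {1..<m}" for i
  proof (rule ccontr)
    assume "\<not> lookup a i < d"
    then have "d \<le> lookup a i" by simp
    then have "reducible (pure_ideal d :: 'k mp set) a"
      using reducible_pure[OF pure_ideal(1)[OF pure] pure_ideal(3)[OF pure i] _ pure[OF i] a(1)] i by simp
    then show False using a(4) by blast
  qed
  then show ?thesis using that a by blast
qed

text \<open>In the extremal case the pure power equations together with one equation for \<open>a\<close> reduce every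
  nonstandard monomial. So they generate the ideal, and normal monomials are standard. As standardness
  ignores \<open>x\<^sub>0\<close>, the first claim follows: it says that \<open>x\<^sub>0\<close> is a nonzerodivisor.\<close>

lemma extremal_case:
  assumes dc: "2 \<le> d" "2 \<le> m - 1" and gen: "generated_in_degree_le m d (tangent :: 'k::field mp set)"
    and pure: "\<And>i. i \<in> {1..<m} \<Longrightarrow> pure_relation i d"
    and a: "a \<in> exps" "\<not> normal a" "deg a \<le> d" "\<And>i. i \<in> {1..<m} \<Longrightarrow> lookup a i < d"
    and n0: "n 0 = d ^ (m - 1) - (d - 1) * d ^ (m - 1 - 2)"
  shows "\<And>s. s \<in> sgp \<Longrightarrow> max_len (s + n 0) = Suc (max_len s)"
    and "minimally_generated_by (mpoly_ring m) (tangent :: 'k mp set) (m - 1 + 1)"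
proof -
  have d0: "0 < d" using dc by simp
  have nsa: "\<not> standard a" using a standard_imp_normal by blast
  have aeq: "deg a = d" "lookup a 0 = 0"
    and std: "std = box {1..<m} (\<lambda>_. 0) (\<lambda>_. d) - box {1..<m} (lookup a) (\<lambda>_. d)"
    using box_bound(2)[OF dc pure a(1) nsa a(3,4) n0] by auto
  obtain t :: "'k mp" where t: "t = 0 \<and> deg a < max_len (val a) \<or>
      (\<exists>b\<in>exps. t = mon b \<and> deg b = deg a \<and> val b = val a \<and> b \<prec> a)"
    using not_normal_cases[OF a(1,2)] by metis
  define g where "g = mon a - t"
  have gt: "g \<in> tangent"
    using t a(1) by (auto simp: g_def mono_in_tangent_iff intro: binomial_in_tangent)
  let ?B = "insert g (eqn d ` {1..<m})"
  have "(eqn d ` {1..<m} :: 'k mp set) \<subseteq> tangent"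
    by (rule image_subsetI, rule eqn_tangent) (use pure in auto)
  then have Bt: "?B \<subseteq> tangent" using gt by blast
  have Bc: "?B \<subseteq> carrier (mpoly_ring m)" using Bt by (auto simp: tangent_def)
  define I where "I = genideal (mpoly_ring m) ?B"
  have I: "ideal I (mpoly_ring m)" "?B \<subseteq> I" "I \<subseteq> tangent"
    unfolding I_def using mpoly_genideal[OF Bc] Bt tangent_ideal by auto
  \<comment> \<open>A nonstandard exponent leaves the box or is a multiple of \<open>a\<close>.\<close>
  have red: "reducible I x" if x: "x \<in> exps" "\<not> standard x" for x
  proof (cases "\<exists>i\<in>{1..<m}. d \<le> lookup x i")
    case True
    then obtain i where i: "i \<in> {1..<m}" "d \<le> lookup x i" by blast
    show ?thesis by (rule reducible_pure[OF I(1) _ _ pure[OF i(1)] x(1) i(2)]) (use I(2) i in auto)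
  next
    case False
    then have xb: "drop0 x \<in> box {1..<m} (\<lambda>_. 0) (\<lambda>_. d)" using drop0_in_box[OF x(1)] by (meson not_le)
    have "drop0 x \<notin> std" using x by (simp add: std_def)
    then have "drop0 x \<in> box {1..<m} (lookup a) (\<lambda>_. d)" using std xb by blast
    then have le1: "lookup a i \<le> lookup x i" if "i \<in> {1..<m}" for i
      using that by (auto simp: box_def lookup_drop0)
    have le: "lookup a i \<le> lookup x i" for i
    proof (cases "i \<in> {1..<m}")
      case True then show ?thesis by (rule le1)
    next
      case False
      then have "i = 0 \<or> i \<notin> keys a" using a(1) by (auto simp: exps_def)
      then show ?thesis using aeq(2) by (auto simp: in_keys_iff)
    qed
    have e: "x - a \<in> exps" using x exps_minus by blast
    have gI: "g \<in> I" using I(2) by blast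
    from t have "reducible I (a + (x - a))"
    proof
      assume "t = 0 \<and> deg a < max_len (val a)"
      then show ?thesis using gI e I(1) by (intro reducibleI_mon) (auto simp: g_def)
    next
      assume "\<exists>b\<in>exps. t = mon b \<and> deg b = deg a \<and> val b = val a \<and> b \<prec> a"
      then obtain b where "b \<in> exps" "t = mon b" "deg b = deg a" "b \<prec> a" by blast
      then show ?thesis using gI e I(1) by (intro reducibleI_binomial[of _ _ b]) (auto simp: g_def)
    qed
    then show ?thesis using expo_le_imp_add[OF le] by simp
  qed
  have normal_std: "standard x" if x: "x \<in> exps" "normal x" for x
  proof (rule ccontr)
    assume "\<not> standard x"
    with red[OF x(1)] consider "mon x \<in> I" | b where "b \<in> exps" "deg b = deg x" "b \<prec> x" "mon x - mon b \<in> I"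
      unfolding reducible_def by blast
    then show False
    proof cases
      case 1
      then have "(mon x :: 'k mp) \<in> tangent" using I(3) by blast
      then show False using x mono_in_tangent_iff[OF x(1), where ?'k = 'k] by (simp add: normal_def)
    next
      case (2 b)
      then have "(mon x - mon b :: 'k mp) \<in> tangent" using I(3) by blast
      then have "coef (mon x - mon b :: 'k mp) (val x) = 0" by (simp add: tangent_def)
      then have "val b = val x" using x(2) by (simp add: coef_minus coef_single normal_def split: if_splits)
      then show False using x(2) 2 by (auto simp: normal_def)
    qed
  qed
  have TI: "(tangent :: 'k mp set) = I"
  proof (rule homogeneous_generators_subset[OF gen I(1,3)])
    fix x assume x: "x \<in> exps" "\<not> normal x"
    then show "reducible I x" using red standard_imp_normal by blast
  qed
  show "max_len (s + n 0) = Suc (max_len s)" if s: "s \<in> sgp" for s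
  proof -
    obtain x where x: "x \<in> exps" "val x = s" "normal x" using normal_exists[OF s] .
    let ?y = "x + single 0 1"
    have "drop0 ?y = drop0 x" by (simp add: drop0_add)
    then have "standard ?y" using normal_std[OF x(1,3)] by (metis standard_drop0)
    moreover have "?y \<in> exps" using x m_pos by (simp add: exps_add_iff)
    ultimately have "normal ?y" using standard_imp_normal by blast
    moreover have "val ?y = s + n 0" "deg ?y = Suc (deg x)" using x by (simp_all add: weight_add deg_add)
    ultimately show ?thesis using x by (simp add: normal_def)
  qed
  \<comment> \<open>A nonstandard monomial of degree below \<open>d\<close> would make the bound strict, so the ideal starts in
    degree \<open>d\<close>.\<close>
  have low_normal: "normal x" if x: "x \<in> exps" "deg x < d" for x
  proof (rule ccontr)
    assume "\<not> normal x"
    then have ns: "\<not> standard x" using x standard_imp_normal by blast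
    have lx: "lookup x i < d" if "i \<in> {1..<m}" for i
    proof -
      have "lookup x i \<le> (\<Sum>i\<in>{1..<m}. lookup x i)"
        by (rule member_le_sum) (use that in auto)
      then show ?thesis using sum_drop0[OF x(1)] x(2) by linarith
    qed
    have "deg x = d" using box_bound(2)[OF dc pure x(1) ns _ lx n0] x(2) by simp
    then show False using x(2) by simp
  qed
  have low: "d \<le> deg x" if f: "f \<in> tangent" "x \<in> keys f" for f :: "'k mp" and x
  proof (rule ccontr)
    assume "\<not> d \<le> deg x"
    then have dx: "deg x < d" by simp
    have car: "keys f \<subseteq> exps" using f by (simp add: tangent_def carrier_exps)
    have nx: "normal x" using low_normal f car dx by blast
    have "coef f (val x) = (\<Sum>y\<in>keys f. if y = x then lookup f y else 0)"
      unfolding coef_def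
    proof (rule sum.cong[OF refl])
      fix y assume y: "y \<in> keys f"
      have "val y = val x \<and> deg y = max_len (val x) \<longleftrightarrow> y = x"
      proof
        assume yx: "val y = val x \<and> deg y = max_len (val x)"
        then have "deg y < d" using nx dx by (simp add: normal_def)
        then show "y = x" using low_normal[of y] normal_unique[of y x] nx yx y f(2) car by blast
      qed (use nx in \<open>simp add: normal_def\<close>)
      then show "(if val y = val x \<and> deg y = max_len (val x) then lookup f y else 0) =
        (if y = x then lookup f y else 0)" by simp
    qed
    also have "\<dots> = lookup f x" using f(2) by simp
    finally show False using f by (auto simp: tangent_def in_keys_iff)
  qed
  \<comment> \<open>Independence is read off from the coefficients at the pure powers and at \<open>a\<close>: the second term of
    \<open>g\<close> precedes \<open>a\<close>, whereas a pure power of the same degree and value does not.\<close>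
  have ge: "lookup g (single i d) = 0" if i: "i \<in> {1..<m}" for i
  proof -
    have ai: "a \<noteq> single i d" using a(4)[OF i] by auto
    have "lookup t (single i d) = 0"
    proof (rule ccontr)
      assume "lookup t (single i d) \<noteq> 0"
      then have "deg a = d" "val a = n i * d" "single i d \<prec> a"
        using t by (auto simp: lookup_single when_def split: if_splits)
      then show False using pure_power_greatest[of i a d] ai a(1) i prec_asym by auto
    qed
    then show ?thesis using ai by (simp add: g_def lookup_minus lookup_single when_def)
  qed
  have ga: "lookup g a = 1"
  proof -
    have "lookup t a = 0" using t prec_irrefl by (auto simp: lookup_single when_def)
    then show ?thesis by (simp add: g_def lookup_minus)
  qed
  have ee: "lookup (eqn d i :: 'k mp) (single j d) = (if i = j then 1 else 0)"
    if "i \<in> {1..<m}" "j \<in> {1..<m}" for i j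
  proof -
    have "single i d = single j d \<longleftrightarrow> i = j"
    proof
      assume "single i d = single j d"
      then have "lookup (single i d) i = lookup (single j d) i" by simp
      then show "i = j" using d0 by (simp add: lookup_single when_def split: if_splits)
    qed simp
    then show ?thesis
      using lookup_tail_pure[OF _ pure[OF that(1)] d0, of j, where ?'k = 'k] that
      by (simp add: eqn_def lookup_minus lookup_single when_def)
  qed
  have inj: "inj_on (eqn d :: nat \<Rightarrow> 'k mp) {1..<m}"
  proof (rule inj_onI)
    fix i j assume ij: "i \<in> {1..<m}" "j \<in> {1..<m}" "(eqn d i :: 'k mp) = eqn d j"
    have "(if j = i then 1 else 0) = (1 :: 'k)"
      using ee[OF ij(1,1)] unfolding ij(3) ee[OF ij(2,1)] by simp
    then show "i = j" by (metis zero_neq_one)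
  qed
  have gn: "g \<notin> eqn d ` {1..<m}"
  proof
    assume "g \<in> eqn d ` {1..<m}"
    then obtain i where i: "i \<in> {1..<m}" "g = eqn d i" by blast
    then show False using ge[OF i(1)] ee[OF i(1,1)] by simp
  qed
  have card: "card ?B = m - 1 + 1" using gn card_image[OF inj] by simp
  have hom: "homogeneous d f" if "f \<in> ?B" for f
  proof -
    have "homogeneous d g" using t aeq(1) unfolding homogeneous_iff g_def
      by (auto simp: in_keys_iff lookup_minus lookup_single when_def split: if_splits)
    moreover have "homogeneous d (eqn d i :: 'k mp)" if i: "i \<in> {1..<m}" for i
      by (rule tail_cases[OF _ pure[OF i], where ?'k = 'k])
        (use i in \<open>auto simp: homogeneous_iff eqn_def in_keys_iff lookup_minus lookup_single when_def split: if_splits\<close>)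
    ultimately show ?thesis using that by blast
  qed
  have indep: "\<forall>f\<in>?B. u f = 0" if z: "(\<Sum>f\<in>?B. single 0 (u f) * f) = 0" for u :: "'k mp \<Rightarrow> 'k"
  proof -
    have sum: "(\<Sum>f\<in>?B. u f * lookup f x) = 0" for x
    proof -
      have "lookup (\<Sum>f\<in>?B. single 0 (u f) * f) x = 0" unfolding z by simp
      then show ?thesis unfolding lookup_sum lookup_scale .
    qed
    have ue: "u (eqn d j) = 0" if j: "j \<in> {1..<m}" for j
    proof -
      have "(\<Sum>f\<in>?B. u f * lookup f (single j d)) =
          (\<Sum>f\<in>eqn d ` {1..<m}. u f * lookup f (single j d))"
        using gn ge[OF j] by simp
      also have "\<dots> = (\<Sum>i\<in>{1..<m}. u (eqn d i) * lookup (eqn d i) (single j d))"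
        by (rule sum.reindex[OF inj, unfolded comp_def])
      also have "\<dots> = (\<Sum>i\<in>{1..<m}. if i = j then u (eqn d j) else 0)"
        by (rule sum.cong[OF refl]) (use ee[OF _ j] in auto)
      also have "\<dots> = u (eqn d j)" using j by simp
      finally show ?thesis using sum by simp
    qed
    have "(\<Sum>f\<in>eqn d ` {1..<m}. u f * lookup f a) = 0"
      proof (rule sum.neutral, rule ballI)
      fix f :: "'k mp" assume "f \<in> eqn d ` {1..<m}"
      then have "u f = 0" using ue by blast
      then show "u f * lookup f a = 0" by simp
    qed
    then have "(\<Sum>f\<in>?B. u f * lookup f a) = u g * lookup g a"
      using gn by simp
    then have "u g = 0" using sum[of a] ga by simp
    then show ?thesis using ue by blast
  qed
  show "minimally_generated_by (mpoly_ring m) (tangent :: 'k mp set) (m - 1 + 1)"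
    unfolding minimally_generated_by_def
  proof (intro conjI allI impI)
    show "\<exists>S\<subseteq>carrier (mpoly_ring m). finite S \<and> card S = m - 1 + 1 \<and> (tangent :: 'k mp set) = genideal (mpoly_ring m) S"
      by (rule exI[of _ ?B]) (use Bc card TI I_def in auto)
    fix S :: "'k mp set" assume S: "S \<subseteq> carrier (mpoly_ring m)" "finite S \<and> tangent = genideal (mpoly_ring m) S"
    have "card ?B \<le> card S"
    proof (rule card_generators_ge[where I = tangent and d = d])
      show "tangent = genideal (mpoly_ring m) S" "finite S" using S(2) by auto
      show "finite ?B" by simp
    qed (fact S(1) low Bt hom indep)+
    then show "m - 1 + 1 \<le> card S" using card by simp
  qed
qed

text \<open>If \<open>m - 1 < c\<close>, or if one side of the box is shorter than \<open>d\<close>, the size of the box alone is below the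
  bound (\<open>bound_arith\<close>). Otherwise the witness for not being a complete intersection removes enough of a
  box with all sides \<open>d\<close>.\<close>

theorem multiplicity_bound:
  assumes dc: "2 \<le> d" "2 \<le> c" "m - 1 \<le> c"
    and gen: "generated_in_degree_le m d (tangent :: 'k::field mp set)"
    and nci: "\<not> complete_intersection (mpoly_ring m) (tangent :: 'k mp set)"
  shows "n 0 \<le> d ^ c - (d - 1) * d ^ (c - 2)"
    and "n 0 = d ^ c - (d - 1) * d ^ (c - 2) \<Longrightarrow>
      (\<forall>s\<in>sgp. max_len (s + n 0) = Suc (max_len s)) \<and>
      minimally_generated_by (mpoly_ring m) (tangent :: 'k mp set) (c + 1)"
proof -
  have "n 0 < d ^ c - (d - 1) * d ^ (c - 2) \<or> (m - 1 = c \<and> (\<forall>i\<in>{1..<m}. pure_relation i d))"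
  proof (cases "m - 1 = c")
    case False
    then have "m - 1 \<le> c - 1" using dc by linarith
    then have "d ^ (m - 1) \<le> d ^ (c - 1)" using dc by (intro power_increasing) auto
    then show ?thesis using n0_le_power(1)[OF gen] bound_arith(1)[OF dc(1,2)] by linarith
  next
    case True
    then have "m - 2 = c - 1" by simp
    then show ?thesis using n0_le_power(2)[OF gen dc(1)] bound_arith(2)[OF dc(1,2)] True by auto
  qed
  moreover have "n 0 \<le> d ^ c - (d - 1) * d ^ (c - 2) \<and> (n 0 = d ^ c - (d - 1) * d ^ (c - 2) \<longrightarrow>
      (\<forall>s\<in>sgp. max_len (s + n 0) = Suc (max_len s)) \<and>
      minimally_generated_by (mpoly_ring m) (tangent :: 'k mp set) (c + 1))"
    if mc: "m - 1 = c" and pure: "\<forall>i\<in>{1..<m}. pure_relation i d"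
  proof -
    have dm: "2 \<le> m - 1" using dc mc by simp
    have pure': "\<And>i. i \<in> {1..<m} \<Longrightarrow> pure_relation i d" using pure by blast
    have d0: "0 < d" using dc by simp
    obtain a where a: "a \<in> exps" "\<not> normal a" "deg a \<le> d" "\<And>i. i \<in> {1..<m} \<Longrightarrow> lookup a i < d"
      using irreducible_witness[OF d0 gen pure' nci] by blast
    have ns: "\<not> standard a" using a standard_imp_normal by blast
    have "n 0 \<le> d ^ (m - 1) - (d - 1) * d ^ (m - 1 - 2)"
      by (rule box_bound(1)[OF dc(1) dm pure' a(1) ns a(3,4)])
    moreover note extremal_case[OF dc(1) dm gen pure' a]
    ultimately show ?thesis unfolding mc by blast
  qed
  ultimately show "n 0 \<le> d ^ c - (d - 1) * d ^ (c - 2)"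
    and "n 0 = d ^ c - (d - 1) * d ^ (c - 2) \<Longrightarrow>
      (\<forall>s\<in>sgp. max_len (s + n 0) = Suc (max_len s)) \<and>
      minimally_generated_by (mpoly_ring m) (tangent :: 'k mp set) (c + 1)"
    using less_imp_le less_irrefl by metis+
qed

end

section \<open>Minimal generators\<close>

text \<open>Every generating set contains the atoms, and the atoms generate.\<close>

definition atoms :: "nat set \<Rightarrow> nat set" where
  "atoms \<Lambda> = {s \<in> \<Lambda>. 0 < s \<and> \<not> (\<exists>a\<in>\<Lambda>. \<exists>b\<in>\<Lambda>. 0 < a \<and> 0 < b \<and> s = a + b)}"

lemma submonoid_gen_base: "a \<in> A \<Longrightarrow> a \<in> submonoid_gen A"
  using submonoid_gen.add[OF _ submonoid_gen.zero, of a A] by simp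

lemma submonoid_gen_subset:
  assumes "A \<subseteq> \<Lambda>" "0 \<in> \<Lambda>" "\<And>a b. a \<in> \<Lambda> \<Longrightarrow> b \<in> \<Lambda> \<Longrightarrow> a + b \<in> \<Lambda>"
  shows "submonoid_gen A \<subseteq> \<Lambda>"
proof
  fix s assume "s \<in> submonoid_gen A"
  then show "s \<in> \<Lambda>" by induction (use assms in auto)
qed

lemma submonoid_gen_plus:
  assumes "a \<in> submonoid_gen A" "b \<in> submonoid_gen A" shows "a + b \<in> submonoid_gen A"
  using assms by (induction) (auto simp: add.assoc intro: submonoid_gen.add)

lemma numerical_semigroup_atoms:
  assumes "numerical_semigroup \<Lambda>"
  shows "submonoid_gen (atoms \<Lambda>) = \<Lambda>" and "\<And>A. submonoid_gen A = \<Lambda> \<Longrightarrow> atoms \<Lambda> \<subseteq> A"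
    and "min_gens \<Lambda> = atoms \<Lambda>" and "finite (atoms \<Lambda>)" and "atoms \<Lambda> \<noteq> {}"
proof -
  have z: "0 \<in> \<Lambda>" and add: "\<And>a b. a \<in> \<Lambda> \<Longrightarrow> b \<in> \<Lambda> \<Longrightarrow> a + b \<in> \<Lambda>" and fin: "finite (UNIV - \<Lambda>)"
    using assms by (auto simp: numerical_semigroup_def)
  have sub: "submonoid_gen (atoms \<Lambda>) \<subseteq> \<Lambda>"
    by (rule submonoid_gen_subset) (use z add in \<open>auto simp: atoms_def\<close>)
  have "s \<in> submonoid_gen (atoms \<Lambda>)" if "s \<in> \<Lambda>" for s
    using that
  proof (induction s rule: less_induct)
    case (less s)
    show ?case
    proof (cases "s = 0 \<or> s \<in> atoms \<Lambda>")
      case True then show ?thesis using submonoid_gen.zero submonoid_gen_base by blast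
    next
      case False
      then obtain a b where "a \<in> \<Lambda>" "b \<in> \<Lambda>" "0 < a" "0 < b" "s = a + b"
        using less.prems by (auto simp: atoms_def)
      then show ?thesis using less.IH[of a] less.IH[of b] submonoid_gen_plus by simp
    qed
  qed
  then show gen: "submonoid_gen (atoms \<Lambda>) = \<Lambda>" using sub by blast
  show least: "atoms \<Lambda> \<subseteq> A" if A: "submonoid_gen A = \<Lambda>" for A
  proof
    fix s assume s: "s \<in> atoms \<Lambda>"
    have AL: "A \<subseteq> \<Lambda>" using submonoid_gen_base A by blast
    have "t \<in> submonoid_gen A \<Longrightarrow> t \<in> atoms \<Lambda> \<Longrightarrow> t \<in> A" for t
    proof (induction rule: submonoid_gen.induct)
      case zero then show ?case by (simp add: atoms_def)
    next
      case (add a t)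
      then have "a \<in> \<Lambda>" "t \<in> \<Lambda>" using AL A by auto
      then have "a = 0 \<or> t = 0" using add.prems by (auto simp: atoms_def)
      then show ?case using add by auto
    qed
    then show "s \<in> A" using s A by (auto simp: atoms_def)
  qed
  show "min_gens \<Lambda> = atoms \<Lambda>"
    unfolding min_gens_def
  proof (rule the_equality)
    show "submonoid_gen (atoms \<Lambda>) = \<Lambda> \<and> (\<forall>B. B \<subset> atoms \<Lambda> \<longrightarrow> submonoid_gen B \<noteq> \<Lambda>)"
      using gen least by blast
    fix A assume "submonoid_gen A = \<Lambda> \<and> (\<forall>B. B \<subset> A \<longrightarrow> submonoid_gen B \<noteq> \<Lambda>)"
    then show "A = atoms \<Lambda>" using gen least by blast
  qed
  have "infinite \<Lambda>" using fin by (metis Diff_infinite_finite infinite_UNIV_nat)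
  then obtain k where k: "k \<in> \<Lambda>" "0 < k" using infinite_nat_iff_unbounded by blast
  have mult: "j * k \<in> \<Lambda>" for j by (induction j) (use z add k in auto)
  \<comment> \<open>Two atoms in the same class modulo \<open>k\<close> would differ by a multiple of \<open>k\<close>, so there are at most \<open>k\<close>.\<close>
  have neq: False if st: "s \<in> atoms \<Lambda>" "t \<in> atoms \<Lambda>" "s mod k = t mod k" "s < t" for s t
  proof -
    have "k dvd t - s" using st by (metis mod_eq_dvd_iff_nat less_imp_le)
    then obtain j where j: "t - s = j * k" by (metis dvdE mult.commute)
    then have "t = s + j * k" "0 < j * k" using st(4) by linarith+
    have "s \<in> \<Lambda>" "0 < s" using st(1) by (auto simp: atoms_def)
    then have "\<exists>a\<in>\<Lambda>. \<exists>b\<in>\<Lambda>. 0 < a \<and> 0 < b \<and> t = a + b"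
      using \<open>t = s + j * k\<close> \<open>0 < j * k\<close> mult[of j] by blast
    then show False using st(2) unfolding atoms_def by blast
  qed
  have "inj_on (\<lambda>s. s mod k) (atoms \<Lambda>)"
    by (rule inj_onI) (use neq in \<open>metis linorder_neqE_nat\<close>)
  moreover have "(\<lambda>s. s mod k) ` atoms \<Lambda> \<subseteq> {..<k}" using k by auto
  ultimately show "finite (atoms \<Lambda>)" using finite_lessThan finite_subset finite_imageD by metis
  show "atoms \<Lambda> \<noteq> {}"
  proof
    assume "atoms \<Lambda> = {}"
    then have "\<Lambda> = submonoid_gen {}" using gen by simp
    moreover have "submonoid_gen {} \<subseteq> {0}"
      by (rule submonoid_gen_subset) auto
    ultimately show False using k by auto
  qed
qed

lemma weight_closed:
  assumes "0 \<in> \<Lambda>" "\<And>a b. a \<in> \<Lambda> \<Longrightarrow> b \<in> \<Lambda> \<Longrightarrow> a + b \<in> \<Lambda>"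
    and "\<And>i. i \<in> keys a \<Longrightarrow> w i \<in> \<Lambda>"
  shows "weight w a \<in> (\<Lambda> :: nat set)"
proof -
  have mult: "x * j \<in> \<Lambda>" if "x \<in> \<Lambda>" for x j by (induction j) (use assms(1,2) that in auto)
  have "(\<Sum>i\<in>S. w i * lookup a i) \<in> \<Lambda>" if "finite S" "S \<subseteq> keys a" for S
    using that by (induction S rule: finite_induct) (use assms mult in auto)
  then show ?thesis unfolding weight_def by simp
qed

theorem numerical_semigroup_generators:
  assumes L: "numerical_semigroup \<Lambda>"
  shows "monoid_generators (min_gen \<Lambda>) (card (min_gens \<Lambda>))"
    and "monoid_generators.sgp (min_gen \<Lambda>) (card (min_gens \<Lambda>)) = \<Lambda>"
    and "min_gens \<Lambda> = min_gen \<Lambda> ` {..<card (min_gens \<Lambda>)}"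
proof -
  note A = numerical_semigroup_atoms[OF L]
  have z: "0 \<in> \<Lambda>" and add: "\<And>a b. a \<in> \<Lambda> \<Longrightarrow> b \<in> \<Lambda> \<Longrightarrow> a + b \<in> \<Lambda>" and fin: "finite (UNIV - \<Lambda>)"
    using L by (auto simp: numerical_semigroup_def)
  let ?xs = "sorted_list_of_set (min_gens \<Lambda>)" and ?m = "card (min_gens \<Lambda>)" and ?n = "min_gen \<Lambda>"
  have finG: "finite (min_gens \<Lambda>)" using A by simp
  have len: "length ?xs = ?m" by simp
  have set: "set ?xs = min_gens \<Lambda>" using finG by simp
  show im: "min_gens \<Lambda> = ?n ` {..<?m}"
    using set unfolding min_gen_def[abs_def] by (metis len list.set_map map_nth set_upt atLeast0LessThan)
  have mono: "?n i < ?n j" if "i < j" "j < ?m" for i j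
    using that strict_sorted_list_of_set[of "min_gens \<Lambda>"] unfolding min_gen_def
    by (simp add: sorted_wrt_iff_nth_less)
  have mpos: "0 < ?m" using A finG by (simp add: card_gt_0_iff)
  have ng: "?n i \<in> atoms \<Lambda>" if "i < ?m" for i using im that A(3) by blast
  have sgp: "weight ?n ` {a. keys a \<subseteq> {..<?m}} = \<Lambda>"
  proof
    show "weight ?n ` {a. keys a \<subseteq> {..<?m}} \<subseteq> \<Lambda>"
    proof clarify
      fix a :: expo assume "keys a \<subseteq> {..<?m}"
      then show "weight ?n a \<in> \<Lambda>" by (intro weight_closed z add) (use ng in \<open>auto simp: atoms_def\<close>)
    qed
    have "s \<in> weight ?n ` {a. keys a \<subseteq> {..<?m}}" if "s \<in> submonoid_gen (atoms \<Lambda>)" for s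
      using that
    proof induction
      case zero show ?case by (rule image_eqI[of _ _ 0]) auto
    next
      case (add g s)
      obtain i where i: "i < ?m" "g = ?n i" using add(1) im A(3) by auto
      obtain a where a: "keys a \<subseteq> {..<?m}" "s = weight ?n a" using add by blast
      show ?case
        by (rule image_eqI[of _ _ "single i 1 + a"])
          (use i a in \<open>auto simp: weight_add keys_add_nat\<close>)
    qed
    then show "\<Lambda> \<subseteq> weight ?n ` {a. keys a \<subseteq> {..<?m}}" using A(1) by blast
  qed
  show loc: "monoid_generators ?n ?m"
  proof
    show "0 < ?m" by (rule mpos)
    show "\<And>i j. i < j \<Longrightarrow> j < ?m \<Longrightarrow> ?n i < ?n j" by (rule mono)
    show "0 < ?n 0" using ng[OF mpos] by (simp add: atoms_def)
    show "finite (UNIV - weight ?n ` {a. keys a \<subseteq> {..<?m}})" unfolding sgp by (rule fin)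
  qed
  interpret monoid_generators ?n ?m by (rule loc)
  show "sgp = \<Lambda>" unfolding sgp_def exps_def by (rule sgp)
qed

section \<open>The maximal ideal of the semigroup ring and its powers\<close>

context monoid_generators
begin

abbreviation R :: "'k::field fps ring" where "R \<equiv> semigroup_ring sgp"

lemma R_simps [simp]:
  "mult R = (*)" "one R = 1" "zero R = 0" "add R = (+)"
  by (simp_all add: semigroup_ring_def)

lemma R_carrier: "f \<in> carrier R \<longleftrightarrow> (\<forall>s. fps_nth f s \<noteq> 0 \<longrightarrow> s \<in> sgp)"
  by (simp add: semigroup_ring_def)

text \<open>This is the power \<open>mm\<^sup>i\<close> of the maximal ideal, see \<open>ideal_pow_mm\<close>.\<close>

definition filt :: "nat \<Rightarrow> 'k::field fps set" where
  "filt i = {f. \<forall>s. fps_nth f s \<noteq> 0 \<longrightarrow> s \<in> sgp \<and> i \<le> max_len s}"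

definition mm :: "'k::field fps set" where
  "mm = genideal R {fps_X ^ g | g. g \<in> n ` {..<m}}"

lemma filt_0: "filt 0 = carrier R"
  by (auto simp: filt_def R_carrier)

lemma filt_antimono: "i \<le> j \<Longrightarrow> filt j \<subseteq> filt i"
  by (auto simp: filt_def)

lemma filt_carrier: "filt i \<subseteq> carrier R"
  by (auto simp: filt_def R_carrier)

lemma filt_zero [simp]: "0 \<in> filt i"
  by (simp add: filt_def)

lemma filt_add: assumes "f \<in> filt i" "g \<in> filt i" shows "f + g \<in> filt i"
  unfolding filt_def
proof (intro CollectI allI impI)
  fix s assume "fps_nth (f + g) s \<noteq> 0"
  then have "fps_nth f s \<noteq> 0 \<or> fps_nth g s \<noteq> 0" by auto
  then show "s \<in> sgp \<and> i \<le> max_len s" using assms by (auto simp: filt_def)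
qed

lemma filt_uminus: "f \<in> filt i \<Longrightarrow> - f \<in> filt i"
  by (simp add: filt_def)

lemma filt_minus: "f \<in> filt i \<Longrightarrow> g \<in> filt i \<Longrightarrow> f - g \<in> filt i"
  using filt_add[of f i "- g"] filt_uminus[of g i] by simp

lemma filt_sum: "(\<And>x. x \<in> A \<Longrightarrow> f x \<in> filt i) \<Longrightarrow> sum f A \<in> filt i"
  by (induction A rule: infinite_finite_induct) (auto intro: filt_add)

lemma filt_mult:
  assumes f: "f \<in> filt i" and g: "g \<in> filt j" shows "f * g \<in> filt (i + j)"
  unfolding filt_def
proof (intro CollectI allI impI)
  fix s assume "fps_nth (f * g) s \<noteq> 0"
  then have "(\<Sum>k=0..s. fps_nth f k * fps_nth g (s - k)) \<noteq> 0" by (simp add: fps_mult_nth)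
  then obtain k where k: "k \<in> {0..s}" "fps_nth f k * fps_nth g (s - k) \<noteq> 0" by (meson sum.neutral)
  then have "k \<in> sgp" "i \<le> max_len k" "s - k \<in> sgp" "j \<le> max_len (s - k)"
    using f g by (auto simp: filt_def)
  then show "s \<in> sgp \<and> i + j \<le> max_len s"
    using sgp_add[of k "s - k"] max_len_add[of k "s - k"] k(1) by auto
qed

lemma R_cring: "cring (R :: 'k::field fps ring)"
proof (rule cringI)
  show "abelian_group (R :: 'k fps ring)"
  proof (rule abelian_groupI)
    fix x :: "'k fps" assume x: "x \<in> carrier R"
    show "\<exists>y\<in>carrier R. y \<oplus>\<^bsub>R\<^esub> x = \<zero>\<^bsub>R\<^esub>"
      by (rule bexI[of _ "- x"]) (use x filt_uminus[of x 0] in \<open>auto simp: filt_0\<close>)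
  qed (use filt_add[where i = 0] in \<open>auto simp: algebra_simps simp flip: filt_0\<close>)
  show "comm_monoid (R :: 'k fps ring)"
  proof (rule comm_monoidI)
    show "\<one>\<^bsub>R\<^esub> \<in> carrier (R :: 'k fps ring)" by (auto simp: R_carrier split: if_splits)
  qed (use filt_mult[where i = 0 and j = 0] in \<open>auto simp: algebra_simps simp flip: filt_0\<close>)
qed (auto simp: algebra_simps)

lemma R_a_inv: "f \<in> carrier R \<Longrightarrow> \<ominus>\<^bsub>R\<^esub> f = - (f :: 'k::field fps)"
proof -
  interpret cring "R :: 'k fps ring" by (rule R_cring)
  assume "f \<in> carrier R"
  then show ?thesis using filt_uminus[of f 0] by (intro minus_equality) (auto simp: filt_0)
qed

lemma filt_ideal: "ideal (filt i) (R :: 'k::field fps ring)"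
proof (rule idealI)
  interpret cring "R :: 'k fps ring" by (rule R_cring)
  show "ring (R :: 'k fps ring)" by (rule ring_axioms)
  show "subgroup (filt i) (add_monoid (R :: 'k fps ring))"
  proof (rule add.subgroupI)
    show "filt i \<subseteq> carrier R" by (rule filt_carrier)
    show "(filt i :: 'k fps set) \<noteq> {}" using filt_zero by blast
    fix a :: "'k fps" assume a: "a \<in> filt i"
    then have "a \<in> carrier R" using filt_carrier by blast
    then show "\<ominus>\<^bsub>R\<^esub> a \<in> filt i" using filt_uminus[OF a] by (simp add: R_a_inv)
  qed (use filt_add in auto)
  fix a x :: "'k fps" assume "a \<in> filt i" "x \<in> carrier R"
  then have "x * a \<in> filt (0 + i)" by (intro filt_mult) (auto simp: filt_0)
  then show "x \<otimes>\<^bsub>R\<^esub> a \<in> filt i" "a \<otimes>\<^bsub>R\<^esub> x \<in> filt i" by (simp_all add: mult.commute)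
qed

lemma X_in_filt: assumes "a \<in> exps" shows "fps_X ^ val a \<in> filt (deg a)"
  using val_sgp[OF assms] max_len_ge[OF assms] by (auto simp: filt_def fps_X_power_nth split: if_splits)

lemma X_gen_in_filt: "i < m \<Longrightarrow> fps_X ^ n i \<in> filt 1"
  using X_in_filt[of "single i 1"] by simp

lemma split_generator:
  assumes "s \<in> sgp" "Suc j \<le> max_len s"
  shows "\<exists>i<m. n i \<le> s \<and> s - n i \<in> sgp \<and> j \<le> max_len (s - n i)"
proof -
  obtain a where a: "a \<in> exps" "val a = s" "deg a = max_len s" using max_len_attained[OF assms(1)] .
  have "a \<noteq> 0" using a assms(2) by auto
  then obtain i where i: "i \<in> keys a" by (metis ex_in_conv keys_eq_empty)
  then have im: "i < m" using a by (auto simp: exps_def)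
  let ?b = "a - single i 1"
  have "1 \<le> lookup a i" using i by (simp add: in_keys_iff)
  then have ab: "a = single i 1 + ?b" by (rule expo_add_single_diff)
  have b: "?b \<in> exps" using a exps_minus by blast
  have "val a = n i + val ?b" "deg a = 1 + deg ?b" by (subst ab, simp add: weight_add deg_add)+
  then have "s - n i = val ?b" "n i \<le> s" "j \<le> deg ?b" using a assms(2) by auto
  then show ?thesis using im val_sgp[OF b] max_len_ge[OF b] by (intro exI[of _ i]) auto
qed

text \<open>A power series may have infinitely many terms. Its terms are distributed over the finitely many
  generators, one generator for each exponent \<open>s\<close>, so that finitely many products suffice.\<close>

lemma filt_Suc_decomp:
  fixes f :: "'k::field fps"
  assumes f: "f \<in> filt (Suc j)"
  obtains g where "\<And>i. i < m \<Longrightarrow> g i \<in> filt j" "f = (\<Sum>i<m. g i * fps_X ^ n i)"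
proof -
  have "\<exists>i<m. n i \<le> s \<and> s - n i \<in> sgp \<and> j \<le> max_len (s - n i)" if "fps_nth f s \<noteq> 0" for s
    using split_generator[of s j] f that by (auto simp: filt_def)
  then obtain ix where ix: "\<And>s. fps_nth f s \<noteq> 0 \<Longrightarrow>
      ix s < m \<and> n (ix s) \<le> s \<and> s - n (ix s) \<in> sgp \<and> j \<le> max_len (s - n (ix s))" by metis
  define g where "g i = Abs_fps (\<lambda>t. if ix (t + n i) = i then fps_nth f (t + n i) else 0)" for i
  have g: "g i \<in> filt j" for i
    unfolding filt_def g_def
  proof (intro CollectI allI impI)
    fix t assume "fps_nth (Abs_fps (\<lambda>t. if ix (t + n i) = i then fps_nth f (t + n i) else 0)) t \<noteq> 0"
    then have "ix (t + n i) = i" "fps_nth f (t + n i) \<noteq> 0" by (auto split: if_splits)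
    then show "t \<in> sgp \<and> j \<le> max_len t" using ix[of "t + n i"] by simp
  qed
  have eq: "f = (\<Sum>i<m. g i * fps_X ^ n i)"
  proof (rule fps_ext)
    fix s
    have "fps_nth (g i * fps_X ^ n i) s = (if i = ix s then if n i \<le> s then fps_nth f s else 0 else 0)" for i
      by (auto simp: fps_X_power_mult_right_nth g_def)
    then have "fps_nth (\<Sum>i<m. g i * fps_X ^ n i) s = (\<Sum>i<m. if i = ix s then if n i \<le> s then fps_nth f s else 0 else 0)"
      by (simp add: fps_sum_nth)
    also have "\<dots> = (if ix s < m then if n (ix s) \<le> s then fps_nth f s else 0 else 0)" by simp
    also have "\<dots> = fps_nth f s" using ix[of s] by auto
    finally show "fps_nth f s = fps_nth (\<Sum>i<m. g i * fps_X ^ n i) s" by simp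
  qed
  show ?thesis by (rule that[OF g eq])
qed

lemma mm_eq: "(mm :: 'k::field fps set) = filt 1"
proof
  interpret cring "R :: 'k fps ring" by (rule R_cring)
  let ?X = "{fps_X ^ g | g. g \<in> n ` {..<m}} :: 'k fps set"
  have X: "?X \<subseteq> filt 1" using X_gen_in_filt by auto
  then have Xc: "?X \<subseteq> carrier R" using filt_carrier by blast
  show "(mm :: 'k fps set) \<subseteq> filt 1" unfolding mm_def by (rule genideal_minimal[OF filt_ideal X])
  interpret mm: ideal "mm :: 'k fps set" R unfolding mm_def by (rule genideal_ideal[OF Xc])
  show "filt 1 \<subseteq> (mm :: 'k fps set)"
  proof
    fix f :: "'k fps" assume "f \<in> filt 1"
    then obtain g where g: "\<And>i. i < m \<Longrightarrow> g i \<in> filt 0" "f = (\<Sum>i<m. g i * fps_X ^ n i)"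
      using filt_Suc_decomp[of f 0] by auto
    have t: "g i * fps_X ^ n i \<in> mm" if "i < m" for i
    proof -
      have "fps_X ^ n i \<in> (mm :: 'k fps set)" unfolding mm_def
        by (rule subsetD[OF genideal_self[OF Xc]]) (use that in blast)
      then show ?thesis using mm.I_l_closed[of "fps_X ^ n i" "g i"] g(1)[OF that] by (simp add: filt_0)
    qed
    have "(\<Sum>i\<in>S. g i * fps_X ^ n i) \<in> mm" if "finite S" "S \<subseteq> {..<m}" for S
      using that
    proof (induction S rule: finite_induct)
      case empty show ?case using additive_subgroup.zero_closed[OF mm.is_additive_subgroup] by simp
    next
      case (insert x F)
      then show ?case using additive_subgroup.a_closed[OF mm.is_additive_subgroup t[of x]] by simp
    qed
    then show "f \<in> mm" using g(2) by simp
  qed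
qed

lemma ideal_pow_mm: "ideal_pow R (mm :: 'k::field fps set) i = filt i"
proof (induction i)
  case 0 show ?case by (simp add: nat_pow_def ideals_set_def filt_0)
next
  case (Suc j)
  have "ideal_pow R (mm :: 'k fps set) (Suc j) = ideal_prod R (ideal_pow R mm j) mm"
    by (simp add: nat_pow_def ideals_set_def)
  also have "\<dots> = ideal_prod R (filt j) mm" by (simp only: Suc)
  also have "\<dots> = ideal_prod R (filt j) (filt 1)" by (simp only: mm_eq)
  also have "\<dots> = filt (Suc j)"
  proof
    show "ideal_prod R (filt j) (filt 1) \<subseteq> (filt (Suc j) :: 'k fps set)"
    proof
      fix f :: "'k fps" assume "f \<in> ideal_prod R (filt j) (filt 1)"
      then show "f \<in> filt (Suc j)"
      proof (induction rule: ideal_prod.induct)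
        case (prod a b) then show ?case using filt_mult[of a j b 1] by simp
      next
        case (sum a b) then show ?case using filt_add by simp
      qed
    qed
    show "(filt (Suc j) :: 'k fps set) \<subseteq> ideal_prod R (filt j) (filt 1)"
    proof
      fix f :: "'k fps" assume "f \<in> filt (Suc j)"
      then obtain g where g: "\<And>i. i < m \<Longrightarrow> g i \<in> filt j" "f = (\<Sum>i<m. g i * fps_X ^ n i)"
        using filt_Suc_decomp by blast
      have "(\<Sum>i\<in>S. g i * fps_X ^ n i) \<in> ideal_prod R (filt j) (filt 1)" if "finite S" "S \<subseteq> {..<m}" for S
        using that
      proof (induction S rule: finite_induct)
        case empty
        show ?case using ideal_prod.prod[of "0 :: 'k fps" "filt j" 0 "filt 1" R] by simp
      next
        case (insert x F)
        have "g x * fps_X ^ n x \<in> ideal_prod R (filt j) (filt 1)"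
          using ideal_prod.prod[of "g x" "filt j" "fps_X ^ n x" "filt 1" R] g(1)[of x] X_gen_in_filt[of x] insert.prems by simp
        then show ?case using ideal_prod.sum[of _ R "filt j" "filt 1"] insert by simp
      qed
      then show "f \<in> ideal_prod R (filt j) (filt 1)" using g(2) by simp
    qed
  qed
  finally show ?case .
qed

end

section \<open>The associated graded ring as a quotient of the polynomial ring\<close>

context monoid_generators
begin

abbreviation G :: "(nat \<Rightarrow> 'k::field fps set) ring" where "G \<equiv> assoc_graded R mm"

text \<open>The class of \<open>x\<close> modulo \<open>mm\<^sup>i\<^sup>+\<^sup>1\<close>.\<close>

definition cls :: "nat \<Rightarrow> 'k::field fps \<Rightarrow> 'k fps set" where
  "cls i x = filt (Suc i) +>\<^bsub>R\<^esub> x"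

definition form :: "nat \<Rightarrow> 'k::field mp \<Rightarrow> 'k fps" where
  "form i f = (\<Sum>a\<in>keys f. if deg a = i then fps_const (lookup f a) * fps_X ^ val a else 0)"

text \<open>Evaluating \<open>form i\<close>, the part of degree \<open>i\<close>, at the powers of \<open>t\<close> gives the component of degree \<open>i\<close>
  of the image of \<open>f\<close> under the presentation. The ring axioms of the associated graded ring are
  transported along this surjection.\<close>

definition \<Phi> :: "'k::field mp \<Rightarrow> (nat \<Rightarrow> 'k fps set)" where
  "\<Phi> f = (\<lambda>i. cls i (form i f))"

lemma cls_eq: "cls i x = {h + x | h. h \<in> filt (Suc i)}"
  by (auto simp: cls_def a_r_coset_def')

lemma cls_eq_iff: "cls i x = cls i y \<longleftrightarrow> x - y \<in> filt (Suc i)"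
proof
  assume "cls i x = cls i y"
  moreover have "x \<in> cls i x" unfolding cls_eq by (intro CollectI exI[of _ 0]) simp
  ultimately obtain h where "x = h + y" "h \<in> filt (Suc i)" unfolding cls_eq by blast
  then show "x - y \<in> filt (Suc i)" by simp
next
  assume xy: "x - y \<in> filt (Suc i)"
  show "cls i x = cls i y"
  proof (intro equalityI subsetI)
    fix z assume "z \<in> cls i x"
    then obtain h where h: "z = h + x" "h \<in> filt (Suc i)" unfolding cls_eq by blast
    then have "z = (h + (x - y)) + y" by simp
    then show "z \<in> cls i y" unfolding cls_eq using filt_add[OF h(2) xy] by blast
  next
    fix z assume "z \<in> cls i y"
    then obtain h where h: "z = h + y" "h \<in> filt (Suc i)" unfolding cls_eq by blast
    then have "z = (h - (x - y)) + x" by simp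
    then show "z \<in> cls i x" unfolding cls_eq using filt_minus[OF h(2) xy] by blast
  qed
qed

lemma cls_zero: "cls i 0 = filt (Suc i)"
  by (auto simp: cls_eq)

lemma cls_add: "set_add R (cls i x) (cls i y) = cls i (x + y)"
proof (intro equalityI subsetI)
  fix z assume "z \<in> set_add R (cls i x) (cls i y)"
  then obtain h h' where h: "h \<in> filt (Suc i)" "h' \<in> filt (Suc i)" "z = (h + x) + (h' + y)"
    unfolding set_add_def' cls_eq by auto
  then have "z = (h + h') + (x + y)" by simp
  then show "z \<in> cls i (x + y)" unfolding cls_eq using filt_add[OF h(1,2)] by blast
next
  fix z assume "z \<in> cls i (x + y)"
  then obtain h where h: "h \<in> filt (Suc i)" "z = h + (x + y)" unfolding cls_eq by blast
  then have z: "z = (h + x) + (0 + y)" by simp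
  have "h + x \<in> cls i x" "0 + y \<in> cls i y" unfolding cls_eq using h(1) filt_zero by blast+
  then show "z \<in> set_add R (cls i x) (cls i y)" unfolding set_add_def' z by auto
qed

lemma rcoset_mult_cls:
  assumes x: "x \<in> filt i" and y: "y \<in> filt j"
  shows "rcoset_mult R (filt (Suc (i + j))) (cls i x) (cls j y) = cls (i + j) (x * y)"
proof -
  have eq: "filt (Suc (i + j)) +>\<^bsub>R\<^esub> (a * b) = cls (i + j) (x * y)" if a: "a \<in> cls i x" and b: "b \<in> cls j y" for a b
  proof -
    obtain h where h1: "h \<in> filt (Suc i)" "a = h + x" using a unfolding cls_eq by blast
    obtain h' where h2: "h' \<in> filt (Suc j)" "b = h' + y" using b unfolding cls_eq by blast
    note h = h1(1) h2(1) h1(2) h2(2)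
    have "h * h' \<in> filt (Suc (i + j))"
      using filt_mult[OF h(1,2)] filt_antimono[of "Suc (i + j)" "Suc i + Suc j"] by auto
    moreover have "h * y \<in> filt (Suc (i + j))" using filt_mult[OF h(1) y] by simp
    moreover have "x * h' \<in> filt (Suc (i + j))" using filt_mult[OF x h(2)] by simp
    moreover have "a * b - x * y = h * h' + h * y + x * h'" unfolding h by (simp add: algebra_simps)
    ultimately have "a * b - x * y \<in> filt (Suc (i + j))" by (simp add: filt_add)
    then show ?thesis unfolding cls_def[symmetric] cls_eq_iff .
  qed
  have "x \<in> cls i x" "y \<in> cls j y" unfolding cls_eq using filt_zero by force+
  then show ?thesis unfolding rcoset_mult_def using eq by (auto simp: set_eq_iff; metis)
qed

lemma finsum_cls:
  assumes "finite A" "\<And>x. x \<in> A \<Longrightarrow> z x \<in> carrier R"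
  shows "finsum (R Quot filt (Suc i)) (\<lambda>x. cls i (z x)) A = cls i (\<Sum>x\<in>A. z x)"
proof -
  interpret Q: cring "R Quot filt (Suc i)"
    by (rule ideal.quotient_is_cring[OF filt_ideal R_cring])
  have car: "cls i x \<in> carrier (R Quot filt (Suc i))" if "x \<in> carrier R" for x
    using that by (auto simp: FactRing_def A_RCOSETS_def' cls_def)
  show ?thesis
    using assms
  proof (induction A rule: finite_induct)
    case empty
    show ?case by (simp add: cls_zero) (simp add: FactRing_def)
  next
    case (insert x F)
    have "finsum (R Quot filt (Suc i)) (\<lambda>x. cls i (z x)) (insert x F) =
        cls i (z x) \<oplus>\<^bsub>R Quot filt (Suc i)\<^esub> finsum (R Quot filt (Suc i)) (\<lambda>x. cls i (z x)) F"
      by (rule Q.finsum_insert) (use insert car in auto)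
    also have "\<dots> = set_add R (cls i (z x)) (cls i (sum z F))"
      using insert by (simp add: FactRing_def)
    also have "\<dots> = cls i (sum z (insert x F))" using insert by (simp add: cls_add)
    finally show ?case .
  qed
qed

lemma form_zero [simp]: "form i 0 = 0"
  by (simp add: form_def)

lemma form_add: "form i (f + g) = form i f + form i g"
  using extend_add[of "\<lambda>a c. if deg a = i then fps_const c * fps_X ^ val a else 0" f g]
  by (simp add: form_def extend_def distrib_right flip: fps_const_add)

lemma form_sum: "form i (sum f A) = (\<Sum>x\<in>A. form i (f x))"
  by (induction A rule: infinite_finite_induct) (auto simp: form_add)

lemma form_single: "form i (single a c) = (if deg a = i then fps_const c * fps_X ^ val a else 0)"
  by (simp add: form_def)

lemma const_filt: "fps_const c * f \<in> filt i" if "f \<in> filt i"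
  using that by (auto simp: filt_def)

lemma form_in_filt: assumes "f \<in> carrier (mpoly_ring m)" shows "form i f \<in> filt i"
  unfolding form_def
proof (rule filt_sum)
  fix a assume "a \<in> keys f"
  then have "a \<in> exps" using assms by (auto simp: carrier_exps)
  then show "(if deg a = i then fps_const (lookup f a) * fps_X ^ val a else 0) \<in> filt i"
    using X_in_filt[of a] const_filt by auto
qed

lemma form_mult:
  fixes f g :: "'k::field mp"
  shows "form k (f * g) = (\<Sum>i\<le>k. form i f * form (k - i) g)"
proof -
  define t where "t a c = fps_const c * fps_X ^ val a" for a and c :: 'k
  have tm: "t a c * t b e = t (a + b) (c * e)" for a b c e
    by (simp add: t_def weight_add power_add mult_ac flip: fps_const_mult)
  let ?F = "keys f" and ?G = "keys g"
  let ?f = "lookup f" and ?g = "lookup g"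
  have "f * g = (\<Sum>a\<in>?F. \<Sum>b\<in>?G. single (a + b) (?f a * ?g b))"
    by (subst mpoly_mult_eq_sum, subst (1) mpoly_eq_sum[of g]) (simp add: sum_distrib_left mult_single)
  then have "form k (f * g) = (\<Sum>a\<in>?F. \<Sum>b\<in>?G. if deg a + deg b = k then t (a + b) (?f a * ?g b) else 0)"
    by (simp add: form_sum form_single t_def deg_add cong: if_cong)
  also have "\<dots> = (\<Sum>a\<in>?F. \<Sum>b\<in>?G. \<Sum>i\<le>k. (if deg a = i then t a (?f a) else 0) * (if deg b = k - i then t b (?g b) else 0))"
  proof (rule sum.cong[OF refl], rule sum.cong[OF refl])
    fix a b
    have "(\<Sum>i\<le>k. (if deg a = i then t a (?f a) else 0) * (if deg b = k - i then t b (?g b) else 0))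
        = (\<Sum>i\<le>k. if i = deg a then (if deg b = k - deg a then t (a + b) (?f a * ?g b) else 0) else 0)"
      by (rule sum.cong) (auto simp: tm)
    also have "\<dots> = (if deg a + deg b = k then t (a + b) (?f a * ?g b) else 0)" by auto
    finally show "(if deg a + deg b = k then t (a + b) (?f a * ?g b) else 0) =
      (\<Sum>i\<le>k. (if deg a = i then t a (?f a) else 0) * (if deg b = k - i then t b (?g b) else 0))" ..
  qed
  also have "\<dots> = (\<Sum>i\<le>k. \<Sum>a\<in>?F. \<Sum>b\<in>?G. (if deg a = i then t a (?f a) else 0) * (if deg b = k - i then t b (?g b) else 0))"
  proof -
    have "(\<Sum>b\<in>?G. \<Sum>i\<le>k. (if deg a = i then t a (?f a) else 0) * (if deg b = k - i then t b (?g b) else 0)) = (\<Sum>i\<le>k. \<Sum>b\<in>?G. (if deg a = i then t a (?f a) else 0) * (if deg b = k - i then t b (?g b) else 0))" for a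
      by (rule sum.swap)
    then show ?thesis by (simp only: sum.swap[of _ "{..k}" ?F])
  qed
  also have "\<dots> = (\<Sum>i\<le>k. form i f * form (k - i) g)"
    unfolding form_def sum_product t_def ..
  finally show ?thesis .
qed

lemma fps_nth_form: "fps_nth (form i f) s = (\<Sum>a\<in>keys f. if deg a = i \<and> val a = s then lookup f a else 0)"
  unfolding form_def fps_sum_nth by (rule sum.cong) (auto simp: fps_X_power_nth)

lemma coef_eq_form: "coef f s = fps_nth (form (max_len s) f) s"
  unfolding coef_def fps_nth_form by (rule sum.cong) auto

text \<open>Every \<open>s\<close> that occurs in \<open>form i f\<close> has a factorisation of length \<open>i\<close>; if \<open>i\<close> is the greatest length,
  then its coefficient is \<open>coef f s\<close>.\<close>

lemma form_in_filt_Suc_iff: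
  assumes "f \<in> carrier (mpoly_ring m)"
  shows "form i f \<in> filt (Suc i) \<longleftrightarrow> (\<forall>s. max_len s = i \<longrightarrow> coef f s = 0)"
proof
  assume "form i f \<in> filt (Suc i)"
  then show "\<forall>s. max_len s = i \<longrightarrow> coef f s = 0" unfolding coef_eq_form filt_def by fastforce
next
  assume z: "\<forall>s. max_len s = i \<longrightarrow> coef f s = 0"
  have "s \<in> sgp \<and> Suc i \<le> max_len s" if s: "fps_nth (form i f) s \<noteq> 0" for s
  proof -
    have "s \<in> sgp \<and> i \<le> max_len s" using form_in_filt[OF assms, of i] s by (auto simp: filt_def)
    moreover have "max_len s \<noteq> i" using z s by (auto simp: coef_eq_form)
    ultimately show ?thesis by simp
  qed
  then show "form i f \<in> filt (Suc i)" by (simp add: filt_def)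
qed

lemma form_minus: "form i (f - g) = form i f - form i g"
  using form_add[of i "f - g" g] by (simp add: algebra_simps)

lemma \<Phi>_eq_iff:
  assumes "f \<in> carrier (mpoly_ring m)" "g \<in> carrier (mpoly_ring m)"
  shows "\<Phi> f = \<Phi> g \<longleftrightarrow> (\<forall>s. coef f s = coef g s)"
proof -
  have "\<Phi> f = \<Phi> g \<longleftrightarrow> (\<forall>i. form i (f - g) \<in> filt (Suc i))"
    by (simp add: \<Phi>_def fun_eq_iff cls_eq_iff form_minus)
  also have "\<dots> \<longleftrightarrow> (\<forall>s. coef (f - g) s = 0)"
    using form_in_filt_Suc_iff[of "f - g"] assms by auto
  finally show ?thesis by (simp add: coef_minus)
qed

lemma G_simps:
  "carrier G = {g. (\<forall>i. \<exists>x\<in>filt i. g i = cls i x) \<and> finite {i. g i \<noteq> filt (Suc i)}}"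
  "mult G = (\<lambda>g h n. finsum (R Quot filt (Suc n)) (\<lambda>i. rcoset_mult R (filt (Suc n)) (g i) (h (n - i))) {..n})"
  "one G = (\<lambda>i. if i = 0 then cls 0 1 else filt (Suc i))"
  "zero G = (\<lambda>i. filt (Suc i))"
  "add G = (\<lambda>g h i. set_add R (g i) (h i))"
  unfolding assoc_graded_def ideal_pow_mm cls_def
  by (simp_all only: ring.select_convs monoid.select_convs partial_object.select_convs R_simps)

lemma \<Phi>_add: "\<Phi> (f + g) = add G (\<Phi> f) (\<Phi> g)"
  by (simp add: \<Phi>_def G_simps cls_add form_add)

lemma \<Phi>_zero: "\<Phi> 0 = zero G"
  by (simp add: \<Phi>_def G_simps cls_zero)

lemma \<Phi>_one: "\<Phi> (1 :: 'k::field mp) = one G"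
proof -
  have "form i (1 :: 'k mp) = (if i = 0 then 1 else 0)" for i
    using form_single[of i 0 1] by auto
  then show ?thesis unfolding \<Phi>_def G_simps by (intro ext) (simp add: cls_zero)
qed

lemma \<Phi>_mult:
  assumes f: "f \<in> carrier (mpoly_ring m)" and g: "g \<in> carrier (mpoly_ring m)"
  shows "\<Phi> (f * g) = mult G (\<Phi> f) (\<Phi> g)"
proof
  fix k
  interpret Q: cring "R Quot filt (Suc k)" by (rule ideal.quotient_is_cring[OF filt_ideal R_cring])
  have prod: "form i f * form (k - i) g \<in> carrier R" if "i \<le> k" for i
    using filt_mult[OF form_in_filt[OF f, of i] form_in_filt[OF g, of "k - i"]] filt_carrier by blast
  have t: "rcoset_mult R (filt (Suc k)) (cls i (form i f)) (cls (k - i) (form (k - i) g)) = cls k (form i f * form (k - i) g)"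
    if "i \<le> k" for i
    using rcoset_mult_cls[OF form_in_filt[OF f, of i] form_in_filt[OF g, of "k - i"]] that by simp
  have car: "cls k x \<in> carrier (R Quot filt (Suc k))" if "x \<in> carrier R" for x
    using that by (auto simp: FactRing_def A_RCOSETS_def' cls_def)
  have "mult G (\<Phi> f) (\<Phi> g) k = finsum (R Quot filt (Suc k)) (\<lambda>i. cls k (form i f * form (k - i) g)) {..k}"
    unfolding G_simps \<Phi>_def by (rule Q.finsum_cong') (use t prod car in auto)
  also have "\<dots> = cls k (\<Sum>i\<le>k. form i f * form (k - i) g)"
    by (rule finsum_cls) (use prod in auto)
  finally show "\<Phi> (f * g) k = mult G (\<Phi> f) (\<Phi> g) k" by (simp add: \<Phi>_def form_mult)
qed

lemma \<Phi>_carrier: assumes f: "f \<in> carrier (mpoly_ring m)" shows "\<Phi> f \<in> carrier G"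
proof -
  have "{i. \<Phi> f i \<noteq> filt (Suc i)} \<subseteq> deg ` keys f"
  proof
    fix i assume "i \<in> {i. \<Phi> f i \<noteq> filt (Suc i)}"
    then have "form i f \<noteq> 0" by (auto simp: \<Phi>_def cls_zero)
    moreover have "form i f = 0" if "i \<notin> deg ` keys f"
      unfolding form_def by (rule sum.neutral) (use that in auto)
    ultimately show "i \<in> deg ` keys f" by blast
  qed
  then have "finite {i. \<Phi> f i \<noteq> filt (Suc i)}" by (rule finite_subset) simp
  moreover have "\<exists>x\<in>filt i. \<Phi> f i = cls i x" for i using form_in_filt[OF f] by (auto simp: \<Phi>_def)
  ultimately show ?thesis by (simp add: G_simps)
qed

lemma finite_max_len: "finite {s \<in> sgp. max_len s = i}"
proof (rule finite_subset)
  show "{s \<in> sgp. max_len s = i} \<subseteq> val ` {a \<in> exps. deg a = i}"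
  proof clarify
    fix s assume "s \<in> sgp" "i = max_len s"
    then show "s \<in> val ` {a \<in> exps. deg a = max_len s}" by (elim max_len_attained) force
  qed
qed (simp add: finite_exps_deg)

text \<open>A longest factorisation of \<open>s\<close>.\<close>

definition rep :: "nat \<Rightarrow> expo" where
  "rep s = (SOME a. a \<in> exps \<and> val a = s \<and> deg a = max_len s)"

lemma rep: assumes "s \<in> sgp" shows "rep s \<in> exps" "val (rep s) = s" "deg (rep s) = max_len s"
proof -
  have "\<exists>a. a \<in> exps \<and> val a = s \<and> deg a = max_len s" using max_len_attained[OF assms] by metis
  then have "rep s \<in> exps \<and> val (rep s) = s \<and> deg (rep s) = max_len s" unfolding rep_def by (rule someI_ex)
  then show "rep s \<in> exps" "val (rep s) = s" "deg (rep s) = max_len s" by auto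
qed

lemma coef_rep_sum:
  assumes "finite T" "T \<subseteq> sgp"
  shows "coef (\<Sum>s\<in>T. single (rep s) (c s)) s = (if s \<in> T then c s else (0 :: 'k::field))"
proof -
  have "coef (\<Sum>s\<in>T. single (rep s) (c s)) s = (\<Sum>t\<in>T. if t = s then c s else 0)"
    unfolding coef_sum coef_single by (rule sum.cong) (use rep assms in auto)
  then show ?thesis using assms by simp
qed

lemma rep_sum_carrier: "T \<subseteq> sgp \<Longrightarrow> (\<Sum>s\<in>T. single (rep s) (c s)) \<in> carrier (mpoly_ring m)"
  by (rule mpoly_carrier_sum) (use rep in auto)

lemma \<Phi>_surj: assumes g: "g \<in> carrier (G :: (nat \<Rightarrow> 'k::field fps set) ring)" shows "\<exists>f\<in>carrier (mpoly_ring m). \<Phi> f = g"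
proof -
  have "\<forall>i. \<exists>x\<in>filt i. g i = cls i x" and fin: "finite {i. g i \<noteq> filt (Suc i)}" using g by (auto simp: G_simps)
  then obtain x where x: "\<And>i. x i \<in> filt i" "\<And>i. g i = cls i (x i)" by metis
  define T where "T = (\<Union>i\<in>{i. g i \<noteq> filt (Suc i)}. {s \<in> sgp. max_len s = i})"
  have T: "finite T" "T \<subseteq> sgp" using fin finite_max_len by (auto simp: T_def)
  define f where "f = (\<Sum>s\<in>T. single (rep s) (fps_nth (x (max_len s)) s))"
  have f: "f \<in> carrier (mpoly_ring m)" unfolding f_def by (rule rep_sum_carrier[OF T(2)])
  have "\<Phi> f i = g i" for i
  proof -
    have "form i f - x i \<in> filt (Suc i)"
      unfolding filt_def
    proof (intro CollectI allI impI)
      fix s assume nz: "fps_nth (form i f - x i) s \<noteq> 0"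
      then have s: "s \<in> sgp" "i \<le> max_len s"
        using filt_minus[OF form_in_filt[OF f, of i] x(1)] by (auto simp: filt_def)
      have "max_len s \<noteq> i"
      proof
        assume i: "max_len s = i"
        have "fps_nth (form i f) s = (if s \<in> T then fps_nth (x i) s else 0)"
          using coef_rep_sum[OF T, of "\<lambda>s. fps_nth (x (max_len s)) s" s] i unfolding f_def coef_eq_form by simp
        moreover have "fps_nth (x i) s = 0" if "s \<notin> T"
        proof -
          have "cls i (x i) = cls i 0" using that s i x(2)[of i] by (auto simp: T_def cls_zero)
          then have "x i \<in> filt (Suc i)" by (simp add: cls_eq_iff)
          then show ?thesis using i by (auto simp: filt_def)
        qed
        ultimately show False using nz by (auto split: if_splits)
      qed
      then show "s \<in> sgp \<and> Suc i \<le> max_len s" using s by simp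
    qed
    then show ?thesis unfolding \<Phi>_def x(2) cls_eq_iff .
  qed
  then show ?thesis using f by blast
qed

lemma \<Phi>_hom: "\<Phi> \<in> ring_hom (mpoly_ring m) (G :: (nat \<Rightarrow> 'k::field fps set) ring)"
  by (rule ring_hom_memI) (simp_all add: \<Phi>_carrier \<Phi>_mult \<Phi>_add \<Phi>_one)

lemma \<Phi>_image: "\<Phi> ` carrier (mpoly_ring m) = carrier (G :: (nat \<Rightarrow> 'k::field fps set) ring)"
  using \<Phi>_surj \<Phi>_carrier by blast

lemma G_cring: "cring (G :: (nat \<Rightarrow> 'k::field fps set) ring)"
proof -
  interpret P: cring "mpoly_ring m :: 'k mp ring" by (rule mpoly_cring)
  have "ring ((G :: (nat \<Rightarrow> 'k fps set) ring) \<lparr> carrier := \<Phi> ` carrier (mpoly_ring m), zero := \<Phi> \<zero>\<^bsub>mpoly_ring m\<^esub> \<rparr>)"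
    by (rule P.ring_hom_imp_img_ring[OF \<Phi>_hom])
  then have "ring (G :: (nat \<Rightarrow> 'k fps set) ring)" by (simp add: \<Phi>_image \<Phi>_zero)
  then interpret G: ring "G :: (nat \<Rightarrow> 'k fps set) ring" .
  show ?thesis
  proof unfold_locales
    fix x y :: "nat \<Rightarrow> 'k fps set" assume "x \<in> carrier G" "y \<in> carrier G"
    then obtain f g where "f \<in> carrier (mpoly_ring m)" "x = \<Phi> f" "g \<in> carrier (mpoly_ring m)" "y = \<Phi> g"
      using \<Phi>_surj by metis
    then show "mult G x y = mult G y x" by (simp add: \<Phi>_mult[symmetric] mult.commute)
  qed
qed

lemma kernel_\<Phi>: "a_kernel (mpoly_ring m) G \<Phi> = (tangent :: 'k::field mp set)"
  using \<Phi>_eq_iff[of _ 0] by (auto simp: a_kernel_def' tangent_def \<Phi>_zero[symmetric])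

subsection \<open>The presentation\<close>

lemma gr_class_eq: "gr_class R mm i x = (\<lambda>j. if j = i then cls i x else filt (Suc j))"
  unfolding gr_class_def ideal_pow_mm cls_def by simp

lemma \<Phi>_const: "\<Phi> (single 0 c) = gr_class R mm 0 (fps_const c)"
  unfolding \<Phi>_def gr_class_eq form_single by (intro ext) (simp add: cls_zero)

lemma \<Phi>_var: "\<Phi> (mon (single i 1)) = gr_class R mm 1 (fps_X ^ n i)"
  unfolding \<Phi>_def gr_class_eq form_single by (intro ext) (simp add: cls_zero)

lemma \<Phi>_power:
  assumes "f \<in> carrier (mpoly_ring m :: 'k::field mp ring)" shows "\<Phi> (f ^ k) = \<Phi> f [^]\<^bsub>G\<^esub> k"
proof (induction k)
  case 0 then show ?case by (simp add: \<Phi>_one nat_pow_def)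
next
  case (Suc k)
  have fk: "f ^ k \<in> carrier (mpoly_ring m)" by (induction k) (use assms in auto)
  interpret G: cring "G :: (nat \<Rightarrow> 'k fps set) ring" by (rule G_cring)
  show ?case using Suc assms fk by (simp add: \<Phi>_mult mult.commute[of f] )
qed

lemma \<Phi>_eval:
  assumes f: "f \<in> carrier (mpoly_ring m :: 'k::field mp ring)"
  shows "mpoly_eval G (\<lambda>a. gr_class R mm 0 (fps_const a)) (\<lambda>i. gr_class R mm 1 (fps_X ^ n i)) m f = \<Phi> f"
proof -
  interpret G: cring "G :: (nat \<Rightarrow> 'k fps set) ring" by (rule G_cring)
  let ?x = "\<lambda>i. mon (single i 1) :: 'k mp"
  have xc: "?x i \<in> carrier (mpoly_ring m)" if "i < m" for i using that by simp
  have pc: "\<Phi> (?x i) [^]\<^bsub>G\<^esub> k \<in> carrier G" if "i < m" for i and k :: nat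
    by (rule G.nat_pow_closed[OF \<Phi>_carrier[OF xc[OF that]]])
  have prod: "finprod G (\<lambda>i. \<Phi> (?x i) [^]\<^bsub>G\<^esub> lookup a i) S
      = \<Phi> (mon (\<Sum>i\<in>S. single i (lookup a i)))" if "finite S" "S \<subseteq> {..<m}" for S a
    using that
  proof (induction S rule: finite_induct)
    case empty then show ?case by (simp add: \<Phi>_one)
  next
    case (insert i F)
    have im: "i < m" using insert by simp
    have Fe: "(\<Sum>i\<in>F. single i (lookup a i)) \<in> exps"
      using insert(1) insert.prems by (induction F rule: finite_induct) (auto simp: exps_add_iff)
    have "finprod G (\<lambda>i. \<Phi> (?x i) [^]\<^bsub>G\<^esub> lookup a i) (insert i F)
       = mult G (\<Phi> (?x i) [^]\<^bsub>G\<^esub> lookup a i) (finprod G (\<lambda>i. \<Phi> (?x i) [^]\<^bsub>G\<^esub> lookup a i) F)"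
    proof (rule G.finprod_insert[OF insert(1,2)])
      show "(\<lambda>i. \<Phi> (?x i) [^]\<^bsub>G\<^esub> lookup a i) \<in> F \<rightarrow> carrier G"
        by (rule Pi_I, rule pc) (use insert.prems in blast)
    qed (rule pc[OF im])
    also have "\<dots> = mult G (\<Phi> (mon (single i (lookup a i)))) (\<Phi> (mon (\<Sum>i\<in>F. single i (lookup a i))))"
      unfolding insert(3)[OF subset_trans[OF subset_insertI insert.prems]]
        \<Phi>_power[OF xc[OF im], symmetric] mon_power ..
    also have "\<dots> = \<Phi> (mon (\<Sum>i\<in>insert i F. single i (lookup a i)))"
      using insert im Fe by (simp add: \<Phi>_mult[symmetric] mult_single)
    finally show ?case .
  qed
  have single: "mult G (gr_class R mm 0 (fps_const c)) (finprod G (\<lambda>i. gr_class R mm 1 (fps_X ^ n i) [^]\<^bsub>G\<^esub> lookup a i) {..<m})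
      = \<Phi> (single a c)" if a: "a \<in> exps" for a and c :: 'k
  proof -
    have "(\<Sum>i<m. single i (lookup a i)) = a"
      using mpoly_eq_sum_superset[of "{..<m}" a] a by (simp add: exps_def)
    then show ?thesis
      using prod[of "{..<m}" a] a unfolding \<Phi>_var[symmetric] \<Phi>_const[symmetric]
      by (simp add: \<Phi>_mult[symmetric] mult_single)
  qed
  have "finsum G (\<lambda>a. \<Phi> (single a (lookup f a))) S
      = \<Phi> (\<Sum>a\<in>S. single a (lookup f a))" if "finite S" "S \<subseteq> exps" for S
    using that
  proof (induction S rule: finite_induct)
    case empty then show ?case by (simp add: \<Phi>_zero)
  next
    case (insert x F)
    have "finsum G (\<lambda>a. \<Phi> (single a (lookup f a))) (insert x F) =
        add G (\<Phi> (single x (lookup f x))) (finsum G (\<lambda>a. \<Phi> (single a (lookup f a))) F)"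
      by (rule G.finsum_insert) (use insert(1,2) insert.prems in \<open>auto intro!: \<Phi>_carrier\<close>)
    then show ?case using insert by (simp add: \<Phi>_add)
  qed
  from this[of "keys f"] have fs: "finsum G (\<lambda>a. \<Phi> (single a (lookup f a))) (keys f) = \<Phi> f"
    using f mpoly_eq_sum[of f] by (simp add: carrier_exps)
  have "mpoly_eval G (\<lambda>a. gr_class R mm 0 (fps_const a)) (\<lambda>i. gr_class R mm 1 (fps_X ^ n i)) m f
      = finsum G (\<lambda>a. \<Phi> (single a (lookup f a))) (keys f)"
    unfolding mpoly_eval_def
    by (rule G.finsum_cong') (use single f in \<open>auto simp: carrier_exps intro!: \<Phi>_carrier\<close>)
  then show ?thesis using fs by simp
qed

theorem kernel_presentation:
  "a_kernel (mpoly_ring m) G (mpoly_eval G (\<lambda>a. gr_class R mm 0 (fps_const a)) (\<lambda>i. gr_class R mm 1 (fps_X ^ n i)) m)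
    = (tangent :: 'k::field mp set)"
  unfolding kernel_\<Phi>[symmetric] a_kernel_def'
  by (intro Collect_cong conj_cong refl) (simp only: \<Phi>_eval)

end

section \<open>Hilbert function and multiplicity\<close>

context monoid_generators
begin

lemma deg_eq_0_iff: "deg a = 0 \<longleftrightarrow> a = 0"
proof
  assume "deg a = 0"
  then have "\<forall>i\<in>keys a. lookup a i = 0" by (simp add: deg_def weight_def)
  then show "a = 0" by (intro poly_mapping_eqI) (auto simp: in_keys_iff)
qed simp

lemma coef_outside:
  assumes "f \<in> carrier (mpoly_ring m)" "s \<notin> sgp" shows "coef f s = 0"
  unfolding coef_def by (rule sum.neutral) (use assms val_sgp in \<open>auto simp: carrier_exps\<close>)

definition rep_poly :: "nat set \<Rightarrow> (nat \<Rightarrow> 'k::field) \<Rightarrow> 'k mp" where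
  "rep_poly T c = (\<Sum>s\<in>T. single (rep s) (c s))"

definition level :: "nat \<Rightarrow> nat set" where
  "level i = {s \<in> sgp. max_len s = i}"

lemma graded_component_eq:
  "graded_component (G :: (nat \<Rightarrow> 'k::field fps set) ring) i = {\<Phi> (rep_poly (level i) c) | c. True}"
proof (intro equalityI subsetI)
  fix g :: "nat \<Rightarrow> 'k fps set" assume g: "g \<in> graded_component G i"
  then have "g \<in> carrier G" by (simp add: graded_component_def)
  then obtain f where f: "f \<in> carrier (mpoly_ring m)" "g = \<Phi> f" using \<Phi>_surj by metis
  have "coef f s = (if s \<in> level i then coef f s else 0)" for s
  proof (cases "s \<in> sgp \<and> max_len s \<noteq> i")
    case True
    then have "\<Phi> f (max_len s) = filt (Suc (max_len s))" using g f by (auto simp: graded_component_def G_simps)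
    then have "form (max_len s) f \<in> filt (Suc (max_len s))"
      unfolding \<Phi>_def by (metis cls_eq_iff cls_zero diff_zero)
    then have "coef f s = 0" using form_in_filt_Suc_iff[OF f(1)] by blast
    then show ?thesis by simp
  next
    case False
    then show ?thesis using coef_outside[OF f(1)] by (auto simp: level_def)
  qed
  moreover have "coef (rep_poly (level i) (coef f)) s = (if s \<in> level i then coef f s else 0)" for s
    unfolding rep_poly_def level_def by (rule coef_rep_sum) (use finite_max_len in auto)
  moreover have "rep_poly (level i) (coef f) \<in> carrier (mpoly_ring m)"
    unfolding rep_poly_def level_def by (rule rep_sum_carrier) auto
  ultimately have "g = \<Phi> (rep_poly (level i) (coef f))" using \<Phi>_eq_iff[OF f(1)] f(2) by metis
  then show "g \<in> {\<Phi> (rep_poly (level i) c) | c. True}" by blast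
next
  fix g :: "nat \<Rightarrow> 'k fps set" assume "g \<in> {\<Phi> (rep_poly (level i) c) | c. True}"
  then obtain c where g: "g = \<Phi> (rep_poly (level i) c)" by blast
  have "rep_poly (level i) c \<in> carrier (mpoly_ring m)"
    unfolding rep_poly_def level_def by (rule rep_sum_carrier) auto
  then have "g \<in> carrier G" unfolding g by (rule \<Phi>_carrier)
  moreover have "g j = zero G j" if "j \<noteq> i" for j
  proof -
    have "form j (rep_poly (level i) c) = 0"
      unfolding rep_poly_def form_sum form_single
      by (rule sum.neutral) (use that rep in \<open>auto simp: level_def\<close>)
    then show ?thesis by (simp add: g \<Phi>_def cls_zero G_simps)
  qed
  ultimately show "g \<in> graded_component G i" by (simp add: graded_component_def)
qed

abbreviation \<iota>0 :: "'k::field \<Rightarrow> (nat \<Rightarrow> 'k fps set)" where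
  "\<iota>0 c \<equiv> \<Phi> (single 0 c)"

lemma level_0: "level 0 = {0}" and rep_0: "rep 0 = 0"
proof -
  have "s = 0" if "s \<in> sgp" "max_len s = 0" for s
    using rep[OF that(1)] that(2) deg_eq_0_iff[of "rep s"] by auto
  moreover have "max_len 0 = 0" using max_len_mult_le[of 0] n0_pos by simp
  ultimately show "level 0 = {0}" by (auto simp: level_def)
  show "rep 0 = 0" using rep[of 0] \<open>max_len 0 = 0\<close> deg_eq_0_iff[of "rep 0"] by simp
qed

lemma graded_component_0: "graded_component (G :: (nat \<Rightarrow> 'k::field fps set) ring) 0 = range \<iota>0"
  unfolding graded_component_eq level_0 rep_poly_def by (auto simp: rep_0 intro: exI[of _ "\<lambda>_. _"])

lemma \<iota>0_zero_iff: "\<iota>0 c = zero G \<longleftrightarrow> (c :: 'k::field) = 0"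
proof -
  have "\<iota>0 c = zero G \<longleftrightarrow> (\<forall>s. coef (single 0 c) s = 0)"
    using \<Phi>_eq_iff[of "single 0 c" 0] by (simp add: \<Phi>_zero)
  moreover have "coef (single 0 c) 0 = c"
    using max_len_mult_le[of 0] n0_pos by (simp add: coef_single)
  ultimately show ?thesis by (metis single_zero coef_zero)
qed

lemma subfield_range_\<iota>0: "subfield (range \<iota>0) (G :: (nat \<Rightarrow> 'k::field fps set) ring)"
proof -
  interpret G: cring "G :: (nat \<Rightarrow> 'k fps set) ring" by (rule G_cring)
  have car: "\<iota>0 c \<in> carrier G" for c :: 'k by (rule \<Phi>_carrier) simp
  have add: "\<iota>0 c \<oplus>\<^bsub>G\<^esub> \<iota>0 e = \<iota>0 (c + e)" for c e :: 'k by (simp add: \<Phi>_add[symmetric] single_add)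
  have mult: "\<iota>0 c \<otimes>\<^bsub>G\<^esub> \<iota>0 e = \<iota>0 (c * e)" for c e :: 'k by (simp add: \<Phi>_mult[symmetric] mult_single)
  have one: "\<one>\<^bsub>G\<^esub> = \<iota>0 (1 :: 'k)" by (simp add: \<Phi>_one)
  have zero: "\<zero>\<^bsub>G\<^esub> = \<iota>0 (0 :: 'k)" by (simp add: \<Phi>_zero)
  show ?thesis
  proof (rule G.subfieldI)
    show "subcring (range \<iota>0) (G :: (nat \<Rightarrow> 'k fps set) ring)"
    proof (rule G.subcringI', rule G.subringI)
      show "range \<iota>0 \<subseteq> carrier (G :: (nat \<Rightarrow> 'k fps set) ring)" using car by blast
      show "\<one>\<^bsub>G\<^esub> \<in> range (\<iota>0 :: 'k \<Rightarrow> _)" unfolding one by blast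
      fix h :: "nat \<Rightarrow> 'k fps set" assume "h \<in> range \<iota>0"
      then obtain c where c: "h = \<iota>0 c" by blast
      have "\<ominus>\<^bsub>G\<^esub> h = \<iota>0 (- c)" unfolding c
        by (rule G.minus_equality) (simp_all add: add car zero)
      then show "\<ominus>\<^bsub>G\<^esub> h \<in> range \<iota>0" by blast
    next
      fix h1 h2 :: "nat \<Rightarrow> 'k fps set" assume "h1 \<in> range \<iota>0" "h2 \<in> range \<iota>0"
      then obtain c e where ce: "h1 = \<iota>0 c" "h2 = \<iota>0 e" by blast
      show "h1 \<otimes>\<^bsub>G\<^esub> h2 \<in> range \<iota>0" "h1 \<oplus>\<^bsub>G\<^esub> h2 \<in> range \<iota>0" unfolding ce add mult by blast+
    qed
    show "Units (G \<lparr> carrier := range \<iota>0 \<rparr>) = range \<iota>0 - {\<zero>\<^bsub>G :: (nat \<Rightarrow> 'k fps set) ring\<^esub>}"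
    proof (intro equalityI subsetI)
      fix x :: "nat \<Rightarrow> 'k fps set" assume "x \<in> Units (G \<lparr> carrier := range \<iota>0 \<rparr>)"
      then obtain y where xy: "x \<in> range \<iota>0" "y \<in> range \<iota>0" "x \<otimes>\<^bsub>G\<^esub> y = \<one>\<^bsub>G\<^esub>"
        by (auto simp: Units_def)
      have "x \<noteq> \<zero>\<^bsub>G\<^esub>"
      proof
        assume "x = \<zero>\<^bsub>G\<^esub>"
        moreover have "y \<in> carrier G" using xy(2) car by blast
        ultimately have "\<one>\<^bsub>G\<^esub> = (\<zero>\<^bsub>G :: (nat \<Rightarrow> 'k fps set) ring\<^esub>)" using xy(3) by simp
        then have "(1 :: 'k) = 0" using \<iota>0_zero_iff[of "1 :: 'k"] unfolding one by blast
        then show False by simp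
      qed
      then show "x \<in> range \<iota>0 - {\<zero>\<^bsub>G\<^esub>}" using xy by blast
    next
      fix x :: "nat \<Rightarrow> 'k fps set" assume "x \<in> range \<iota>0 - {\<zero>\<^bsub>G\<^esub>}"
      then obtain c where x: "x = \<iota>0 c" "x \<noteq> \<zero>\<^bsub>G\<^esub>" by blast
      then have c: "x = \<iota>0 c" "c \<noteq> 0" using \<iota>0_zero_iff[of c] by metis+
      have "x \<otimes>\<^bsub>G\<^esub> \<iota>0 (inverse c) = \<one>\<^bsub>G\<^esub>" "\<iota>0 (inverse c) \<otimes>\<^bsub>G\<^esub> x = \<one>\<^bsub>G\<^esub>"
        unfolding c(1) mult one using c(2) by simp_all
      then show "x \<in> Units (G \<lparr> carrier := range \<iota>0 \<rparr>)" using c by (auto simp: Units_def)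
    qed
  qed
qed

lemma dimension_rep_poly:
  assumes "finite T" "T \<subseteq> sgp"
  shows "ring.dimension (G :: (nat \<Rightarrow> 'k::field fps set) ring) (card T) (range \<iota>0) {\<Phi> (rep_poly T c) | c. True}"
  using assms
proof (induction T rule: finite_induct)
  case empty
  interpret G: cring "G :: (nat \<Rightarrow> 'k fps set) ring" by (rule G_cring)
  show ?case by (simp add: rep_poly_def \<Phi>_zero G.zero_dim)
next
  case (insert s T)
  interpret G: cring "G :: (nat \<Rightarrow> 'k fps set) ring" by (rule G_cring)
  let ?E = "{\<Phi> (rep_poly T c) | c. True} :: (nat \<Rightarrow> 'k fps set) set"
  let ?v = "\<Phi> (mon (rep s)) :: nat \<Rightarrow> 'k fps set"
  have s: "s \<in> sgp" "T \<subseteq> sgp" using insert by auto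
  have car: "rep_poly T c \<in> carrier (mpoly_ring m)" for c :: "nat \<Rightarrow> 'k"
    unfolding rep_poly_def by (rule rep_sum_carrier[OF s(2)])
  have mc: "(mon (rep s) :: 'k mp) \<in> carrier (mpoly_ring m)" using rep(1)[OF s(1)] by simp
  have "?v \<notin> ?E"
  proof
    assume "?v \<in> ?E"
    then obtain c where "?v = \<Phi> (rep_poly T c)" by blast
    then have "coef (mon (rep s) :: 'k mp) s = coef (rep_poly T c) s" using \<Phi>_eq_iff[OF mc car] by blast
    also have "\<dots> = 0" using coef_rep_sum[OF insert(1) s(2), of c s] insert(2) by (simp add: rep_poly_def)
    finally show False using rep[OF s(1)] by (simp add: coef_single)
  qed
  then have dim: "G.dimension (Suc (card T)) (range \<iota>0) (G.line_extension (range \<iota>0) ?v ?E)"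
    by (intro G.Suc_dim insert.IH s \<Phi>_carrier mc)
  have eq: "\<Phi> (rep_poly (insert s T) c) = \<iota>0 (c s) \<otimes>\<^bsub>G\<^esub> ?v \<oplus>\<^bsub>G\<^esub> \<Phi> (rep_poly T c)" for c :: "nat \<Rightarrow> 'k"
  proof -
    have "rep_poly (insert s T) c = single 0 (c s) * mon (rep s) + rep_poly T c"
      using insert by (simp add: rep_poly_def mult_single)
    then show ?thesis using mc by (simp add: \<Phi>_add \<Phi>_mult)
  qed
  have "G.line_extension (range \<iota>0) ?v ?E = {\<Phi> (rep_poly (insert s T) c) | c. True}"
  proof (intro equalityI subsetI)
    fix x :: "nat \<Rightarrow> 'k fps set" assume "x \<in> G.line_extension (range \<iota>0) ?v ?E"
    then obtain k c where x: "x = \<iota>0 k \<otimes>\<^bsub>G\<^esub> ?v \<oplus>\<^bsub>G\<^esub> \<Phi> (rep_poly T c)"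
      unfolding G.line_extension_mem_iff by blast
    have "rep_poly T c = rep_poly T (c(s := k))" unfolding rep_poly_def by (rule sum.cong) (use insert in auto)
    then have "x = \<Phi> (rep_poly (insert s T) (c(s := k)))" unfolding eq x by simp
    then show "x \<in> {\<Phi> (rep_poly (insert s T) c) | c. True}" by blast
  next
    fix x :: "nat \<Rightarrow> 'k fps set" assume "x \<in> {\<Phi> (rep_poly (insert s T) c) | c. True}"
    then obtain c where "x = \<Phi> (rep_poly (insert s T) c)" by blast
    then have "x = \<iota>0 (c s) \<otimes>\<^bsub>G\<^esub> ?v \<oplus>\<^bsub>G\<^esub> \<Phi> (rep_poly T c)" using eq by simp
    moreover have "\<iota>0 (c s) \<in> range \<iota>0" "\<Phi> (rep_poly T c) \<in> ?E" by blast+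
    ultimately show "x \<in> G.line_extension (range \<iota>0) ?v ?E"
      unfolding G.line_extension_mem_iff by blast
  qed
  then show ?case using dim insert by simp
qed

lemma hilbert_function_eq: "hilbert_function (G :: (nat \<Rightarrow> 'k::field fps set) ring) i = card (level i)"
proof -
  interpret G: cring "G :: (nat \<Rightarrow> 'k fps set) ring" by (rule G_cring)
  have d: "G.dimension (card (level i)) (range \<iota>0) (graded_component G i)"
    unfolding graded_component_eq
    by (rule dimension_rep_poly) (use finite_max_len in \<open>auto simp: level_def\<close>)
  then have "\<exists>!k. G.dimension k (range \<iota>0) (graded_component G i)"
    using G.unique_dimension[OF subfield_range_\<iota>0] G.finite_dimension_def by blast
  then show ?thesis
    unfolding hilbert_function_def graded_component_0 G.dim_def using d by (rule the1_equality)
qed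

text \<open>If \<open>b\<close> is standard, then so is \<open>x\<^sub>0\<^sup>k b\<close>, and its degree is the greatest length of its value. So a large
  degree contains exactly one element of each residue class modulo \<open>n 0\<close>.\<close>

lemma card_level_eventually: "\<exists>i0. \<forall>i\<ge>i0. card (level i) = n 0"
proof -
  have "\<exists>b. b \<in> std \<and> val b mod n 0 = r" if "r < n 0" for r using residue_in_std[OF that] by metis
  then obtain b where b: "\<And>r. r < n 0 \<Longrightarrow> b r \<in> std \<and> val (b r) mod n 0 = r" by metis
  define i0 where "i0 = (\<Sum>r<n 0. val (b r))"
  have le: "val (b r) \<le> i0" if "r < n 0" for r
    unfolding i0_def by (rule member_le_sum) (use that in auto)
  have bexp: "b r \<in> exps" if "r < n 0" for r using b[OF that] by (simp add: std_def)
  have dv: "deg (b r) \<le> val (b r)" if "r < n 0" for r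
  proof -
    have "1 * deg (b r) \<le> n 0 * deg (b r)" using n0_pos by (intro mult_right_mono) auto
    then show ?thesis using val_eq[OF bexp[OF that]] by linarith
  qed
  have len: "max_len (val (b r) + n 0 * k) = deg (b r) + k" "val (b r) + n 0 * k \<in> sgp" if "r < n 0" for r k
  proof -
    let ?a = "b r + single 0 k"
    have a: "?a \<in> exps" using bexp[OF that] m_pos by (simp add: exps_add_iff)
    have "drop0 ?a = drop0 (b r)" by (simp add: drop0_add)
    then have "standard ?a" using b[OF that] by (metis (no_types, lifting) mem_Collect_eq standard_drop0 std_def)
    then have "normal ?a" by (rule standard_imp_normal[OF a])
    moreover have v: "val ?a = val (b r) + n 0 * k" "deg ?a = deg (b r) + k" by (simp_all add: weight_add deg_add)
    ultimately show "max_len (val (b r) + n 0 * k) = deg (b r) + k" by (simp add: normal_def)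
    show "val (b r) + n 0 * k \<in> sgp" using val_sgp[OF a] v by simp
  qed
  have "card (level i) = n 0" if i: "i0 \<le> i" for i
  proof -
    let ?f = "\<lambda>r. val (b r) + n 0 * (i - deg (b r))"
    have "level i = ?f ` {..<n 0}"
    proof (intro equalityI subsetI)
      fix s assume "s \<in> level i"
      then have s: "s \<in> sgp" "max_len s = i" by (auto simp: level_def)
      let ?r = "s mod n 0"
      have r: "?r < n 0" using n0_pos by simp
      have "n 0 * i \<le> s" using max_len_mult_le[OF s(1)] s(2) by simp
      moreover have "i \<le> n 0 * i" using n0_pos by simp
      ultimately have "val (b ?r) \<le> s" using le[OF r] i by linarith
      then have "n 0 dvd s - val (b ?r)" using b[OF r] by (metis mod_eq_dvd_iff_nat)
      then obtain k where k: "s - val (b ?r) = n 0 * k" by (auto elim: dvdE)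
      then have sk: "s = val (b ?r) + n 0 * k" using \<open>val (b ?r) \<le> s\<close> by linarith
      then have "deg (b ?r) + k = i" using len(1)[OF r, of k] s(2) by metis
      then have "k = i - deg (b ?r)" by linarith
      then have "s = ?f ?r" using sk by metis
      then show "s \<in> ?f ` {..<n 0}" using r by blast
    next
      fix s assume "s \<in> ?f ` {..<n 0}"
      then obtain r where r: "r < n 0" "s = ?f r" by blast
      have "deg (b r) \<le> i" using dv[OF r(1)] le[OF r(1)] i by linarith
      then show "s \<in> level i" using len[OF r(1), of "i - deg (b r)"] r by (simp add: level_def)
    qed
    moreover have "inj_on ?f {..<n 0}"
    proof (rule inj_onI)
      fix r r' assume r: "r \<in> {..<n 0}" "r' \<in> {..<n 0}" "?f r = ?f r'"
      have "?f r mod n 0 = r" "?f r' mod n 0 = r'" using b[of r] b[of r'] r(1,2) by simp_all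
      then show "r = r'" using r(3) by metis
    qed
    ultimately show ?thesis by (simp add: card_image)
  qed
  then show ?thesis by blast
qed

lemma poly_eq_if_eventually_eq:
  fixes p q :: "rat poly"
  assumes "\<forall>\<^sub>F k in sequentially. poly p (of_nat k) = poly q (of_nat k)" shows "p = q"
proof (rule ccontr)
  assume "p \<noteq> q"
  then have fin: "finite {x. poly (p - q) x = 0}" by (intro poly_roots_finite) simp
  obtain N where "\<And>k. N \<le> k \<Longrightarrow> poly p (of_nat k) = poly q (of_nat k)"
    using assms by (auto simp: eventually_sequentially)
  then have "of_nat ` {N..} \<subseteq> {x. poly (p - q) x = 0}" by auto
  then have "finite (of_nat ` {N..} :: rat set)" using fin finite_subset by blast
  moreover have "inj_on (of_nat :: nat \<Rightarrow> rat) {N..}" by (auto intro: inj_onI)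
  ultimately have "finite {N..}" using finite_imageD by blast
  then show False using infinite_Ici by blast
qed

theorem hs_multiplicity_eq: "hs_multiplicity (G :: (nat \<Rightarrow> 'k::field fps set) ring) = of_nat (n 0)"
proof -
  obtain i0 where i0: "\<forall>i\<ge>i0. card (level i) = n 0" using card_level_eventually by blast
  let ?S = "\<lambda>N. \<Sum>i\<le>N. hilbert_function (G :: (nat \<Rightarrow> 'k fps set) ring) i"
  let ?p = "[:of_nat (?S i0) - of_nat (n 0) * of_nat i0, of_nat (n 0):] :: rat poly"
  have S: "?S (i0 + k) = ?S i0 + n 0 * k" for k
    by (induction k) (auto simp: hilbert_function_eq i0)
  have ev: "\<forall>\<^sub>F N in sequentially. poly ?p (of_nat N) = of_nat (?S N)"
  proof (rule eventually_sequentiallyI)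
    fix N assume "i0 \<le> N"
    then obtain k where "N = i0 + k" by (auto simp: le_iff_add)
    then show "poly ?p (of_nat N) = of_nat (?S N)" by (simp only: S) (simp add: algebra_simps)
  qed
  have "hilbert_samuel_poly (G :: (nat \<Rightarrow> 'k fps set) ring) = ?p"
    unfolding hilbert_samuel_poly_def
  proof (rule the_equality)
    show "\<forall>\<^sub>F N in sequentially. poly ?p (of_nat N) = of_nat (?S N)" by (rule ev)
    fix q :: "rat poly" assume "\<forall>\<^sub>F N in sequentially. poly q (of_nat N) = of_nat (?S N)"
    with ev have "\<forall>\<^sub>F N in sequentially. poly q (of_nat N) = poly ?p (of_nat N)"
      by eventually_elim simp
    then show "q = ?p" by (rule poly_eq_if_eventually_eq)
  qed
  then show ?thesis using n0_pos by (simp add: hs_multiplicity_def)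
qed

section \<open>The height of the tangent cone ideal\<close>

text \<open>The prime ideal \<open>(x\<^sub>1, \<dots>, x\<^sub>j)\<close>.\<close>

definition coord_ideal :: "nat \<Rightarrow> 'k::field mp set" where
  "coord_ideal j = {f \<in> carrier (mpoly_ring m). \<forall>a\<in>keys f. \<exists>i\<in>{1..j}. lookup a i \<noteq> 0}"

lemma coord_ideal_ideal: "ideal (coord_ideal j :: 'k::field mp set) (mpoly_ring m)"
proof (rule mpoly_idealI)
  fix f g :: "'k mp" assume "f \<in> coord_ideal j" "g \<in> coord_ideal j"
  then show "f + g \<in> coord_ideal j" using Poly_Mapping.keys_add[of f g] by (auto simp: coord_ideal_def)
next
  fix c f :: "'k mp" assume c: "c \<in> carrier (mpoly_ring m)" and f: "f \<in> coord_ideal j"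
  have "\<exists>i\<in>{1..j}. lookup x i \<noteq> 0" if x: "x \<in> keys (c * f)" for x
  proof -
    obtain a b where ab: "x = a + b" "b \<in> keys f" using Poly_Mapping.keys_mult[of c f] x by blast
    then obtain i where "i \<in> {1..j}" "lookup b i \<noteq> 0" using f by (auto simp: coord_ideal_def)
    then show ?thesis by (intro bexI[of _ i]) (simp_all add: ab lookup_add)
  qed
  then show "c * f \<in> coord_ideal j" using c f by (simp add: coord_ideal_def)
qed (auto simp: coord_ideal_def)

lemma coord_ideal_prime: "primeideal (coord_ideal j :: 'k::field mp set) (mpoly_ring m)"
proof (rule primeidealI)
  show "ideal (coord_ideal j :: 'k mp set) (mpoly_ring m)" by (rule coord_ideal_ideal)
  show "cring (mpoly_ring m :: 'k mp ring)" by (rule mpoly_cring)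
  have "(1 :: 'k mp) \<notin> coord_ideal j" by (simp add: coord_ideal_def)
  then show "carrier (mpoly_ring m) \<noteq> (coord_ideal j :: 'k mp set)" using mpoly_carrier_one by metis
  fix f g :: "'k mp"
  assume fg: "f \<in> carrier (mpoly_ring m)" "g \<in> carrier (mpoly_ring m)"
    "f \<otimes>\<^bsub>mpoly_ring m\<^esub> g \<in> coord_ideal j"
  define avoid where "avoid a \<longleftrightarrow> (\<forall>i\<in>{1..j}. lookup a i = 0)" for a :: expo
  define \<rho> where "\<rho> h = (\<Sum>a\<in>keys h. if avoid a then single a (lookup h a) else 0)"
    for h :: "'k mp"
  have l\<rho>: "lookup (\<rho> h) a = (if avoid a then lookup h a else 0)" for h a
  proof -
    have "lookup (\<rho> h) a =
      (\<Sum>b\<in>keys h. if b = a then (if avoid a then lookup h a else 0) else 0)"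
      unfolding \<rho>_def lookup_sum by (rule sum.cong) (auto simp: lookup_single when_def)
    also have "\<dots> = (if avoid a then lookup h a else 0)" by (auto simp: in_keys_iff)
    finally show ?thesis .
  qed
  have diff: "h - \<rho> h \<in> coord_ideal j" "\<rho> h \<in> carrier (mpoly_ring m)" if "h \<in> carrier (mpoly_ring m)" for h
    using that by (auto simp: coord_ideal_def carrier_exps in_keys_iff lookup_minus l\<rho> avoid_def subset_iff split: if_splits)
  have zero: "h \<in> coord_ideal j" if "h \<in> carrier (mpoly_ring m)" "\<rho> h = 0" for h
    using diff[OF that(1)] that(2) by simp
  \<comment> \<open>\<open>\<rho>\<close> sets \<open>x\<^sub>1, \<dots>, x\<^sub>j\<close> to zero, and the polynomials in the other variables have no zero divisors.\<close>
  show "f \<in> coord_ideal j \<or> g \<in> coord_ideal j"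
  proof (rule ccontr)
    assume "\<not> ?thesis"
    then have nz: "\<rho> f * \<rho> g \<noteq> 0" using zero fg by auto
    note I = mpoly_idealD[OF coord_ideal_ideal]
    have "f * g - (f - \<rho> f) * g - \<rho> f * (g - \<rho> g) \<in> coord_ideal j"
      by (intro I(7) I(5)[OF fg(2) diff(1)] I(4)[OF diff(2) diff(1)]) (use fg in simp_all)
    then have "\<rho> f * \<rho> g \<in> coord_ideal j" by (simp add: algebra_simps)
    moreover obtain a where a: "a \<in> keys (\<rho> f * \<rho> g)" using nz by (metis all_not_in_conv keys_eq_empty)
    ultimately obtain i where i: "i \<in> {1..j}" "lookup a i \<noteq> 0" by (auto simp: coord_ideal_def)
    obtain x y where xy: "a = x + y" "x \<in> keys (\<rho> f)" "y \<in> keys (\<rho> g)"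
      using Poly_Mapping.keys_mult[of "\<rho> f" "\<rho> g"] a by blast
    then have "avoid x" "avoid y" by (auto simp: in_keys_iff l\<rho> split: if_splits)
    then show False using i xy(1) by (simp add: avoid_def lookup_add)
  qed
qed

lemma prime_power_mem:
  assumes Q: "primeideal Q (mpoly_ring m :: 'k::field mp ring)" and i: "i < m"
    and "mon (single i k) \<in> Q"
  shows "mon (single i 1) \<in> Q"
  using assms(3)
proof (induction k)
  case 0
  interpret Q: primeideal Q "mpoly_ring m" by (rule Q)
  have "(1 :: 'k mp) \<in> Q" using 0 by simp
  then have "carrier (mpoly_ring m) = Q" using Q.one_imp_carrier by simp
  then show ?case using i by (metis exps_single single_carrier)
next
  case (Suc k)
  have "mon (single i (Suc k)) = mon (single i 1) * (mon (single i k) :: 'k mp)"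
    by (simp add: mult_single single_add[symmetric])
  then have "mon (single i 1) \<in> Q \<or> mon (single i k) \<in> Q"
    using primeideal.I_prime[OF Q, of "mon (single i 1)" "mon (single i k)"] Suc.prems i by simp
  then show ?case using Suc.IH by blast
qed

lemma coord_ideal_subset_prime:
  assumes Q: "primeideal Q (mpoly_ring m :: 'k::field mp ring)" and sub: "tangent \<subseteq> Q"
  shows "coord_ideal (m - 1) \<subseteq> Q"
proof
  have idQ: "ideal Q (mpoly_ring m)" by (rule primeideal.axioms(1)[OF Q])
  fix f :: "'k mp" assume f: "f \<in> coord_ideal (m - 1)"
  have "(\<Sum>a\<in>keys f. single a (lookup f a)) \<in> Q"
  proof (rule mpoly_ideal_sum[OF idQ])
    fix a assume a: "a \<in> keys f"
    then obtain i where i: "i \<in> {1..m - 1}" "lookup a i \<noteq> 0" using f by (auto simp: coord_ideal_def)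
    have ae: "a \<in> exps" using f a by (auto simp: coord_ideal_def carrier_exps)
    have im: "0 < i" "i < m" using i m_pos by auto
    have "mon (single i (n 0)) \<in> Q" using power_in_tangent[OF im] sub by blast
    then have x: "mon (single i 1) \<in> Q" by (rule prime_power_mem[OF Q im(2)])
    let ?b = "a - single i 1"
    have "a = ?b + single i 1" using expo_add_single_diff[of 1 a i] i(2) by (simp add: add.commute)
    then have "single a (lookup f a) =
        single ?b (lookup f a) * mon (single i 1)"
      by (metis mult_single mult.right_neutral)
    then show "single a (lookup f a) \<in> Q"
      using mpoly_idealD(4)[OF idQ single_carrier x] exps_minus[OF ae] by metis
  qed
  then show "f \<in> Q" using mpoly_eq_sum[of f] by simp
qed

lemma coord_ideal_strict:
  assumes "Suc j < m" shows "(coord_ideal j :: 'k::field mp set) \<subset> coord_ideal (Suc j)"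
proof
  show "(coord_ideal j :: 'k mp set) \<subseteq> coord_ideal (Suc j)" by (fastforce simp: coord_ideal_def)
  have "(mon (single (Suc j) 1) :: 'k mp) \<in> coord_ideal (Suc j)"
    using assms by (auto simp: coord_ideal_def lookup_single when_def)
  moreover have "(mon (single (Suc j) 1) :: 'k mp) \<notin> coord_ideal j"
    by (auto simp: coord_ideal_def lookup_single when_def)
  ultimately show "(coord_ideal j :: 'k mp set) \<noteq> coord_ideal (Suc j)" by blast
qed

text \<open>Every prime ideal over the tangent cone ideal contains the nilpotents \<open>x\<^sub>1, \<dots>, x\<^sub>m\<^sub>-\<^sub>1\<close>, hence sits on top
  of the chain of coordinate primes. This compares the codimension with the number of generators.\<close>

theorem height_tangent_ge: "enat (m - 1) \<le> height (mpoly_ring m) (tangent :: 'k::field mp set)"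
  unfolding height_def
proof (rule Inf_greatest)
  fix h assume "h \<in> {prime_height (mpoly_ring m) p | p. primeideal p (mpoly_ring m) \<and> (tangent :: 'k mp set) \<subseteq> p}"
  then obtain Q :: "'k mp set" where Q: "h = prime_height (mpoly_ring m) Q" "primeideal Q (mpoly_ring m)" "tangent \<subseteq> Q" by blast
  have sub: "coord_ideal (m - 1) \<subseteq> Q" by (rule coord_ideal_subset_prime[OF Q(2,3)])
  have strict: "(coord_ideal i :: 'k mp set) \<subset> coord_ideal (Suc i)" if "i < m - 1" for i
    by (rule coord_ideal_strict) (use that in simp)
  let ?S = "{enat k | k. \<exists>q :: nat \<Rightarrow> 'k mp set. (\<forall>i\<le>k. primeideal (q i) (mpoly_ring m)) \<and> (\<forall>i<k. q i \<subset> q (Suc i)) \<and> q k = Q}"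
  show "enat (m - 1) \<le> h"
  proof (cases "coord_ideal (m - 1) = Q")
    case True
    have "enat (m - 1) \<in> ?S"
      by (rule CollectI, rule exI[of _ "m - 1"], intro conjI refl exI[of _ coord_ideal])
        (use coord_ideal_prime strict True in auto)
    then show ?thesis unfolding Q(1) prime_height_def by (rule Sup_upper)
  next
    case False
    let ?q = "\<lambda>i. if i \<le> m - 1 then coord_ideal i else Q"
    have "enat m \<in> ?S"
    proof (rule CollectI, rule exI[of _ m], intro conjI refl exI[of _ ?q] allI impI)
      fix i assume i: "i < m"
      show "?q i \<subset> ?q (Suc i)"
      proof (cases "i < m - 1")
        case True then show ?thesis using strict[of i] by simp
      next
        case False
        then have "i = m - 1" using i by simp
        then show ?thesis using sub \<open>coord_ideal (m - 1) \<noteq> Q\<close> m_pos by auto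
      qed
    qed (use coord_ideal_prime Q(2) m_pos in auto)
    then have "enat m \<le> h" unfolding Q(1) prime_height_def by (rule Sup_upper)
    then show ?thesis using order.trans[of "enat (m - 1)" "enat m" h] by simp
  qed
qed

end

section \<open>A criterion for the Cohen-Macaulay property\<close>

lemma poly_ideal_principal:
  fixes S :: "'k::field poly set"
  assumes ne: "S \<noteq> {}" and add: "\<And>p q. p \<in> S \<Longrightarrow> q \<in> S \<Longrightarrow> p + q \<in> S"
    and mult: "\<And>c p. p \<in> S \<Longrightarrow> c * p \<in> S"
  shows "\<exists>g\<in>S. \<forall>p\<in>S. g dvd p"
proof (cases "\<exists>p\<in>S. p \<noteq> 0")
  case False
  then show ?thesis using ne by (metis all_not_in_conv dvd_0_right)
next
  case True
  define k where "k = (LEAST k. \<exists>p\<in>S. p \<noteq> 0 \<and> degree p = k)"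
  have "\<exists>k. \<exists>p\<in>S. p \<noteq> 0 \<and> degree p = k" using True by blast
  then have "\<exists>p\<in>S. p \<noteq> 0 \<and> degree p = k" unfolding k_def by (rule LeastI_ex)
  then obtain g where g: "g \<in> S" "g \<noteq> 0" "degree g = k" by blast
  have min: "k \<le> degree p" if "p \<in> S" "p \<noteq> 0" for p
    unfolding k_def by (rule Least_le) (use that in blast)
  have "g dvd p" if p: "p \<in> S" for p
  proof -
    have eq: "p mod g = p + (- (p div g)) * g" by (simp add: minus_div_mult_eq_mod[symmetric])
    have "p mod g \<in> S" unfolding eq by (rule add[OF p mult[OF g(1)]])
    then have "p mod g = 0" using min g degree_mod_less[OF g(2), of p] by fastforce
    then show ?thesis by (simp add: dvd_eq_mod_eq_0)
  qed
  then show ?thesis using g(1) by blast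
qed

lemma poly_split_power:
  fixes p q :: "'k::field poly"
  assumes "q \<noteq> 0" "0 < degree p" obtains e h where "q = p ^ e * h" "\<not> p dvd h"
proof -
  have "\<exists>e h. q = p ^ e * h \<and> \<not> p dvd h" using assms(1)
  proof (induction "degree q" arbitrary: q rule: less_induct)
    case less
    show ?case
    proof (cases "p dvd q")
      case False then show ?thesis by (intro exI[of _ 0] exI[of _ q]) simp
    next
      case True
      then obtain q' where q': "q = p * q'" by (auto elim: dvdE)
      then have "q' \<noteq> 0" "p \<noteq> 0" using less.prems by auto
      then have "degree q' < degree q" using assms(2) by (simp add: q' degree_mult_eq)
      then obtain e h where "q' = p ^ e * h" "\<not> p dvd h" using less.hyps \<open>q' \<noteq> 0\<close> by blast
      then show ?thesis by (intro exI[of _ "Suc e"] exI[of _ h]) (simp add: q' mult_ac)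
    qed
  qed
  then show ?thesis using that by blast
qed

context cring
begin

lemma add_power:
  assumes "x \<in> carrier R" "y \<in> carrier R"
  shows "\<exists>z\<in>carrier R. (x \<oplus> y) [^] (N::nat) = x \<otimes> z \<oplus> y [^] N"
proof (induction N)
  case 0 then show ?case using assms by (intro bexI[of _ \<zero>]) auto
next
  case (Suc N)
  then obtain z where z: "z \<in> carrier R" "(x \<oplus> y) [^] N = x \<otimes> z \<oplus> y [^] N" by blast
  show ?case
  proof (rule bexI)
    have "(x \<otimes> z \<oplus> v) \<otimes> (x \<oplus> y) = x \<otimes> (z \<otimes> (x \<oplus> y) \<oplus> v) \<oplus> v \<otimes> y" if "v \<in> carrier R" for v
      using assms z(1) that by (simp add: l_distr r_distr a_ac m_ac)
    from this[of "y [^] N"] show "(x \<oplus> y) [^] Suc N = x \<otimes> (z \<otimes> (x \<oplus> y) \<oplus> y [^] N) \<oplus> y [^] Suc N"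
      using assms z(2) by simp
  qed (use assms z in simp)
qed

definition nilradical :: "'a set" where
  "nilradical = {x \<in> carrier R. \<exists>N::nat. x [^] N = \<zero>}"

lemma nilradical_carrier: "x \<in> nilradical \<Longrightarrow> x \<in> carrier R"
  by (simp add: nilradical_def)

lemma set_add_memI: "h \<in> H \<Longrightarrow> k \<in> K \<Longrightarrow> h \<oplus> k \<in> H <+> K"
  unfolding set_add_def' by blast

lemma nilradical_add: assumes "x \<in> nilradical" "y \<in> nilradical" shows "x \<oplus> y \<in> nilradical"
proof -
  obtain K N :: nat where x: "x \<in> carrier R" "x [^] K = \<zero>" and y: "y \<in> carrier R" "y [^] N = \<zero>"
    using assms by (auto simp: nilradical_def)
  obtain z where z: "z \<in> carrier R" "(x \<oplus> y) [^] N = x \<otimes> z" using add_power[OF x(1) y(1), of N] x y by auto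
  have "(x \<oplus> y) [^] (N * K) = (x \<otimes> z) [^] K" using x y z by (simp flip: nat_pow_pow)
  also have "\<dots> = \<zero>" using x z by (simp add: nat_pow_distrib)
  finally show ?thesis using x y by (auto simp: nilradical_def)
qed

lemma nilradical_mult: assumes "x \<in> nilradical" "y \<in> carrier R" shows "y \<otimes> x \<in> nilradical"
proof -
  obtain K :: nat where x: "x \<in> carrier R" "x [^] K = \<zero>" using assms by (auto simp: nilradical_def)
  have "(y \<otimes> x) [^] K = \<zero>" using x assms(2) by (simp add: nat_pow_distrib)
  then show ?thesis using x assms(2) by (auto simp: nilradical_def)
qed

lemma nilradical_ideal: "ideal nilradical R"
proof (rule idealI)
  show "ring R" by (rule ring_axioms)
  show "subgroup nilradical (add_monoid R)"
  proof (rule add.subgroupI)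
    show "nilradical \<subseteq> carrier R" by (auto simp: nilradical_def)
    have "\<zero> [^] (1::nat) = \<zero>" by simp
    then show "nilradical \<noteq> {}" unfolding nilradical_def by blast
    fix a assume a: "a \<in> nilradical"
    then have "\<ominus> a = (\<ominus> \<one>) \<otimes> a" by (simp add: nilradical_def l_minus)
    then show "\<ominus> a \<in> nilradical" using nilradical_mult[OF a, of "\<ominus> \<one>"] by simp
  qed (use nilradical_add in auto)
  fix a x assume "a \<in> nilradical" "x \<in> carrier R"
  then show "x \<otimes> a \<in> nilradical" "a \<otimes> x \<in> nilradical" using nilradical_mult[of a x] by (auto simp: nilradical_def m_comm)
qed

end

text \<open>A ring over \<open>k[X]\<close> whose elements are polynomials up to nilpotents, and which embeds into a free
  module of finite rank by the coordinates \<open>\<kappa>\<close>. Its prime ideals correspond to those of \<open>k[X]\<close>, and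
  nonzero polynomials are nonzerodivisors, so all maximal ideals have height and depth one.\<close>

locale nilpotent_over_line = cring A for A :: "('a, 'b) ring_scheme" (structure) +
  fixes \<iota> :: "'k::field poly \<Rightarrow> 'a" and W :: "'w set" and \<kappa> :: "'w \<Rightarrow> 'a \<Rightarrow> 'k poly"
  assumes \<iota>_carrier [simp]: "\<iota> p \<in> carrier A"
    and \<iota>_add: "\<iota> (p + q) = \<iota> p \<oplus> \<iota> q"
    and \<iota>_mult: "\<iota> (p * q) = \<iota> p \<otimes> \<iota> q"
    and \<iota>_one: "\<iota> 1 = \<one>"
    and one_neq_zero: "\<one> \<noteq> \<zero>"
    and finite_W: "finite W"
    and \<kappa>_add: "x \<in> carrier A \<Longrightarrow> y \<in> carrier A \<Longrightarrow> \<kappa> w (x \<oplus> y) = \<kappa> w x + \<kappa> w y"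
    and \<kappa>_scale: "x \<in> carrier A \<Longrightarrow> w \<in> W \<Longrightarrow> \<kappa> w (\<iota> p \<otimes> x) = p * \<kappa> w x"
    and \<kappa>_inj: "x \<in> carrier A \<Longrightarrow> (\<And>w. w \<in> W \<Longrightarrow> \<kappa> w x = 0) \<Longrightarrow> x = \<zero>"
    and decomp: "x \<in> carrier A \<Longrightarrow> \<exists>p y (N::nat). y \<in> carrier A \<and> x = \<iota> p \<oplus> y \<and> y [^] N = \<zero>"
begin

lemma \<iota>_zero: "\<iota> 0 = \<zero>"
  using \<iota>_add[of 0 0] by (metis \<iota>_carrier add.r_cancel_one' add_0)

lemma \<iota>_power: "\<iota> (p ^ k) = \<iota> p [^] k"
  by (induction k) (auto simp: \<iota>_one \<iota>_mult m_comm)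

lemma \<kappa>_zero: "\<kappa> w \<zero> = 0"
  using \<kappa>_add[of \<zero> \<zero> w] by (simp only: zero_closed r_zero add_cancel_right_right)

lemma torsion_free:
  assumes "p \<noteq> 0" "x \<in> carrier A" "\<iota> p \<otimes> x = \<zero>" shows "x = \<zero>"
proof (rule \<kappa>_inj[OF assms(2)])
  fix w assume "w \<in> W"
  then have "p * \<kappa> w x = 0" using \<kappa>_scale[OF assms(2), of w p] assms(3) by (simp add: \<kappa>_zero)
  then show "\<kappa> w x = 0" using assms(1) by simp
qed

lemma \<iota>_eq_zero: "\<iota> p = \<zero> \<Longrightarrow> p = 0"
  using torsion_free[of p \<one>] one_neq_zero by auto

lemma \<iota>_in_nil: "\<iota> p \<in> nilradical \<Longrightarrow> p = 0"
proof -
  assume "\<iota> p \<in> nilradical"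
  then obtain N :: nat where "\<iota> p [^] N = \<zero>" by (auto simp: nilradical_def)
  then have "p ^ N = 0" by (intro \<iota>_eq_zero) (simp add: \<iota>_power)
  then show "p = 0" by simp
qed

lemma nilradical_decomp: assumes "x \<in> carrier A" obtains p y where "y \<in> nilradical" "x = \<iota> p \<oplus> y"
proof -
  obtain p y and N :: nat where "y \<in> carrier A" "x = \<iota> p \<oplus> y" "y [^] N = \<zero>" using decomp[OF assms] by blast
  then show ?thesis using that[of y p] unfolding nilradical_def by blast
qed

lemma one_notin_nil: "\<one> \<notin> nilradical"
  using one_neq_zero by (auto simp: nilradical_def)

lemma nilradical_prime: "primeideal nilradical A"
proof (rule primeidealI)
  show "ideal nilradical A" by (rule nilradical_ideal)
  show "cring A" by (rule cring_axioms)
  show "carrier A \<noteq> nilradical" using one_notin_nil by auto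
  interpret nilradical: ideal nilradical A by (rule nilradical_ideal)
  fix a b assume ab: "a \<in> carrier A" "b \<in> carrier A" "a \<otimes> b \<in> nilradical"
  obtain p y where y: "y \<in> nilradical" "a = \<iota> p \<oplus> y" using nilradical_decomp[OF ab(1)] .
  obtain q z where z: "z \<in> nilradical" "b = \<iota> q \<oplus> z" using nilradical_decomp[OF ab(2)] .
  have yz: "y \<in> carrier A" "z \<in> carrier A" using nilradical_carrier[OF y(1)] nilradical_carrier[OF z(1)] by auto
  have "\<iota> (p * q) = a \<otimes> b \<oplus> \<ominus> (\<iota> p \<otimes> z \<oplus> b \<otimes> y)"
  proof -
    have "a \<otimes> b = \<iota> p \<otimes> \<iota> q \<oplus> (\<iota> p \<otimes> z \<oplus> b \<otimes> y)"
      unfolding y(2) z(2) using yz by (simp add: l_distr r_distr m_comm a_ac)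
    then show ?thesis using yz ab by (simp add: \<iota>_mult a_assoc r_neg)
  qed
  moreover have "\<iota> p \<otimes> z \<oplus> b \<otimes> y \<in> nilradical" using nilradical_add nilradical_mult y z ab by simp
  ultimately have "\<iota> (p * q) \<in> nilradical"
    using additive_subgroup.a_closed[OF nilradical.is_additive_subgroup ab(3)]
      additive_subgroup.a_inv_closed[OF nilradical.is_additive_subgroup] by simp
  then have "p * q = 0" by (rule \<iota>_in_nil)
  then consider "p = 0" | "q = 0" by auto
  then show "a \<in> nilradical \<or> b \<in> nilradical"
  proof cases
    case 1 then have "a = y" using y(2) yz by (simp add: \<iota>_zero)
    then show ?thesis using y(1) by simp
  next
    case 2 then have "b = z" using z(2) yz by (simp add: \<iota>_zero)
    then show ?thesis using z(1) by simp
  qed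
qed

lemma nilradical_subset_prime: assumes "primeideal Q A" shows "nilradical \<subseteq> Q"
proof
  interpret Q: primeideal Q A by fact
  fix x assume x: "x \<in> nilradical"
  then obtain N :: nat where N: "x \<in> carrier A" "x [^] N = \<zero>" by (auto simp: nilradical_def)
  have "x [^] k \<in> Q \<Longrightarrow> x \<in> Q" for k :: nat
  proof (induction k)
    case 0 then show ?case using Q.I_notcarr Q.one_imp_carrier by simp
  next
    case (Suc k) then show ?case using Q.I_prime[of "x [^] k" x] N(1) by auto
  qed
  moreover have "x [^] N \<in> Q" using N additive_subgroup.zero_closed[OF Q.is_additive_subgroup] by simp
  ultimately show "x \<in> Q" by blast
qed

definition contract :: "'a set \<Rightarrow> 'k poly set" where "contract Q = {p. \<iota> p \<in> Q}"

lemma contract_ideal: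
  assumes "ideal Q A"
  shows "0 \<in> contract Q" "\<And>p q. p \<in> contract Q \<Longrightarrow> q \<in> contract Q \<Longrightarrow> p + q \<in> contract Q"
    "\<And>c p. p \<in> contract Q \<Longrightarrow> c * p \<in> contract Q"
proof -
  interpret Q: ideal Q A by fact
  show "0 \<in> contract Q" using additive_subgroup.zero_closed[OF Q.is_additive_subgroup] by (simp add: contract_def \<iota>_zero)
  show "p + q \<in> contract Q" if "p \<in> contract Q" "q \<in> contract Q" for p q
    using additive_subgroup.a_closed[OF Q.is_additive_subgroup] that by (simp add: contract_def \<iota>_add)
  show "c * p \<in> contract Q" if "p \<in> contract Q" for c p
    using Q.I_l_closed that by (simp add: contract_def \<iota>_mult)
qed

lemma contract_generator:
  assumes "ideal Q A" obtains g where "g \<in> contract Q" "\<forall>p\<in>contract Q. g dvd p"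
proof -
  have "contract Q \<noteq> {}" using contract_ideal(1)[OF assms] by blast
  then show ?thesis using that poly_ideal_principal[OF _ contract_ideal(2,3)[OF assms]] by blast
qed

lemma prime_mem_iff:
  assumes "primeideal Q A" "y \<in> nilradical" shows "\<iota> p \<oplus> y \<in> Q \<longleftrightarrow> p \<in> contract Q"
proof -
  interpret Q: primeideal Q A by fact
  have y: "y \<in> Q" "y \<in> carrier A" using nilradical_subset_prime[OF assms(1)] nilradical_carrier[OF assms(2)] assms(2) by blast+
  have "\<iota> p = (\<iota> p \<oplus> y) \<oplus> \<ominus> y" using y by (simp add: a_assoc r_neg)
  then show ?thesis
    using additive_subgroup.a_closed[OF Q.is_additive_subgroup] additive_subgroup.a_inv_closed[OF Q.is_additive_subgroup y(1)] y
    unfolding contract_def mem_Collect_eq by metis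
qed

lemma contract_strict:
  assumes "primeideal Q A" "primeideal Q' A" "Q \<subset> Q'" obtains p where "p \<in> contract Q'" "p \<notin> contract Q"
proof -
  obtain x where x: "x \<in> Q'" "x \<notin> Q" using assms(3) by blast
  interpret Q': primeideal Q' A by fact
  obtain p y where "y \<in> nilradical" "x = \<iota> p \<oplus> y" using nilradical_decomp[OF Q'.Icarr[OF x(1)]] .
  then show ?thesis using that[of p] x prime_mem_iff assms(1,2) by blast
qed

lemma contract_prime:
  assumes "primeideal Q A" "p * q \<in> contract Q" shows "p \<in> contract Q \<or> q \<in> contract Q"
  using primeideal.I_prime[OF assms(1), of "\<iota> p" "\<iota> q"] assms(2) by (simp add: contract_def \<iota>_mult)

lemma one_notin_contract: assumes "primeideal Q A" shows "1 \<notin> contract Q"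
proof -
  interpret Q: primeideal Q A by fact
  show ?thesis using Q.I_notcarr Q.one_imp_carrier by (auto simp: contract_def \<iota>_one)
qed

text \<open>Nonzero prime ideals of \<open>k[X]\<close> are maximal.\<close>

lemma no_prime_chain:
  assumes Q: "primeideal Q0 A" "primeideal Q1 A" "primeideal Q2 A" "Q0 \<subset> Q1" "Q1 \<subset> Q2" shows False
proof -
  have id: "ideal Q0 A" "ideal Q1 A" "ideal Q2 A" using Q by (simp_all add: primeideal.axioms(1))
  obtain p where p: "p \<in> contract Q1" "p \<notin> contract Q0" using contract_strict[OF Q(1,2,4)] .
  then have p0: "p \<noteq> 0" using contract_ideal(1)[OF id(1)] by auto
  obtain r where r: "r \<in> contract Q2" "r \<notin> contract Q1" using contract_strict[OF Q(2,3,5)] .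
  obtain g1 where g1: "g1 \<in> contract Q1" "\<forall>p\<in>contract Q1. g1 dvd p" using contract_generator[OF id(2)] .
  obtain g2 where g2: "g2 \<in> contract Q2" "\<forall>p\<in>contract Q2. g2 dvd p" using contract_generator[OF id(3)] .
  have g10: "g1 \<noteq> 0" using bspec[OF g1(2) p(1)] p0 by auto
  have "g1 \<in> contract Q2" using g1(1) Q(5) by (auto simp: contract_def)
  then obtain h where h: "g1 = h * g2" using g2(2) by (metis dvdE mult.commute)
  have "h \<in> contract Q1 \<or> g2 \<in> contract Q1" using contract_prime[OF Q(2)] g1(1) h by blast
  then show False
  proof
    assume "g2 \<in> contract Q1"
    moreover obtain k where "r = k * g2" using bspec[OF g2(2) r(1)] by (metis dvdE mult.commute)
    ultimately show False using contract_ideal(3)[OF id(2)] r(2) by blast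
  next
    assume "h \<in> contract Q1"
    then obtain k where "h = g1 * k" using g1(2) by (auto elim: dvdE)
    then have "g1 * (k * g2) = g1 * 1" using h by (simp add: mult_ac)
    then have "k * g2 = 1" using g10 mult_left_cancel by blast
    then have "1 \<in> contract Q2" using contract_ideal(3)[OF id(3) g2(1), of k] by simp
    then show False using one_notin_contract[OF Q(3)] by blast
  qed
qed

text \<open>If the nilradical were maximal, the variable \<open>X\<close> would be invertible up to nilpotents, hence
  invertible in \<open>k[X]\<close>.\<close>

lemma nilradical_psubset_maximal: assumes "maximalideal M A" shows "nilradical \<subset> M"
proof -
  interpret M: maximalideal M A by fact
  have prime: "primeideal M A" by (rule maximalideal_prime[OF assms])
  have "nilradical \<noteq> M"
  proof
    assume eq: "nilradical = M"
    define X :: "'k poly" where "X = [:0, 1:]"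
    have idX: "ideal (PIdl (\<iota> X)) A" by (rule cgenideal_ideal) simp
    have id: "ideal (M <+> PIdl (\<iota> X)) A" by (rule add_ideals[OF M.ideal_axioms idX])
    have z: "\<zero> \<in> PIdl (\<iota> X)" "\<zero> \<in> M"
      using additive_subgroup.zero_closed[OF ideal.axioms(1)[OF idX]]
        additive_subgroup.zero_closed[OF M.is_additive_subgroup] by blast+
    have sub: "M \<subseteq> M <+> PIdl (\<iota> X)"
    proof
      fix x assume x: "x \<in> M"
      have "x \<oplus> \<zero> \<in> M <+> PIdl (\<iota> X)" by (rule set_add_memI[OF x z(1)])
      then show "x \<in> M <+> PIdl (\<iota> X)" using M.Icarr[OF x] by simp
    qed
    have iX: "\<iota> X \<in> M <+> PIdl (\<iota> X)"
    proof -
      have "\<zero> \<oplus> \<iota> X \<in> M <+> PIdl (\<iota> X)" by (rule set_add_memI[OF z(2) cgenideal_self]) simp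
      then show ?thesis by simp
    qed
    have "\<iota> X \<notin> M"
    proof
      assume "\<iota> X \<in> M"
      then have "X = 0" using \<iota>_in_nil eq by blast
      then show False by (simp add: X_def)
    qed
    then have "M <+> PIdl (\<iota> X) = carrier A"
      using M.I_maximal[OF id sub] iX ideal.Icarr[OF id] by blast
    then have "\<one> \<in> M <+> PIdl (\<iota> X)" by simp
    then obtain y a where y: "y \<in> M" "a \<in> carrier A" "\<one> = y \<oplus> a \<otimes> \<iota> X"
      unfolding set_add_def' cgenideal_def by blast
    obtain p z where a: "z \<in> nilradical" "a = \<iota> p \<oplus> z" using nilradical_decomp[OF y(2)] .
    have c: "y \<in> carrier A" "z \<in> carrier A" using M.Icarr[OF y(1)] nilradical_carrier[OF a(1)] by auto
    have t: "y \<oplus> \<iota> X \<otimes> z \<in> nilradical" using y(1) eq nilradical_add nilradical_mult[OF a(1), of "\<iota> X"] by simp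
    have "\<iota> 1 = \<iota> (p * X) \<oplus> (y \<oplus> \<iota> X \<otimes> z)"
      unfolding \<iota>_one y(3) a(2) \<iota>_mult using c by (simp add: l_distr m_comm[of z "\<iota> X"] a_lcomm)
    then have "\<iota> (1 + (- (p * X))) = (\<iota> (p * X) \<oplus> \<iota> (- (p * X))) \<oplus> (y \<oplus> \<iota> X \<otimes> z)"
      unfolding \<iota>_add using c by (simp add: a_ac)
    also have "\<dots> = y \<oplus> \<iota> X \<otimes> z" using c by (simp add: \<iota>_zero flip: \<iota>_add)
    finally have "1 + (- (p * X)) = 0" using t \<iota>_in_nil by metis
    then have "1 = p * X" by (simp add: algebra_simps)
    then have "poly 1 0 = poly (p * X) 0" by simp
    then show False by (simp add: X_def)
  qed
  then show ?thesis using nilradical_subset_prime[OF prime] by blast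
qed

lemma height_maximal: assumes "maximalideal M A" shows "height A M = 1"
proof -
  interpret M: maximalideal M A by fact
  have prime: "primeideal M A" by (rule maximalideal_prime[OF assms])
  let ?S = "{enat n | n. \<exists>q :: nat \<Rightarrow> 'a set. (\<forall>i\<le>n. primeideal (q i) A) \<and> (\<forall>i<n. q i \<subset> q (Suc i)) \<and> q n = M}"
  have "Sup ?S = 1"
  proof (rule antisym)
    show "Sup ?S \<le> 1"
    proof (rule Sup_least)
      fix x assume "x \<in> ?S"
      then obtain n q where n: "x = enat n" and q: "\<forall>i\<le>n. primeideal (q i) A" "\<forall>i<n. q i \<subset> q (Suc i)" by blast
      have "n \<le> 1"
      proof (rule ccontr)
        assume "\<not> n \<le> 1"
        then have "Suc (Suc 0) \<le> n" by simp
        then show False using no_prime_chain[of "q 0" "q (Suc 0)" "q (Suc (Suc 0))"] q by simp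
      qed
      then show "x \<le> 1" by (simp add: n one_enat_def)
    qed
    have "enat 1 \<in> ?S"
      by (rule CollectI, intro exI[of _ 1] conjI exI[of _ "\<lambda>i. if i = 0 then nilradical else M"])
        (use nilradical_prime prime nilradical_psubset_maximal[OF assms] in auto)
    then show "1 \<le> Sup ?S" unfolding one_enat_def by (rule Sup_upper)
  qed
  then have ph: "prime_height A M = 1" unfolding prime_height_def .
  have "{prime_height A p | p. primeideal p A \<and> M \<subseteq> p} = {1}"
  proof -
    have "p = M" if "primeideal p A" "M \<subseteq> p" for p
    proof -
      interpret p: primeideal p A by fact
      show ?thesis using M.I_maximal[OF p.ideal_axioms that(2)] p.I_notcarr p.Icarr by blast
    qed
    then have "primeideal p A \<and> M \<subseteq> p \<longleftrightarrow> p = M" for p using prime by auto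
    then show ?thesis by (simp add: ph)
  qed
  then show ?thesis unfolding height_def by simp
qed

lemma genideal_empty: "genideal A {} = {\<zero>}"
  using genideal_minimal[OF zeroideal, of "{}"]
    additive_subgroup.zero_closed[OF ideal.axioms(1)[OF genideal_ideal[of "{}"]]] by auto

text \<open>This bounds the depth by one. A nonzerodivisor \<open>a\<close> has a polynomial part \<open>q \<noteq> 0\<close>, and \<open>a\<close> divides a power
  of \<open>q\<close> because their difference is nilpotent. If \<open>p\<close> generates the contraction of \<open>M\<close>, split that power
  as \<open>p\<^sup>e h\<close> with \<open>p\<close> not dividing \<open>h\<close>. A large power of \<open>b\<close> is a multiple of \<open>p\<^sup>e\<close>, so it kills \<open>h\<close> modulo
  \<open>a\<close>; were \<open>b\<close> regular modulo \<open>a\<close>, then \<open>h\<close> would lie in \<open>M\<close>.\<close>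

lemma regular_pair_outside_maximal:
  assumes M: "maximalideal M A" and ab: "a \<in> M" "b \<in> M"
    and rega: "\<And>y. y \<in> carrier A \<Longrightarrow> a \<otimes> y = \<zero> \<Longrightarrow> y = \<zero>"
    and regb: "\<And>y. y \<in> carrier A \<Longrightarrow> b \<otimes> y \<in> genideal A {a} \<Longrightarrow> y \<in> genideal A {a}"
  shows False
proof -
  interpret M: maximalideal M A by fact
  have prime: "primeideal M A" by (rule maximalideal_prime[OF M])
  have car: "a \<in> carrier A" "b \<in> carrier A" using ab M.Icarr by auto
  interpret a: ideal "genideal A {a}" A by (rule genideal_ideal) (use car in simp)
  have ag: "a \<in> genideal A {a}" using genideal_self[of "{a}"] car by simp
  have aM: "genideal A {a} \<subseteq> M" by (rule genideal_minimal[OF M.ideal_axioms]) (use ab in simp)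
  obtain q \<nu> where q: "\<nu> \<in> nilradical" "a = \<iota> q \<oplus> \<nu>" using nilradical_decomp[OF car(1)] .
  obtain r \<mu> where r: "\<mu> \<in> nilradical" "b = \<iota> r \<oplus> \<mu>" using nilradical_decomp[OF car(2)] .
  have nc: "\<nu> \<in> carrier A" "\<mu> \<in> carrier A" using nilradical_carrier[OF q(1)] nilradical_carrier[OF r(1)] by auto
  have apow: "a [^] k \<noteq> \<zero>" for k :: nat
  proof (induction k)
    case (Suc k) then show ?case using rega[of "a [^] k"] car by (auto simp: m_comm)
  qed (simp add: one_neq_zero)
  have q0: "q \<noteq> 0"
  proof
    assume "q = 0"
    then have "a = \<nu>" using q(2) nc by (simp add: \<iota>_zero)
    then show False using q(1) apow by (auto simp: nilradical_def)
  qed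
  have "\<ominus> \<nu> \<in> nilradical"
    using additive_subgroup.a_inv_closed[OF ideal.axioms(1)[OF nilradical_ideal] q(1)] .
  then obtain N :: nat where N: "(\<ominus> \<nu>) [^] N = \<zero>" by (auto simp: nilradical_def)
  have "\<iota> q = a \<oplus> \<ominus> \<nu>" using q nc by (simp add: a_assoc r_neg)
  then obtain z where z: "z \<in> carrier A" "\<iota> q [^] N = a \<otimes> z"
    using add_power[of a "\<ominus> \<nu>" N] car nc N by auto
  have qN: "\<iota> (q ^ N) \<in> genideal A {a}" using z a.I_r_closed[OF ag z(1)] by (simp add: \<iota>_power)
  obtain p where p: "p \<in> contract M" "\<forall>x\<in>contract M. p dvd x" using contract_generator[OF M.ideal_axioms] .
  have qM: "q \<in> contract M" using prime_mem_iff[OF prime q(1)] q(2) ab by simp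
  have rM: "r \<in> contract M" using prime_mem_iff[OF prime r(1)] r(2) ab by simp
  have "p \<noteq> 0" using bspec[OF p(2) qM] q0 by auto
  moreover have "\<not> p dvd 1"
  proof
    assume "p dvd 1"
    then have "1 \<in> contract M" using contract_ideal(3)[OF M.ideal_axioms p(1)] by (metis dvdE mult.commute)
    then show False using one_notin_contract[OF prime] by blast
  qed
  ultimately have "0 < degree p" using is_unit_iff_degree by blast
  then obtain e h where h: "q ^ N = p ^ e * h" "\<not> p dvd h" using poly_split_power q0 by (metis power_not_zero)
  obtain r' where r': "r = p * r'" using bspec[OF p(2) rM] by (auto elim: dvdE)
  obtain K :: nat where K: "\<mu> [^] K = \<zero>" using r(1) by (auto simp: nilradical_def)
  obtain c where c: "c \<in> carrier A" "b [^] K = (\<iota> p \<otimes> \<iota> r') \<otimes> c"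
    using add_power[of "\<iota> r" \<mu> K] nc K r(2) r' by (auto simp: \<iota>_mult)
  let ?s = "(\<iota> r' \<otimes> c) [^] e"
  have "b [^] (K * e) = (b [^] K) [^] e" using car by (simp add: nat_pow_pow)
  also have "b [^] K = \<iota> p \<otimes> (\<iota> r' \<otimes> c)" using c by (simp add: m_assoc)
  also have "(\<iota> p \<otimes> (\<iota> r' \<otimes> c)) [^] e = \<iota> (p ^ e) \<otimes> ?s" using c by (simp add: nat_pow_distrib \<iota>_power)
  finally have "b [^] (K * e) \<otimes> \<iota> h = \<iota> (q ^ N) \<otimes> ?s"
    using c by (simp add: h(1) \<iota>_mult m_ac)
  then have mem: "b [^] (K * e) \<otimes> \<iota> h \<in> genideal A {a}" using a.I_r_closed[OF qN, of ?s] c by simp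
  have "b [^] k \<otimes> y \<in> genideal A {a} \<Longrightarrow> y \<in> genideal A {a}" if "y \<in> carrier A" for k :: nat and y
    using that
  proof (induction k arbitrary: y)
    case (Suc k)
    have "b [^] k \<otimes> (b \<otimes> y) \<in> genideal A {a}" using Suc.prems car by (simp add: m_assoc)
    then have "b \<otimes> y \<in> genideal A {a}" using Suc.IH Suc.prems car by simp
    then show ?case using regb Suc.prems by blast
  qed simp
  from this[OF \<iota>_carrier mem] have "\<iota> h \<in> M" by (rule subsetD[OF aM])
  then have "h \<in> contract M" by (simp add: contract_def)
  then show False using bspec[OF p(2)] h(2) by metis
qed

lemma depth_maximal: assumes M: "maximalideal M A" shows "depth A M = 1"
proof -
  interpret M: maximalideal M A by fact
  have prime: "primeideal M A" by (rule maximalideal_prime[OF M])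
  let ?S = "{enat (length xs) | xs. regular_sequence A xs \<and> set xs \<subseteq> M}"
  have "Sup ?S = 1"
  proof (rule antisym)
    show "Sup ?S \<le> 1"
    proof (rule Sup_least)
      fix x assume "x \<in> ?S"
      then obtain xs where xs: "x = enat (length xs)" "regular_sequence A xs" "set xs \<subseteq> M" by blast
      have "length xs \<le> 1"
      proof (rule ccontr)
        assume "\<not> length xs \<le> 1"
        then obtain a b ys where ys: "xs = a # b # ys" by (cases xs; cases "tl xs") auto
        have reg: "\<And>i y. i < length xs \<Longrightarrow> y \<in> carrier A \<Longrightarrow> xs ! i \<otimes> y \<in> genideal A (set (take i xs)) \<Longrightarrow>
            y \<in> genideal A (set (take i xs))" using xs(2) unfolding regular_sequence_def by blast
        show False
        proof (rule regular_pair_outside_maximal[OF M, of a b])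
          show "a \<in> M" "b \<in> M" using xs(3) ys by auto
          show "y = \<zero>" if "y \<in> carrier A" "a \<otimes> y = \<zero>" for y
            using reg[of 0 y] that by (simp add: ys genideal_empty)
          show "y \<in> genideal A {a}" if "y \<in> carrier A" "b \<otimes> y \<in> genideal A {a}" for y
            using reg[of 1 y] that by (simp add: ys)
        qed
      qed
      then show "x \<le> 1" by (simp add: xs one_enat_def)
    qed
    obtain p where p: "p \<in> contract M" "p \<notin> contract nilradical"
      using contract_strict[OF nilradical_prime prime nilradical_psubset_maximal[OF M]] .
    have p0: "p \<noteq> 0" using p(2) contract_ideal(1)[OF nilradical_ideal] by auto
    have pM: "\<iota> p \<in> M" using p(1) by (simp add: contract_def)
    have "regular_sequence A [\<iota> p]"
      unfolding regular_sequence_def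
    proof (intro conjI allI impI ballI)
      show "genideal A (set [\<iota> p]) \<noteq> carrier A"
        using genideal_minimal[OF M.ideal_axioms, of "{\<iota> p}"] pM M.I_notcarr M.Icarr by auto
      fix i y assume "i < length [\<iota> p]" "y \<in> carrier A" "[\<iota> p] ! i \<otimes> y \<in> genideal A (set (take i [\<iota> p]))"
      then show "y \<in> genideal A (set (take i [\<iota> p]))" using torsion_free[OF p0] by (simp add: genideal_empty)
    qed simp
    then have "enat (length [\<iota> p]) \<in> ?S" using pM by (intro CollectI exI[of _ "[\<iota> p]"]) simp
    then have "enat 1 \<in> ?S" by simp
    then show "1 \<le> Sup ?S" unfolding one_enat_def by (rule Sup_upper)
  qed
  then show ?thesis unfolding depth_def .
qed

text \<open>Submodules of a free module of finite rank over a principal ideal domain are finitely generated: add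
  the coordinates one at a time, with a generator for the ideal of values of the new one.\<close>

lemma finitely_generated_part:
  assumes I: "ideal I A" and "finite W'" "W' \<subseteq> W"
  shows "\<exists>F\<subseteq>I. finite F \<and> {x \<in> I. \<forall>w\<in>W - W'. \<kappa> w x = 0} \<subseteq> genideal A F"
  using assms(2,3)
proof (induction W' rule: finite_induct)
  case empty
  have "{x \<in> I. \<forall>w\<in>W - {}. \<kappa> w x = 0} \<subseteq> {\<zero>}" using \<kappa>_inj ideal.Icarr[OF I] by blast
  then show ?case by (intro exI[of _ "{}"]) (simp add: genideal_empty)
next
  case (insert v W')
  interpret I: ideal I A by fact
  obtain F where F: "F \<subseteq> I" "finite F" "{x \<in> I. \<forall>w\<in>W - W'. \<kappa> w x = 0} \<subseteq> genideal A F"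
    using insert by blast
  let ?J = "{x \<in> I. \<forall>w\<in>W - insert v W'. \<kappa> w x = 0}"
  have v: "v \<in> W" using insert by blast
  have lin: "\<iota> c \<otimes> x \<in> ?J" "\<kappa> v (\<iota> c \<otimes> x) = c * \<kappa> v x" if "x \<in> ?J" for c x
    using that I.I_l_closed[of x "\<iota> c"] \<kappa>_scale[of x _ c] I.Icarr v by auto
  have add: "x \<oplus> y \<in> ?J" "\<kappa> v (x \<oplus> y) = \<kappa> v x + \<kappa> v y" if "x \<in> ?J" "y \<in> ?J" for x y
    using that additive_subgroup.a_closed[OF I.is_additive_subgroup, of x y] \<kappa>_add[of x y] I.Icarr by auto
  have zJ: "\<zero> \<in> ?J" using additive_subgroup.zero_closed[OF I.is_additive_subgroup] \<kappa>_zero by auto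
  have "\<exists>g\<in>\<kappa> v ` ?J. \<forall>p\<in>\<kappa> v ` ?J. g dvd p"
  proof (rule poly_ideal_principal[of "\<kappa> v ` ?J"])
    show "\<kappa> v ` ?J \<noteq> {}" using zJ by blast
    show "p + q \<in> \<kappa> v ` ?J" if pJ: "p \<in> \<kappa> v ` ?J" and qJ: "q \<in> \<kappa> v ` ?J" for p q
    proof -
      obtain x where "x \<in> ?J" "p = \<kappa> v x" using pJ by (elim imageE)
      moreover obtain y where "y \<in> ?J" "q = \<kappa> v y" using qJ by (elim imageE)
      ultimately have "x \<in> ?J" "y \<in> ?J" "p = \<kappa> v x" "q = \<kappa> v y" by auto
      then show ?thesis using add[of x y] by (intro image_eqI[of _ _ "x \<oplus> y"]) simp_all
    qed
    show "c * p \<in> \<kappa> v ` ?J" if pJ: "p \<in> \<kappa> v ` ?J" for c p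
    proof -
      obtain x where "x \<in> ?J" "p = \<kappa> v x" using pJ by (elim imageE)
      then show ?thesis using lin[of x c] by (intro image_eqI[of _ _ "\<iota> c \<otimes> x"]) simp_all
    qed
  qed
  then obtain g where g: "g \<in> \<kappa> v ` ?J" "\<forall>p\<in>\<kappa> v ` ?J. g dvd p" by (elim bexE)
  obtain x0 where x0: "x0 \<in> ?J" "g = \<kappa> v x0" using g(1) by (elim imageE)
  have FJ: "insert x0 F \<subseteq> carrier A" using F(1) x0(1) I.Icarr by blast
  have idF: "ideal (genideal A (insert x0 F)) A" by (rule genideal_ideal[OF FJ])
  have "?J \<subseteq> genideal A (insert x0 F)"
  proof
    fix x assume x: "x \<in> ?J"
    then have "g dvd \<kappa> v x" using g(2) by blast
    then obtain c where c: "\<kappa> v x = g * c" by (auto elim: dvdE)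
    let ?y = "x \<oplus> \<iota> (- c) \<otimes> x0"
    have y: "?y \<in> ?J" "\<kappa> v ?y = \<kappa> v x + (- c) * \<kappa> v x0"
      using add[OF x lin(1)[OF x0(1), of "- c"]] lin(2)[OF x0(1), of "- c"] by simp_all
    have "\<kappa> v ?y = 0" unfolding y(2) c x0(2) by simp
    then have "?y \<in> {x \<in> I. \<forall>w\<in>W - W'. \<kappa> w x = 0}" using y(1) by blast
    then have "?y \<in> genideal A F" using F(3) by blast
    moreover have "genideal A F \<subseteq> genideal A (insert x0 F)"
      by (rule genideal_minimal[OF idF]) (use genideal_self[OF FJ] in blast)
    ultimately have yF: "?y \<in> genideal A (insert x0 F)" by blast
    have "x0 \<in> genideal A (insert x0 F)" using genideal_self[OF FJ] by blast
    then have "\<iota> c \<otimes> x0 \<in> genideal A (insert x0 F)" using ideal.I_l_closed[OF idF] by simp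
    then have "?y \<oplus> \<iota> c \<otimes> x0 \<in> genideal A (insert x0 F)"
      using additive_subgroup.a_closed[OF ideal.axioms(1)[OF idF] yF] by blast
    moreover have "?y \<oplus> \<iota> c \<otimes> x0 = x"
    proof -
      have c: "x \<in> carrier A" "x0 \<in> carrier A" using x x0 I.Icarr by auto
      have "?y \<oplus> \<iota> c \<otimes> x0 = x \<oplus> (\<iota> (- c) \<oplus> \<iota> c) \<otimes> x0" using c by (simp add: l_distr a_assoc)
      also have "\<iota> (- c) \<oplus> \<iota> c = \<zero>" by (simp add: \<iota>_zero flip: \<iota>_add)
      finally show ?thesis using c by simp
    qed
    ultimately show "x \<in> genideal A (insert x0 F)" by simp
  qed
  then show ?case using F x0(1) by (intro exI[of _ "insert x0 F"]) auto
qed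

lemma noetherian: "noetherian_ring A"
proof (rule noetherian_ringI)
  fix I assume I: "ideal I A"
  obtain F where F: "F \<subseteq> I" "finite F" "{x \<in> I. \<forall>w\<in>W - W. \<kappa> w x = 0} \<subseteq> genideal A F"
    using finitely_generated_part[OF I finite_W order.refl] by blast
  then have "I = genideal A F" using genideal_minimal[OF I F(1)] by auto
  then show "\<exists>F\<subseteq>carrier A. finite F \<and> I = genideal A F" using F ideal.Icarr[OF I] by blast
qed

theorem cohen_macaulay: "cohen_macaulay A"
  unfolding cohen_macaulay_def
  using cring_axioms noetherian depth_maximal height_maximal by simp

end

section \<open>Cohen-Macaulayness of the tangent cone\<close>

context monoid_generators
begin

definition emb :: "'k::field poly \<Rightarrow> 'k mp" where
  "emb p = poly (map_poly (single 0) p) (mon (single 0 1))"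

lemma emb_zero [simp]: "emb 0 = 0"
  by (simp add: emb_def)

lemma emb_pCons: "emb (pCons c p) = single 0 c + mon (single 0 1) * emb p"
  by (simp add: emb_def map_poly_pCons)

lemma emb_add: "emb (p + q) = emb p + emb q"
  by (induction p q rule: poly_induct2) (simp_all add: emb_pCons single_add algebra_simps)

lemma emb_smult: "emb (Polynomial.smult c p) = single 0 c * emb p"
  by (induction p) (simp_all add: emb_pCons mult_single algebra_simps)

lemma emb_mult: "emb (p * q) = emb p * emb q"
  by (induction p) (simp_all add: emb_pCons emb_add emb_smult algebra_simps)

lemma emb_one: "emb 1 = 1"
  using emb_pCons[of 1 0] by (simp add: one_pCons)

lemma emb_carrier: "emb p \<in> carrier (mpoly_ring m)"
  by (induction p) (use m_pos in \<open>auto simp: emb_pCons intro!: mpoly_carrier_add mpoly_carrier_mult\<close>)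

lemma emb_monom: "emb (Polynomial.monom c k) = single (single 0 k) c"
  by (induction k) (simp_all add: monom_0 monom_Suc emb_pCons mult_single single_add[symmetric])

definition apery :: "nat set" where
  "apery = {w \<in> sgp. w < n 0 \<or> w - n 0 \<notin> sgp}"

lemma finite_apery: "finite apery"
proof -
  have "finite (UNIV - sgp)" using cofinite by (simp add: sgp_def exps_def)
  moreover have "apery \<subseteq> {..<n 0} \<union> (\<lambda>s. s + n 0) ` (UNIV - sgp)"
  proof
    fix w assume "w \<in> apery"
    then have "w < n 0 \<or> w - n 0 \<notin> sgp" by (simp add: apery_def)
    then show "w \<in> {..<n 0} \<union> (\<lambda>s. s + n 0) ` (UNIV - sgp)"
      by (cases "w < n 0") (auto intro!: image_eqI[of _ _ "w - n 0"])
  qed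
  ultimately show ?thesis by (meson finite_Un finite_imageI finite_lessThan finite_subset)
qed

text \<open>The coefficients along the residue class of \<open>w\<close>. Along an element \<open>w\<close> of the Apery set they form a
  polynomial in \<open>x\<^sub>0\<close>, one of the coordinates of the graded ring over \<open>k[x\<^sub>0]\<close>.\<close>

definition kap :: "nat \<Rightarrow> 'k::field mp \<Rightarrow> 'k poly" where
  "kap w f = Abs_poly (\<lambda>j. coef f (w + j * n 0))"

lemma coeff_kap: "Polynomial.coeff (kap w f) j = coef f (w + j * n 0)"
proof -
  have "coef f (w + j * n 0) = 0" if j: "(\<Sum>a\<in>keys f. val a) < j" for j
    unfolding coef_def
  proof (rule sum.neutral, rule ballI)
    fix a assume a: "a \<in> keys f"
    have "val a \<le> (\<Sum>a\<in>keys f. val a)" by (rule member_le_sum) (use a in auto)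
    moreover have "j \<le> j * n 0" using n0_pos by simp
    ultimately have "val a \<noteq> w + j * n 0" using j by linarith
    then show "(if val a = w + j * n 0 \<and> deg a = max_len (w + j * n 0) then lookup f a else 0) = 0"
      by simp
  qed
  then show ?thesis unfolding kap_def by (subst coeff_Abs_poly) auto
qed

lemma kap_add: "kap w (f + g) = kap w f + kap w g"
  by (rule poly_eqI) (simp add: coeff_kap coef_add)

lemma kap_scale:
  assumes "f \<in> carrier (mpoly_ring m)" shows "kap w (single 0 c * f) = Polynomial.smult c (kap w f)"
proof -
  have "max_len 0 = 0" using max_len_mult_le[of 0] n0_pos by simp
  then show ?thesis by (intro poly_eqI) (simp add: coeff_kap coef_mono_mult assms)
qed

text \<open>Multiplication by \<open>x\<^sub>0\<close> moves \<open>t\<^sup>s\<close> to \<open>t\<^sup>s\<^sup>+\<^sup>n\<^sup>0\<close>, without loss since the greatest length grows by one.\<close>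

lemma kap_shift:
  assumes reg: "\<And>s. s \<in> sgp \<Longrightarrow> max_len (s + n 0) = Suc (max_len s)"
    and f: "f \<in> carrier (mpoly_ring m)" and w: "w \<in> apery"
  shows "kap w (mon (single 0 1) * f) = pCons 0 (kap w f)"
proof (rule poly_eqI)
  fix j
  let ?x = "mon (single 0 1) :: 'a mp"
  have x: "coef (?x * f) s = (if n 0 \<le> s \<and> 1 + max_len (s - n 0) = max_len s then coef f (s - n 0) else 0)" for s
    using coef_mono_mult[of "single 0 1" f 1 s] f m_pos by simp
  show "Polynomial.coeff (kap w (?x * f)) j = Polynomial.coeff (pCons 0 (kap w f)) j"
  proof (cases j)
    case 0
    have "w < n 0 \<or> w - n 0 \<notin> sgp" using w by (simp add: apery_def)
    then have "coef (?x * f) w = 0" unfolding x using coef_outside[OF f, of "w - n 0"] by auto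
    then show ?thesis using 0 by (simp add: coeff_kap)
  next
    case (Suc i)
    have "i * n 0 \<in> sgp" using val_sgp[of "single 0 i"] m_pos by (simp add: mult.commute)
    then have "w + i * n 0 \<in> sgp" using w sgp_add by (simp add: apery_def)
    then have "max_len ((w + i * n 0) + n 0) = Suc (max_len (w + i * n 0))" by (rule reg)
    moreover have s: "w + Suc i * n 0 = (w + i * n 0) + n 0" by simp
    ultimately show ?thesis unfolding Suc coeff_kap coeff_pCons_Suc x s by (simp del: add.assoc)
  qed
qed

lemma kap_emb:
  assumes reg: "\<And>s. s \<in> sgp \<Longrightarrow> max_len (s + n 0) = Suc (max_len s)"
    and f: "f \<in> carrier (mpoly_ring m)" and w: "w \<in> apery"
  shows "kap w (emb p * f) = p * kap w f"
proof (induction p)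
  case 0
  have "kap w 0 = 0" by (rule poly_eqI) (simp add: coeff_kap)
  then show ?case by simp
next
  case (pCons c p)
  have "emb (pCons c p) * f = single 0 c * f + mon (single 0 1) * (emb p * f)"
    by (simp add: emb_pCons algebra_simps)
  then have "kap w (emb (pCons c p) * f) = Polynomial.smult c (kap w f) + pCons 0 (kap w (emb p * f))"
    using kap_shift[OF reg mpoly_carrier_mult[OF emb_carrier f] w, of p]
    by (simp add: kap_add kap_scale[OF f])
  then show ?case using pCons by simp
qed

lemma apery_decomp:
  assumes "s \<in> sgp" obtains w j where "w \<in> apery" "s = w + j * n 0"
proof -
  have "\<exists>w\<in>apery. \<exists>j. s = w + j * n 0" using assms
  proof (induction s rule: less_induct)
    case (less s)
    show ?case
    proof (cases "s \<in> apery")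
      case True then show ?thesis by (intro bexI[of _ s] exI[of _ 0]) auto
    next
      case False
      then have s: "n 0 \<le> s" "s - n 0 \<in> sgp" using less.prems by (auto simp: apery_def)
      then obtain w j where "w \<in> apery" "s - n 0 = w + j * n 0" using less.IH[of "s - n 0"] n0_pos by auto
      then show ?thesis using s(1) by (intro bexI[of _ w] exI[of _ "Suc j"]) auto
    qed
  qed
  then show ?thesis using that by blast
qed

text \<open>A monomial is a power of \<open>x\<^sub>0\<close> or involves one of the nilpotent variables.\<close>

lemma \<Phi>_single_decomp:
  assumes a: "a \<in> exps"
  shows "\<exists>p. \<exists>y\<in>cring.nilradical (G :: (nat \<Rightarrow> 'k::field fps set) ring). \<Phi> (single a c) = add G (\<Phi> (emb p)) y"
proof -
  interpret G: cring "G :: (nat \<Rightarrow> 'k fps set) ring" by (rule G_cring)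
  show ?thesis
  proof (cases "drop0 a = 0")
    case True
    then have "a = single 0 (lookup a 0)" using drop0_split[of a] by simp
    then have "\<Phi> (single a c) = \<Phi> (emb (Polynomial.monom c (lookup a 0)))"
      unfolding emb_monom by simp
    moreover have "zero G \<in> G.nilradical"
      using additive_subgroup.zero_closed[OF ideal.axioms(1)[OF G.nilradical_ideal]] .
    ultimately show ?thesis
      using \<Phi>_carrier[OF emb_carrier, of "Polynomial.monom c (lookup a 0)"] G.r_zero by metis
  next
    case False
    then obtain i where i: "lookup (drop0 a) i \<noteq> 0" by (metis poly_mapping_eqI lookup_zero)
    then have i0: "0 < i" "lookup a i \<noteq> 0" by (auto simp: lookup_drop0 split: if_splits)
    then have "i \<in> keys a" by (simp add: in_keys_iff)
    then have im: "i < m" using a by (auto simp: exps_def)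
    let ?b = "a - single i 1"
    let ?y = "mon (single i 1) :: 'k mp" and ?z = "single ?b c :: 'k mp"
    have b: "?b \<in> exps" by (rule exps_minus[OF a])
    have "a = single i 1 + ?b" using i0 by (intro expo_add_single_diff) simp
    then have s: "single a c = ?y * ?z" by (metis mult_single mult_1)
    have yc: "?y \<in> carrier (mpoly_ring m)" "?z \<in> carrier (mpoly_ring m)" using b im by simp_all
    have "?y ^ n 0 \<in> tangent" unfolding mon_power by (rule power_in_tangent[OF i0(1) im])
    then have "\<Phi> (?y ^ n 0) = zero G" unfolding kernel_\<Phi>[symmetric] a_kernel_def' by blast
    then have "\<Phi> ?y \<in> G.nilradical"
      using \<Phi>_carrier[OF yc(1)] unfolding \<Phi>_power[OF yc(1)] G.nilradical_def by blast
    then have "\<Phi> ?z \<otimes>\<^bsub>G\<^esub> \<Phi> ?y \<in> G.nilradical" by (rule G.nilradical_mult[OF _ \<Phi>_carrier[OF yc(2)]])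
    then have n: "\<Phi> (single a c) \<in> G.nilradical"
      unfolding s by (simp only: \<Phi>_mult[OF yc(2,1), symmetric] mult.commute)
    have "\<Phi> (single a c) = add G (\<Phi> (emb 0)) (\<Phi> (single a c))"
      using G.nilradical_carrier[OF n] by (simp add: \<Phi>_zero)
    then show ?thesis using n by blast
  qed
qed

lemma \<Phi>_decomp:
  assumes f: "f \<in> carrier (mpoly_ring m)"
  shows "\<exists>p. \<exists>y\<in>cring.nilradical (G :: (nat \<Rightarrow> 'k::field fps set) ring). \<Phi> f = add G (\<Phi> (emb p)) y"
proof -
  interpret G: cring "G :: (nat \<Rightarrow> 'k fps set) ring" by (rule G_cring)
  have "\<exists>p. \<exists>y\<in>G.nilradical. \<Phi> (\<Sum>a\<in>S. single a (lookup f a)) = add G (\<Phi> (emb p)) y"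
    if "finite S" "S \<subseteq> exps" for S
    using that
  proof (induction S rule: finite_induct)
    case empty
    have "zero G \<in> G.nilradical"
      using additive_subgroup.zero_closed[OF ideal.axioms(1)[OF G.nilradical_ideal]] .
    then show ?case by (intro exI[of _ 0] bexI[of _ "zero G"]) (simp_all add: \<Phi>_zero)
  next
    case (insert x F)
    let ?t = "\<lambda>a. single a (lookup f a)"
    obtain p y where y: "y \<in> G.nilradical" "\<Phi> (\<Sum>a\<in>F. ?t a) = add G (\<Phi> (emb p)) y" using insert by blast
    obtain q z where z: "z \<in> G.nilradical" "\<Phi> (?t x) = add G (\<Phi> (emb q)) z"
      using \<Phi>_single_decomp[of x "lookup f x"] insert.prems by blast
    have c: "y \<in> carrier G" "z \<in> carrier G" using G.nilradical_carrier y(1) z(1) by auto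
    have e: "\<Phi> (emb r) \<in> carrier G" for r :: "'k poly" by (rule \<Phi>_carrier[OF emb_carrier])
    have "\<Phi> (\<Sum>a\<in>insert x F. ?t a) = add G (add G (\<Phi> (emb q)) z) (add G (\<Phi> (emb p)) y)"
      using insert(1,2) by (simp add: \<Phi>_add y(2) z(2))
    also have "\<dots> = add G (\<Phi> (emb (q + p))) (add G z y)"
      using c e by (simp add: emb_add \<Phi>_add G.a_ac)
    finally show ?case using G.nilradical_add[OF z(1) y(1)] by blast
  qed
  from this[of "keys f"] show ?thesis
    using f mpoly_eq_sum[of f] by (simp add: carrier_exps)
qed

theorem cohen_macaulay_G:
  assumes reg: "\<And>s. s \<in> sgp \<Longrightarrow> max_len (s + n 0) = Suc (max_len s)"
  shows "cohen_macaulay (G :: (nat \<Rightarrow> 'k::field fps set) ring)"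
proof -
  interpret G: cring "G :: (nat \<Rightarrow> 'k fps set) ring" by (rule G_cring)
  \<comment> \<open>The coordinates of an element are read off from a polynomial that represents it.\<close>
  define lift :: "(nat \<Rightarrow> 'k fps set) \<Rightarrow> 'k mp" where
    "lift g = (SOME f. f \<in> carrier (mpoly_ring m) \<and> \<Phi> f = g)" for g
  have lift: "lift g \<in> carrier (mpoly_ring m)" "\<Phi> (lift g) = g" if "g \<in> carrier G" for g
  proof -
    have "\<exists>f. f \<in> carrier (mpoly_ring m) \<and> \<Phi> f = g" using \<Phi>_surj[OF that] by blast
    then have "lift g \<in> carrier (mpoly_ring m) \<and> \<Phi> (lift g) = g" unfolding lift_def by (rule someI_ex)
    then show "lift g \<in> carrier (mpoly_ring m)" "\<Phi> (lift g) = g" by auto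
  qed
  have kap_cong: "kap w f = kap w g"
    if "f \<in> carrier (mpoly_ring m)" "g \<in> carrier (mpoly_ring m)" "\<Phi> f = \<Phi> g" for w and f g :: "'k mp"
    using that \<Phi>_eq_iff[of f g] by (intro poly_eqI) (simp add: coeff_kap)
  have ec: "\<Phi> (emb p) \<in> carrier G" for p :: "'k poly" by (rule \<Phi>_carrier[OF emb_carrier])
  interpret nilpotent_over_line "G :: (nat \<Rightarrow> 'k fps set) ring" "\<lambda>p. \<Phi> (emb p)" apery "\<lambda>w g. kap w (lift g)"
  proof
    fix p q :: "'k poly"
    show "\<Phi> (emb p) \<in> carrier G" by (rule ec)
    show "\<Phi> (emb (p + q)) = \<Phi> (emb p) \<oplus>\<^bsub>G\<^esub> \<Phi> (emb q)" by (simp add: emb_add \<Phi>_add)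
    show "\<Phi> (emb (p * q)) = \<Phi> (emb p) \<otimes>\<^bsub>G\<^esub> \<Phi> (emb q)" by (simp add: emb_mult \<Phi>_mult emb_carrier)
    show "\<Phi> (emb (1 :: 'k poly)) = \<one>\<^bsub>G\<^esub>" by (simp add: emb_one \<Phi>_one)
    show "\<one>\<^bsub>G\<^esub> \<noteq> (\<zero>\<^bsub>G :: (nat \<Rightarrow> 'k fps set) ring\<^esub>)"
      using \<iota>0_zero_iff[of "1 :: 'k"] by (simp add: \<Phi>_one)
    show "finite apery" by (rule finite_apery)
  next
    fix x y :: "nat \<Rightarrow> 'k fps set" and w assume xy: "x \<in> carrier G" "y \<in> carrier G"
    have "kap w (lift (x \<oplus>\<^bsub>G\<^esub> y)) = kap w (lift x + lift y)"
      by (rule kap_cong) (use lift xy in \<open>simp_all add: \<Phi>_add\<close>)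
    then show "kap w (lift (x \<oplus>\<^bsub>G\<^esub> y)) = kap w (lift x) + kap w (lift y)" by (simp add: kap_add)
  next
    fix x :: "nat \<Rightarrow> 'k fps set" and w p assume x: "x \<in> carrier G" and w: "w \<in> apery"
    have "kap w (lift (\<Phi> (emb p) \<otimes>\<^bsub>G\<^esub> x)) = kap w (emb p * lift x)"
      by (rule kap_cong) (use lift x ec[of p] emb_carrier[of p] in \<open>simp_all add: \<Phi>_mult\<close>)
    then show "kap w (lift (\<Phi> (emb p) \<otimes>\<^bsub>G\<^esub> x)) = p * kap w (lift x)"
      using kap_emb[OF reg lift(1)[OF x] w, of p] by simp
  next
    fix x :: "nat \<Rightarrow> 'k fps set" assume x: "x \<in> carrier G" and z: "\<And>w. w \<in> apery \<Longrightarrow> kap w (lift x) = 0"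
    have "coef (lift x) s = 0" for s
    proof (cases "s \<in> sgp")
      case True
      then obtain w j where w: "w \<in> apery" "s = w + j * n 0" using apery_decomp by metis
      then show ?thesis using coeff_kap[of w "lift x" j] z[OF w(1)] by simp
    next
      case False then show ?thesis by (rule coef_outside[OF lift(1)[OF x]])
    qed
    then have "\<Phi> (lift x) = \<Phi> 0" using \<Phi>_eq_iff[OF lift(1)[OF x] mpoly_carrier_zero] by simp
    then show "x = \<zero>\<^bsub>G\<^esub>" using lift(2)[OF x] by (simp add: \<Phi>_zero)
  next
    fix x :: "nat \<Rightarrow> 'k fps set" assume x: "x \<in> carrier G"
    obtain p y where "y \<in> G.nilradical" "\<Phi> (lift x) = \<Phi> (emb p) \<oplus>\<^bsub>G\<^esub> y"
      using \<Phi>_decomp[OF lift(1)[OF x]] by blast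
    then show "\<exists>p y (N::nat). y \<in> carrier G \<and> x = \<Phi> (emb p) \<oplus>\<^bsub>G\<^esub> y \<and> y [^]\<^bsub>G\<^esub> N = \<zero>\<^bsub>G\<^esub>"
      unfolding lift(2)[OF x] G.nilradical_def by blast
  qed
  show ?thesis by (rule cohen_macaulay)
qed

end

section \<open>The theorem\<close>

theorem theorem3:
  fixes \<Lambda> :: "nat set" and c d :: nat
    and G :: "(nat \<Rightarrow> 'k::field fps set) ring"
    and P :: "((nat \<Rightarrow>\<^sub>0 nat) \<Rightarrow>\<^sub>0 'k) ring"
    and J :: "((nat \<Rightarrow>\<^sub>0 nat) \<Rightarrow>\<^sub>0 'k) set"
  defines "G \<equiv> semigroup_gr \<Lambda>"
    and "P \<equiv> semigroup_poly_ring \<Lambda>"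
    and "J \<equiv> defining_ideal \<Lambda>"
  assumes "numerical_semigroup \<Lambda>"
    and "c \<ge> 2" and "d \<ge> 2"
    and "height P J = enat c"
    and "generated_in_degree_le (card (min_gens \<Lambda>)) d J"
    and "\<not> complete_intersection P J"
  shows "hs_multiplicity G \<le> of_nat d ^ c - (of_nat d - 1) * of_nat d ^ (c - 2) \<and>
    (hs_multiplicity G = of_nat d ^ c - (of_nat d - 1) * of_nat d ^ (c - 2) \<longrightarrow>
      cohen_macaulay G \<and> almost_complete_intersection P J)"
proof -
  let ?n = "min_gen \<Lambda>" and ?m = "card (min_gens \<Lambda>)"
  note gens = numerical_semigroup_generators[OF \<open>numerical_semigroup \<Lambda>\<close>]
  interpret L: monoid_generators ?n ?m by (rule gens(1))
  have sgp: "L.sgp = \<Lambda>" by (rule gens(2))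
  have mm: "(L.mm :: 'k fps set) = semigroup_max_ideal \<Lambda>"
    unfolding L.mm_def semigroup_max_ideal_def sgp using gens(3) by simp
  have G: "G = L.G" unfolding G_def semigroup_gr_def mm sgp ..
  have P: "P = mpoly_ring ?m" unfolding P_def semigroup_poly_ring_def ..
  have J: "J = L.tangent"
    unfolding J_def defining_ideal_def gr_presentation_def semigroup_poly_ring_def semigroup_gr_def
      L.kernel_presentation[symmetric] mm sgp ..
  have "enat (?m - 1) \<le> enat c" using L.height_tangent_ge[where ?'k = 'k] assms(7) unfolding J P by simp
  then have mc: "?m - 1 \<le> c" by simp
  note gen = assms(8)[unfolded J] and nci = assms(9)[unfolded J P]
  note bound = L.multiplicity_bound[OF \<open>d \<ge> 2\<close> \<open>c \<ge> 2\<close> mc gen nci]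
  have e: "hs_multiplicity G = of_nat (?n 0)" unfolding G by (rule L.hs_multiplicity_eq)
  have b: "(of_nat d ^ c - (of_nat d - 1) * of_nat d ^ (c - 2) :: rat) = of_nat (d ^ c - (d - 1) * d ^ (c - 2))"
    using bound_arith(3)[OF \<open>d \<ge> 2\<close> \<open>c \<ge> 2\<close>] \<open>d \<ge> 2\<close> by (simp add: of_nat_diff)
  show ?thesis
    unfolding e b
  proof (intro conjI impI)
    show "(of_nat (?n 0) :: rat) \<le> of_nat (d ^ c - (d - 1) * d ^ (c - 2))"
      using bound(1) by (simp only: of_nat_le_iff)
    assume "(of_nat (?n 0) :: rat) = of_nat (d ^ c - (d - 1) * d ^ (c - 2))"
    then have eq: "?n 0 = d ^ c - (d - 1) * d ^ (c - 2)" by (simp only: of_nat_eq_iff)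
    show "cohen_macaulay G" unfolding G by (rule L.cohen_macaulay_G) (use bound(2)[OF eq] in blast)
    show "almost_complete_intersection P J"
      unfolding almost_complete_intersection_def using assms(7) bound(2)[OF eq] unfolding J P by blast
  qed
qed

end
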